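(* Let $T$ be an endomorphism of $(X,\mathcal{A},\mu)$. Then $\widehat{T_{*}}$ preserves $\mathcal{I}_{1}$ and satisfies, for all $f\in L^{\Phi}(\mu)$, $$\widehat{T_{*}}I_{1}(f)=I_{1}(\widehat{T}_{\mathcal{P}}f).$$ Moreover $\widehat{T}_{\mathcal{P}}$ preserves $L^{1}(\mu)$ and coincides with $\widehat{T}$ on it.
   Context: $(X,\mathcal{A},\mu)$ is a non-atomic infinite Borel measure space, i.e. measurably isomorphic to the real line with its Borel sets and Lebesgue measure. An endomorphism $T$ is a measurable map $T:X\to X$ with $\mu(T^{-1}A)=\mu(A)$ for all $A\in\mathcal{A}$. Poisson space $(X^{*},\mathcal{A}^{*},\mu^{*})$: $X^{*}$ is the set of measures of the form $\sum_{i\in I}\delta_{x_i}$, $x_i\in X$, $I$ countable; $\mathcal{A}^{*}=\sigma\{N(A): A\in\mathcal{A}\}$ with $N(A)(\omega)=\omega(A)$; $\mu^{*}$ is the unique probability measure such that for pairwise disjoint $A_1,\dots,A_k\in\mathcal{A}$ of finite $\mu$-measure, $N(A_1),\dots,N(A_k)$ are independent and Poisson distributed with parameters $\mu(A_1),\dots,\mu(A_k)$. For $f\in L^1(\mu)$, $N(f)(\omega)=\int_X f\,d\omega$ and $\mu(f)=\int_X f\,d\mu$. $T_{*}:\omega\mapsto\omega\circ T^{-1}$ is an endomorphism of $(X^{*},\mathcal{A}^{*},\mu^{*})$ (the Poisson suspension). Let $\Phi(x)=x^{2}$ for $0\le x\le1$ and $\Phi(x)=2x-1$ for $x>1$; $L^{\Phi}(\mu)=\{f\in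 L^{0}(\mu):\int_X\Phi(|f|)\,d\mu<\infty\}$, which contains $L^1(\mu)$. For $f\in L^{\Phi}(\mu)$, $I_1(f):=\lim_{\epsilon\to0}\big(N(f1_{|f|>\epsilon})-\mu(f1_{|f|>\epsilon})\big)$ (limit in $\mu^{*}$-measure), an integrable centered random variable. $\mathcal{I}_1:=\{I_1(f):f\in L^{\Phi}(\mu)\}\subset L^{1}(\mu^{*})$. The Poisson-Orlicz norm $\|f\|_{*}:=\|I_1(f)\|_{L^{1}(\mu^{*})}$ makes $L^{\Phi}(\mu)$ a Banach space, with topological dual identified with $L^{2}(\mu)\cap L^{\infty}(\mu)$ via $(f,g)\mapsto\int_X fg\,d\mu$. Transfer operators: $\widehat{T}$ on $L^{1}(\mu)$ is characterized by $\int_X\widehat{T}f\cdot g\,d\mu=\int_X f\cdot g\circ T\,d\mu$ for $f\in L^{1}(\mu)$, $g\in L^{\infty}(\mu)$; $\widehat{T_{*}}$ on $L^{1}(\mu^{*})$ is the analogous transfer operator of $T_{*}$, characterized by $\mathbb{E}_{\mu^{*}}[\widehat{T_{*}}F\cdot G]=\mathbb{E}_{\mu^{*}}[F\cdot G\circ T_{*}]$ for $F\in L^{1}(\mu^{*})$, $G\in L^{\infty}(\mu^{*})$. The Poisson-transfer operator $\widehat{T}_{\mathcal{P}}$ on $L^{\Phi}(\mu)$ is characterized by $\int_X\widehat{T}_{\mathcal{P}}f\cdot g\,d\mu=\int_X f\cdot g\circ T\,d\mu$ for $f\in L^{\Phi}(\mu)$, $g\in L^{2}(\mu)\cap L^{\infty}(\mu)$.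 *)

theory Defs
  imports "HOL-Probability.Probability"
begin

text \<open>Elements of the various function spaces are represented by everywhere defined
  functions rather than by classes modulo null sets. Operators that are only determined
  almost everywhere pick some representative by Hilbert choice, and identities between such
  objects are to be stated almost everywhere.\<close>


section \<open>The base space and its endomorphisms\<close>

definition lebesgue_line_space :: "'a measure \<Rightarrow> bool" where
  "lebesgue_line_space M \<longleftrightarrow>
     (\<exists>\<phi> \<psi>. \<phi> \<in> M \<rightarrow>\<^sub>M (lborel :: real measure) \<and> \<psi> \<in> (lborel :: real measure) \<rightarrow>\<^sub>M M \<and>
        (\<forall>x\<in>space M. \<psi> (\<phi> x) = x) \<and> (\<forall>y. \<phi> (\<psi> y) = y) \<and>
        distr M lborel \<phi> = lborel)"

definition endomorphism :: "'a measure \<Rightarrow> ('a \<Rightarrow> 'a) \<Rightarrow> bool" where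
  "endomorphism M T \<longleftrightarrow>
     T \<in> M \<rightarrow>\<^sub>M M \<and> (\<forall>A\<in>sets M. emeasure M (T -` A \<inter> space M) = emeasure M A)"


section \<open>Poisson space\<close>

text \<open>\<open>return M x\<close> is the Dirac mass at \<open>x\<close>. A countable index set may be taken to be a set of
  natural numbers; points may be repeated.\<close>

definition configurations :: "'a measure \<Rightarrow> 'a measure set" where
  "configurations M =
     {\<omega>. sets \<omega> = sets M \<and>
        (\<exists>(I :: nat set) x. (\<forall>i\<in>I. x i \<in> space M) \<and>
           (\<forall>A\<in>sets M. emeasure \<omega> A = (\<Sum>\<^sub>\<infinity>i\<in>I. emeasure (return M (x i)) A)))}"

definition configuration_algebra :: "'a measure \<Rightarrow> 'a measure measure" where
  "configuration_algebra M =
     (SUP A\<in>sets M. vimage_algebra (configurations M) (\<lambda>\<omega>. emeasure \<omega> A) borel)"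

text \<open>\<open>poisson_measure M P\<close>: \<open>P\<close> is the law of the Poisson process with intensity \<open>M\<close>.
  The Poisson masses are written out because \<^const>\<open>poisson_pmf\<close> requires a strictly
  positive rate; for rate \<open>0\<close> they describe the point mass at \<open>0\<close>.\<close>

definition poisson_measure :: "'a measure \<Rightarrow> 'a measure measure \<Rightarrow> bool" where
  "poisson_measure M P \<longleftrightarrow>
     prob_space P \<and> sets P = sets (configuration_algebra M) \<and>
     (\<forall>(k :: nat) A.
        (\<forall>i<k. A i \<in> sets M \<and> emeasure M (A i) < \<infinity>) \<and> disjoint_family_on A {..<k} \<longrightarrow>
        prob_space.indep_vars P (\<lambda>_. borel) (\<lambda>i \<omega>. emeasure \<omega> (A i)) {..<k} \<and>
        (\<forall>i<k. \<forall>n :: nat.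
           measure P {\<omega>\<in>space P. emeasure \<omega> (A i) = of_nat n} =
             measure M (A i) ^ n / fact n * exp (- measure M (A i))))"

definition poisson_suspension :: "'a measure \<Rightarrow> ('a \<Rightarrow> 'a) \<Rightarrow> 'a measure \<Rightarrow> 'a measure" where
  "poisson_suspension M T = (\<lambda>\<omega>. distr \<omega> M T)"


section \<open>Function spaces\<close>

definition L1 :: "'a measure \<Rightarrow> ('a \<Rightarrow> real) set" where
  "L1 M = {f. integrable M f}"

definition L2 :: "'a measure \<Rightarrow> ('a \<Rightarrow> real) set" where
  "L2 M = {f \<in> borel_measurable M. integrable M (\<lambda>x. (f x)\<^sup>2)}"

definition Linfty :: "'a measure \<Rightarrow> ('a \<Rightarrow> real) set" where
  "Linfty M = {f \<in> borel_measurable M. \<exists>C. AE x in M. \<bar>f x\<bar> \<le> C}"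

text \<open>Only used for nonnegative arguments.\<close>

definition Phi :: "real \<Rightarrow> real" where
  "Phi x = (if x \<le> 1 then x\<^sup>2 else 2 * x - 1)"

definition LPhi :: "'a measure \<Rightarrow> ('a \<Rightarrow> real) set" where
  "LPhi M = {f \<in> borel_measurable M. (\<integral>\<^sup>+x. ennreal (Phi \<bar>f x\<bar>) \<partial>M) < \<infinity>}"


section \<open>The compensated Poisson integral\<close>

definition tendsto_in_measure ::
    "'a measure \<Rightarrow> ('i \<Rightarrow> 'a \<Rightarrow> real) \<Rightarrow> ('a \<Rightarrow> real) \<Rightarrow> 'i filter \<Rightarrow> bool" where
  "tendsto_in_measure P X Y F \<longleftrightarrow>
     (\<forall>\<delta>>0. ((\<lambda>i. measure P {\<omega>\<in>space P. \<bar>X i \<omega> - Y \<omega>\<bar> > \<delta>}) \<longlongrightarrow> 0) F)"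

definition truncate_small :: "real \<Rightarrow> ('a \<Rightarrow> real) \<Rightarrow> 'a \<Rightarrow> real" where
  "truncate_small \<epsilon> f = (\<lambda>x. if \<bar>f x\<bar> > \<epsilon> then f x else 0)"

definition I1 :: "'a measure \<Rightarrow> 'a measure measure \<Rightarrow> ('a \<Rightarrow> real) \<Rightarrow> 'a measure \<Rightarrow> real" where
  "I1 M P f = (SOME Y. Y \<in> borel_measurable P \<and>
     tendsto_in_measure P
       (\<lambda>\<epsilon> \<omega>. (\<integral>x. truncate_small \<epsilon> f x \<partial>\<omega>) - (\<integral>x. truncate_small \<epsilon> f x \<partial>M))
       Y (at_right 0))"

definition I1_space :: "'a measure \<Rightarrow> 'a measure measure \<Rightarrow> ('a measure \<Rightarrow> real) set" where
  "I1_space M P =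
     {F \<in> borel_measurable P. \<exists>f\<in>LPhi M. AE \<omega> in P. F \<omega> = I1 M P f \<omega>}"


section \<open>Transfer operators\<close>

definition transfer_op :: "'a measure \<Rightarrow> ('a \<Rightarrow> 'a) \<Rightarrow> ('a \<Rightarrow> real) \<Rightarrow> 'a \<Rightarrow> real" where
  "transfer_op M T f = (SOME h. h \<in> L1 M \<and>
     (\<forall>g\<in>Linfty M. (\<integral>x. h x * g x \<partial>M) = (\<integral>x. f x * g (T x) \<partial>M)))"

definition poisson_transfer_op :: "'a measure \<Rightarrow> ('a \<Rightarrow> 'a) \<Rightarrow> ('a \<Rightarrow> real) \<Rightarrow> 'a \<Rightarrow> real" where
  "poisson_transfer_op M T f = (SOME h. h \<in> LPhi M \<and>
     (\<forall>g\<in>L2 M \<inter> Linfty M. (\<integral>x. h x * g x \<partial>M) = (\<integral>x. f x * g (T x) \<partial>M)))"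

end

theory Submission
  imports Defs
begin

text \<open>The Mecke formula on a cylinder event \<open>{N(D\<^sub>1) = n\<^sub>1, \<dots>, N(D\<^sub>k) = n\<^sub>k}\<close> turns the
  expectation of \<open>N(f)\<close> on the event into the integral of \<open>f\<close> against a weight that depends only
  on the sets \<open>D\<^sub>i\<close>, their masses and the \<open>n\<^sub>i\<close>. The suspension \<open>T\<^sub>*\<close> pulls a cylinder back to the
  cylinder over the preimages, whose weight is the old one composed with \<open>T\<close>. Hence
  \<open>E[N(f) (G \<circ> T\<^sub>*)] = E[N(h) G]\<close> for integrable \<open>f \<ge> 0\<close> with transfer \<open>h\<close> and cylinder
  indicators \<open>G\<close>, and then for all bounded \<open>G\<close>. Centred Poisson integrals are isometric for the
  \<open>L\<^sup>2\<close> norms and the transfer operator contracts \<open>L\<^sup>2\<close>, so the identity passes from the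
  truncations of \<open>f\<close> to \<open>I\<^sub>1(f)\<close> in the limit.\<close>

section \<open>Configurations and the evaluation maps\<close>

text \<open>The definition of \<open>poisson_measure\<close> speaks only of disjoint sets of finite
  measure and of masses at natural numbers. So only cylinders over disjoint families have explicit
  probabilities, while stability under intersection needs cylinders over arbitrary finite families;
  the atoms of a family mediate between the two. The Mecke formula is kept on cylinders because
  there the effect of an added point is an explicit step function of its position, and no map that
  adds a point to a configuration has to be shown measurable. \<open>T\<close> need not be
  invertible, so the transfer of a nonnegative function is a Radon-Nikodym density, and signed
  functions go through their positive and negative parts. Members of \<open>LPhi M\<close> are in
  general neither integrable nor square integrable; the passage to the limit works because
  truncation splits them into an integrable part, where the Mecke argument applies, and a square
  integrable remainder, where the isometry does. Finally, \<open>I1\<close> and both transfer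
  operators are Hilbert choices, so each of them requires a candidate and uniqueness almost
  everywhere.\<close>

lemma emeasure_configuration_eq_of_nat:
  assumes "\<omega> \<in> configurations M" and "A \<in> sets M" and "emeasure \<omega> A \<noteq> \<infinity>"
  shows "\<exists>n :: nat. emeasure \<omega> A = of_nat n"
proof -
  obtain I :: "nat set" and x where x: "\<And>i. i \<in> I \<Longrightarrow> x i \<in> space M"
    and eq: "emeasure \<omega> A = (\<Sum>\<^sub>\<infinity>i\<in>I. emeasure (return M (x i)) A)"
    using assms(1,2) unfolding configurations_def by blast
  \<comment> \<open>Each Dirac mass contributes 0 or 1, so the mass of \<open>A\<close> is the
    number of indices in \<open>?J\<close>: a natural number if \<open>?J\<close> is finite,
    infinite otherwise.\<close>
  let ?J = "{i\<in>I. x i \<in> A}"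
  have "emeasure \<omega> A = (\<Sum>\<^sub>\<infinity>i\<in>?J. 1)"
    unfolding eq by (rule infsum_cong_neutral) (use x assms(2) in \<open>auto simp: indicator_def\<close>)
  moreover have "(\<Sum>\<^sub>\<infinity>i\<in>?J. 1 :: ennreal) = \<infinity>" if "infinite ?J"
    by (rule infsum_superconst_infinite_ennreal[of _ 1]) (use that in auto)
  ultimately show ?thesis
    using assms(3) by (cases "finite ?J") auto
qed

lemma distr_in_configurations:
  assumes "\<omega> \<in> configurations M" and T: "T \<in> M \<rightarrow>\<^sub>M M"
  shows "distr \<omega> M T \<in> configurations M"
proof -
  obtain I :: "nat set" and x where sets: "sets \<omega> = sets M"
    and x: "\<forall>i\<in>I. x i \<in> space M"
    and eq: "\<forall>A\<in>sets M. emeasure \<omega> A = (\<Sum>\<^sub>\<infinity>i\<in>I. emeasure (return M (x i)) A)"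
    using assms(1) unfolding configurations_def by blast
  have T': "T \<in> \<omega> \<rightarrow>\<^sub>M M"
    using T by (simp add: measurable_cong_sets[OF sets refl])
  have "emeasure (distr \<omega> M T) A = (\<Sum>\<^sub>\<infinity>i\<in>I. emeasure (return M (T (x i))) A)"
    if A: "A \<in> sets M" for A
  proof -
    have "emeasure (distr \<omega> M T) A = emeasure \<omega> (T -` A \<inter> space M)"
      using A T' by (simp add: emeasure_distr sets_eq_imp_space_eq[OF sets])
    also have "\<dots> = (\<Sum>\<^sub>\<infinity>i\<in>I. emeasure (return M (x i)) (T -` A \<inter> space M))"
      using eq measurable_sets[OF T A] by blast
    also have "\<dots> = (\<Sum>\<^sub>\<infinity>i\<in>I. emeasure (return M (T (x i))) A)"
      using x A measurable_sets[OF T A] by (intro infsum_cong) (auto simp: indicator_def)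
    finally show ?thesis .
  qed
  moreover have "\<forall>i\<in>I. T (x i) \<in> space M"
    using x measurable_space[OF T] by auto
  ultimately show ?thesis
    unfolding configurations_def by (auto intro!: exI[of _ I] exI[of _ "\<lambda>i. T (x i)"])
qed

lemma space_configuration_algebra: "space (configuration_algebra M) = configurations M"
  unfolding configuration_algebra_def by (simp add: space_Sup_eq_UN) (use sets.top in blast)

lemma measurable_emeasure_configuration:
  assumes "A \<in> sets M"
  shows "(\<lambda>\<omega>. emeasure \<omega> A) \<in> borel_measurable (configuration_algebra M)"
  unfolding configuration_algebra_def
  by (rule measurable_SUP1[OF assms]) (auto intro: measurable_vimage_algebra1)

lemma measurable_configuration_algebra:
  assumes "\<And>x. x \<in> space N \<Longrightarrow> f x \<in> configurations M"
    and "\<And>A. A \<in> sets M \<Longrightarrow> (\<lambda>x. emeasure (f x) A) \<in> borel_measurable N"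
  shows "f \<in> N \<rightarrow>\<^sub>M configuration_algebra M"
  unfolding configuration_algebra_def
  by (rule measurable_SUP2) (use assms in \<open>auto intro!: measurable_vimage_algebra2\<close>)

section \<open>Poisson weights: total mass, mean and convolution\<close>

definition poisson_mass :: "real \<Rightarrow> nat \<Rightarrow> real" where
  "poisson_mass l n = l ^ n / fact n * exp (- l)"

lemma poisson_mass_nonneg: "0 \<le> l \<Longrightarrow> 0 \<le> poisson_mass l n"
  by (simp add: poisson_mass_def)

text \<open>The size-bias identity: weighting a Poisson variable by its value shifts it by one and
  produces the factor \<open>l\<close>. It is the one-dimensional seed of the Mecke formula.\<close>

lemma poisson_mass_Suc: "real (Suc n) * poisson_mass l (Suc n) = l * poisson_mass l n"
  by (simp add: poisson_mass_def field_simps del: of_nat_Suc)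

lemma poisson_mass_sums: "poisson_mass l sums 1"
proof -
  have "(\<lambda>n. (l ^ n /\<^sub>R fact n) * exp (- l)) sums (exp l * exp (- l))"
    by (intro sums_mult2 exp_converges)
  moreover have "exp l * exp (- l) = 1"
    by (simp add: exp_minus)
  ultimately show ?thesis
    unfolding poisson_mass_def by (simp add: field_simps)
qed

lemma poisson_mass_mean: "(\<lambda>n. real n * poisson_mass l n) sums l"
proof -
  have "(\<lambda>n. real (Suc n) * poisson_mass l (Suc n)) sums (l * 1)"
    unfolding poisson_mass_Suc by (intro sums_mult poisson_mass_sums)
  \<comment> \<open>The term at index 0 vanishes, so the series and its shift have the same
    sum.\<close>
  then show ?thesis
    by (subst (asm) sums_Suc_iff) simp
qed

text \<open>The binomial theorem, read as the law of a sum of two independent Poisson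
  counts.\<close>

lemma poisson_mass_binomial:
  "(\<Sum>k\<le>n. poisson_mass a k * poisson_mass b (n - k)) = poisson_mass (a + b) n"
proof -
  have "(\<Sum>k\<le>n. poisson_mass a k * poisson_mass b (n - k))
      = (\<Sum>k\<le>n. of_nat (n choose k) * a ^ k * b ^ (n - k)) / fact n * exp (- (a + b))"
    unfolding sum_divide_distrib sum_distrib_right
  proof (rule sum.cong)
    fix k assume "k \<in> {..n}"
    then show "poisson_mass a k * poisson_mass b (n - k)
        = of_nat (n choose k) * a ^ k * b ^ (n - k) / fact n * exp (- (a + b))"
      by (simp add: poisson_mass_def binomial_fact exp_add[symmetric] mult_ac divide_simps)
  qed simp
  then show ?thesis
    by (simp add: poisson_mass_def binomial_ring)
qed

section \<open>Counts, integrals and the suspension as measurable maps on Poisson space\<close>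

locale poisson_space = sigma_finite_measure M for M :: "'a measure" +
  fixes P :: "'a measure measure"
  assumes poisson: "poisson_measure M P"
begin

sublocale P: prob_space P
  using poisson by (simp add: poisson_measure_def)

lemma sets_P: "sets P = sets (configuration_algebra M)"
  using poisson by (simp add: poisson_measure_def)

lemma space_P: "space P = configurations M"
  using sets_eq_imp_space_eq[OF sets_P] by (simp add: space_configuration_algebra)

lemma sets_config: "\<omega> \<in> space P \<Longrightarrow> sets \<omega> = sets M"
  by (auto simp: space_P configurations_def)

lemma space_config: "\<omega> \<in> space P \<Longrightarrow> space \<omega> = space M"
  by (rule sets_eq_imp_space_eq[OF sets_config])

lemma measurable_config: "\<omega> \<in> space P \<Longrightarrow> f \<in> M \<rightarrow>\<^sub>M N \<Longrightarrow> f \<in> \<omega> \<rightarrow>\<^sub>M N"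
  by (simp add: measurable_cong_sets[OF sets_config refl])

lemma measurable_count [measurable]:
  "A \<in> sets M \<Longrightarrow> (\<lambda>\<omega>. emeasure \<omega> A) \<in> borel_measurable P"
  using measurable_emeasure_configuration[of A M] by (simp add: measurable_cong_sets[OF sets_P refl])

lemma count_eq_of_nat:
  "\<omega> \<in> space P \<Longrightarrow> A \<in> sets M \<Longrightarrow> emeasure \<omega> A \<noteq> \<infinity> \<Longrightarrow> \<exists>n :: nat. emeasure \<omega> A = of_nat n"
  by (rule emeasure_configuration_eq_of_nat) (simp_all add: space_P)

lemma suspension_measurable:
  assumes T: "T \<in> M \<rightarrow>\<^sub>M M"
  shows "poisson_suspension M T \<in> P \<rightarrow>\<^sub>M P"
proof -
  have "poisson_suspension M T \<in> P \<rightarrow>\<^sub>M configuration_algebra M"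
  proof (rule measurable_configuration_algebra)
    show "poisson_suspension M T \<omega> \<in> configurations M" if "\<omega> \<in> space P" for \<omega>
      using that distr_in_configurations[OF _ T] by (simp add: space_P poisson_suspension_def)
    fix A assume A: "A \<in> sets M"
    have "(\<lambda>\<omega>. emeasure \<omega> (T -` A \<inter> space M)) \<in> borel_measurable P"
      using measurable_sets[OF T A] by measurable
    then show "(\<lambda>\<omega>. emeasure (poisson_suspension M T \<omega>) A) \<in> borel_measurable P"
      by (rule measurable_cong[THEN iffD1, rotated])
        (simp add: poisson_suspension_def emeasure_distr measurable_config[OF _ T] A space_config)
  qed
  then show ?thesis
    by (simp add: measurable_cong_sets[OF refl sets_P])
qed

lemma emeasure_suspension:
  assumes "T \<in> M \<rightarrow>\<^sub>M M" "\<omega> \<in> space P" "A \<in> sets M"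
  shows "emeasure (poisson_suspension M T \<omega>) A = emeasure \<omega> (T -` A \<inter> space M)"
  using assms by (simp add: poisson_suspension_def emeasure_distr measurable_config space_config)

lemma nn_integral_measurable [measurable]:
  assumes "f \<in> borel_measurable M"
  shows "(\<lambda>\<omega>. \<integral>\<^sup>+x. f x \<partial>\<omega>) \<in> borel_measurable P"
  using assms
proof (induction rule: borel_measurable_induct)
  case (cong f g)
  then show ?case
    by (subst measurable_cong[where g="\<lambda>\<omega>. integral\<^sup>N \<omega> g"])
      (auto intro!: nn_integral_cong simp: space_config)
next
  case (set A)
  then show ?case
    by (subst measurable_cong[where g="\<lambda>\<omega>. emeasure \<omega> A"]) (auto simp: sets_config)
next
  case (mult u c)
  then show ?case
    by (subst measurable_cong[where g="\<lambda>\<omega>. c * integral\<^sup>N \<omega> u"])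
      (auto intro!: nn_integral_cmult measurable_config)
next
  case (add u v)
  then show ?case
    by (subst measurable_cong[where g="\<lambda>\<omega>. integral\<^sup>N \<omega> v + integral\<^sup>N \<omega> u"])
      (auto intro!: nn_integral_add measurable_config)
next
  case (seq U)
  have "integral\<^sup>N \<omega> (\<Squnion> range U) = (SUP i. integral\<^sup>N \<omega> (U i))" if "\<omega> \<in> space P" for \<omega>
    unfolding SUP_apply[abs_def]
    by (rule nn_integral_monotone_convergence_SUP) (use seq in \<open>auto intro: measurable_config[OF that]\<close>)
  moreover have "(\<lambda>\<omega>. SUP i. integral\<^sup>N \<omega> (U i)) \<in> borel_measurable P"
    using seq by (intro borel_measurable_SUP) auto
  ultimately show ?case
    by (subst measurable_cong) auto
qed

lemma integral_measurable [measurable]: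
  assumes [measurable]: "f \<in> borel_measurable M"
  shows "(\<lambda>\<omega>. \<integral>x. f x \<partial>\<omega> :: real) \<in> borel_measurable P"
proof -
  \<comment> \<open>The measure of integration varies with \<omega>, and the Bochner integral takes
    the value 0 where \<open>f\<close> is not integrable. The case distinction expresses everything
    through nonnegative integrals, whose measurability in \<omega> is known.\<close>
  have "(\<integral>x. f x \<partial>\<omega>) = (if (\<integral>\<^sup>+x. ennreal \<bar>f x\<bar> \<partial>\<omega>) < \<infinity>
      then enn2real (\<integral>\<^sup>+x. ennreal (f x) \<partial>\<omega>) - enn2real (\<integral>\<^sup>+x. ennreal (- f x) \<partial>\<omega>) else 0)"
    if "\<omega> \<in> space P" for \<omega>
  proof -
    have "integrable \<omega> f \<longleftrightarrow> (\<integral>\<^sup>+x. ennreal \<bar>f x\<bar> \<partial>\<omega>) < \<infinity>"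
      using measurable_config[OF that assms] by (simp add: integrable_iff_bounded)
    then show ?thesis
      by (auto simp: real_lebesgue_integral_def not_integrable_integral_eq)
  qed
  then show ?thesis
    by (subst measurable_cong) (assumption, measurable)
qed

text \<open>The sets form an indexed family rather than a collection: preimages under
  \<open>T\<close> keep the index set and the prescribed counts even if several of them become
  empty, and a further set is added by enlarging the index set.\<close>

definition cyl :: "'i set \<Rightarrow> ('i \<Rightarrow> 'a set) \<Rightarrow> ('i \<Rightarrow> nat) \<Rightarrow> 'a measure set" where
  "cyl J D n = {\<omega>\<in>space P. \<forall>j\<in>J. emeasure \<omega> (D j) = of_nat (n j)}"

definition disjoint_finite :: "'i set \<Rightarrow> ('i \<Rightarrow> 'a set) \<Rightarrow> bool" where
  "disjoint_finite J D \<longleftrightarrow> finite J \<and> disjoint_family_on D J \<and>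
     (\<forall>j\<in>J. D j \<in> sets M \<and> emeasure M (D j) < \<infinity>)"

lemma cyl_sets [measurable]:
  "finite J \<Longrightarrow> (\<And>j. j \<in> J \<Longrightarrow> D j \<in> sets M) \<Longrightarrow> cyl J D n \<in> sets P"
  unfolding cyl_def by measurable

lemma prob_cyl:
  assumes "disjoint_finite J D"
  shows "P.prob (cyl J D n) = (\<Prod>j\<in>J. poisson_mass (measure M (D j)) (n j))"
proof (cases "J = {}")
  case True
  then show ?thesis by (simp add: cyl_def P.prob_space)
next
  case False
  have fin: "finite J" and dis: "disjoint_family_on D J"
    and D: "\<And>j. j \<in> J \<Longrightarrow> D j \<in> sets M \<and> emeasure M (D j) < \<infinity>"
    using assms by (auto simp: disjoint_finite_def)
  \<comment> \<open>Independence is postulated for families indexed by an initial segment of the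
    naturals, so \<open>J\<close> is enumerated; the factorisation is for nonempty families, hence
    the separate case of empty \<open>J\<close>.\<close>
  obtain e where e: "bij_betw e {..<card J} J"
    using ex_bij_betw_nat_finite[OF fin] by (auto simp: atLeast0LessThan)
  have eJ: "e i \<in> J" if "i < card J" for i
    using e that by (auto simp: bij_betw_def)
  have dis': "disjoint_family_on (\<lambda>i. D (e i)) {..<card J}"
    using dis e unfolding disjoint_family_on_def bij_betw_def
    by (metis (no_types, lifting) inj_onD imageI)
  have "\<forall>i<card J. D (e i) \<in> sets M \<and> emeasure M (D (e i)) < \<infinity>"
    using D eJ by blast
  from poisson[unfolded poisson_measure_def, THEN conjunct2, THEN conjunct2,
      rule_format, OF conjI, OF this dis']
  have ind: "P.indep_vars (\<lambda>_. borel) (\<lambda>i \<omega>. emeasure \<omega> (D (e i))) {..<card J}"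
    and mass: "\<And>i m. i < card J \<Longrightarrow> P.prob {\<omega> \<in> space P. emeasure \<omega> (D (e i)) = of_nat m}
       = poisson_mass (measure M (D (e i))) m"
    by (auto simp: poisson_mass_def)
  have "cyl J D n = (\<Inter>i\<in>{..<card J}. (\<lambda>\<omega>. emeasure \<omega> (D (e i))) -` {of_nat (n (e i))} \<inter> space P)"
  proof -
    have "J = e ` {..<card J}" using e by (simp add: bij_betw_def)
    moreover from this False have "{..<card J} \<noteq> {}" by auto
    ultimately show ?thesis
      unfolding cyl_def by auto (metis imageE lessThan_iff)
  qed
  then have "P.prob (cyl J D n) = (\<Prod>i<card J. P.prob ((\<lambda>\<omega>. emeasure \<omega> (D (e i))) -` {of_nat (n (e i))} \<inter> space P))"
    using False fin
    by (simp only:, intro P.indep_varsD_finite[OF ind]) (auto simp: lessThan_empty_iff)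
  also have "\<dots> = (\<Prod>i<card J. poisson_mass (measure M (D (e i))) (n (e i)))"
    by (intro prod.cong refl) (simp add: mass[symmetric] vimage_def Int_def conj_commute)
  also have "\<dots> = (\<Prod>j\<in>J. poisson_mass (measure M (D j)) (n j))"
    by (rule prod.reindex_bij_betw[OF e])
  finally show ?thesis .
qed

section \<open>The Mecke formula on cylinder events\<close>

lemma emeasure_cyl:
  "disjoint_finite J D \<Longrightarrow> emeasure P (cyl J D n) = ennreal (\<Prod>j\<in>J. poisson_mass (measure M (D j)) (n j))"
  by (simp add: P.emeasure_eq_measure prob_cyl)

lemma disjoint_cyl_sets [measurable]: "disjoint_finite J D \<Longrightarrow> cyl J D n \<in> sets P"
  by (rule cyl_sets) (auto simp: disjoint_finite_def)

lemma prob_count: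
  assumes "A \<in> sets M" "emeasure M A < \<infinity>"
  shows "P.prob {\<omega>\<in>space P. emeasure \<omega> A = of_nat n} = poisson_mass (measure M A) n"
  using prob_cyl[of "{()}" "\<lambda>_. A" "\<lambda>_. n"] assms
  by (simp add: cyl_def disjoint_finite_def disjoint_family_on_def)

text \<open>The events that the count equals \<open>n\<close> are disjoint and their Poisson masses
  already sum to 1, which leaves probability 0 for an infinite count.\<close>

lemma AE_count_finite:
  assumes A[measurable]: "A \<in> sets M" and fin: "emeasure M A < \<infinity>"
  shows "AE \<omega> in P. emeasure \<omega> A < \<infinity>"
proof -
  define S where "S n = {\<omega>\<in>space P. emeasure \<omega> A = of_nat n}" for n :: nat
  have [measurable]: "S n \<in> sets P" for n
    unfolding S_def by measurable
  have "(\<lambda>n. P.prob (S n)) sums P.prob (\<Union>n. S n)"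
    by (rule P.finite_measure_UNION) (auto simp: S_def disjoint_family_on_def)
  moreover have "(\<lambda>n. P.prob (S n)) sums 1"
    unfolding S_def prob_count[OF assms] by (rule poisson_mass_sums)
  ultimately have "P.prob (\<Union>n. S n) = 1"
    by (rule sums_unique2)
  then have "AE \<omega> in P. \<omega> \<in> (\<Union>n. S n)"
    by (intro P.AE_prob_1)
  then show ?thesis
    by eventually_elim (auto simp: S_def ennreal_of_nat_eq_real_of_nat)
qed

text \<open>Almost surely exactly one of the indicators is nonzero, the one at the true count. A
  factor \<open>N(A)\<close> is thereby traded for a series of cylinder events over
  \<open>A\<close>.\<close>

lemma nn_integral_count_times:
  assumes A[measurable]: "A \<in> sets M" and fin: "emeasure M A < \<infinity>"
    and [measurable]: "Z \<in> borel_measurable P"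
  shows "(\<integral>\<^sup>+\<omega>. emeasure \<omega> A * Z \<omega> \<partial>P)
    = (\<Sum>k. of_nat k * (\<integral>\<^sup>+\<omega>. Z \<omega> * indicator {\<omega>\<in>space P. emeasure \<omega> A = of_nat k} \<omega> \<partial>P))"
proof -
  have "(\<integral>\<^sup>+\<omega>. emeasure \<omega> A * Z \<omega> \<partial>P)
    = (\<integral>\<^sup>+\<omega>. (\<Sum>k. of_nat k * (Z \<omega> * indicator {\<omega>\<in>space P. emeasure \<omega> A = of_nat k} \<omega>)) \<partial>P)"
  proof (rule nn_integral_cong_AE, use AE_count_finite[OF A fin] AE_space in eventually_elim)
    case (elim \<omega>)
    then have "emeasure \<omega> A \<noteq> \<infinity>"
      by auto
    then obtain n :: nat where n: "emeasure \<omega> A = of_nat n"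
      using count_eq_of_nat[OF elim(2) A] by blast
    have "(\<Sum>k. of_nat k * (Z \<omega> * indicator {\<omega>\<in>space P. emeasure \<omega> A = of_nat k} \<omega>))
        = (\<Sum>k\<in>{n}. of_nat k * (Z \<omega> * indicator {\<omega>\<in>space P. emeasure \<omega> A = of_nat k} \<omega>))"
      by (rule suminf_finite) (auto simp: indicator_def n)
    then show ?case
      using elim by (simp add: n)
  qed
  then show ?thesis
    by (simp add: nn_integral_suminf nn_integral_cmult)
qed

text \<open>The count of \<open>B\<close> is independent of the counts of the sets
  \<open>D j\<close> and has mean \<open>emeasure M B\<close>. In the proof \<open>B\<close> joins
  the family under the new index \<open>None\<close>, and the sum over its counts is the Poisson
  mean.\<close>

lemma nn_integral_count_outside:
  assumes D: "disjoint_finite J D" and B[measurable]: "B \<in> sets M" and fin: "emeasure M B < \<infinity>"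
    and dis: "\<And>j. j \<in> J \<Longrightarrow> B \<inter> D j = {}"
  shows "(\<integral>\<^sup>+\<omega>. emeasure \<omega> B * indicator (cyl J D n) \<omega> \<partial>P) = emeasure M B * emeasure P (cyl J D n)"
proof -
  let ?J = "insert None (Some ` J)" and ?D = "\<lambda>i. case i of None \<Rightarrow> B | Some j \<Rightarrow> D j"
    and ?n = "\<lambda>k i. case i of None \<Rightarrow> k | Some j \<Rightarrow> n j"
  let ?b = "measure M B" and ?p = "P.prob (cyl J D n)"
  have Jfin: "finite J" and [measurable]: "\<And>j. j \<in> J \<Longrightarrow> D j \<in> sets M"
    using D by (auto simp: disjoint_finite_def)
  have D': "disjoint_finite ?J ?D"
    using D B fin dis by (auto simp: disjoint_finite_def disjoint_family_on_def)
  have set: "cyl J D n \<inter> {\<omega>\<in>space P. emeasure \<omega> B = of_nat k} = cyl ?J ?D (?n k)" for k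
    by (auto simp: cyl_def)
  have "(\<integral>\<^sup>+\<omega>. indicator (cyl J D n) \<omega> * indicator {\<omega>\<in>space P. emeasure \<omega> B = of_nat k} \<omega> \<partial>P)
      = ennreal (poisson_mass ?b k * ?p)" for k
  proof -
    have "emeasure P (cyl ?J ?D (?n k)) = ennreal (poisson_mass ?b k * ?p)"
      unfolding emeasure_cyl[OF D'] prob_cyl[OF D] using Jfin
      by (subst prod.insert) (auto simp: prod.reindex)
    then show ?thesis
      using disjoint_cyl_sets[OF D'] by (simp add: indicator_inter_arith[symmetric] set)
  qed
  moreover have "(\<Sum>k. of_nat k * ennreal (poisson_mass ?b k * ?p)) = ennreal (?b * ?p)"
  proof -
    have "(\<lambda>k. real k * poisson_mass ?b k * ?p) sums (?b * ?p)"
      by (intro sums_mult2 poisson_mass_mean)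
    then have "(\<Sum>k. ennreal (real k * poisson_mass ?b k * ?p)) = ennreal (?b * ?p)"
      by (intro suminf_ennreal_eq) (auto intro!: mult_nonneg_nonneg poisson_mass_nonneg)
    then show ?thesis
      by (simp add: ennreal_of_nat_eq_real_of_nat ennreal_mult'[symmetric] mult_ac)
  qed
  ultimately show ?thesis
    using Jfin fin by (subst nn_integral_count_times)
      (auto simp: emeasure_eq_ennreal_measure P.emeasure_eq_measure ennreal_mult)
qed

text \<open>Split \<open>D j\<close> into \<open>B\<close> and \<open>D j - B\<close>, with counts
  \<open>k\<close> and \<open>n j - k\<close>. Size bias removes one point from \<open>B\<close> at
  the price of its measure, and convolution reassembles \<open>D j\<close> with one point fewer. The
  case \<open>n j = 0\<close> is separate because \<open>n j - 1\<close> would truncate to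
  0.\<close>

lemma nn_integral_count_inside:
  assumes D: "disjoint_finite J D" and B[measurable]: "B \<in> sets M" and j: "j \<in> J" "B \<subseteq> D j"
  shows "(\<integral>\<^sup>+\<omega>. emeasure \<omega> B * indicator (cyl J D n) \<omega> \<partial>P)
    = emeasure M B * (if n j = 0 then 0 else emeasure P (cyl J D (n(j := n j - 1))))"
proof -
  let ?J = "insert None (Some ` J)" and ?D = "\<lambda>i. case i of None \<Rightarrow> B | Some i \<Rightarrow> if i = j then D j - B else D i"
    and ?n = "\<lambda>k i. case i of None \<Rightarrow> k | Some i \<Rightarrow> if i = j then n j - k else n i"
  let ?a = "measure M B" and ?b = "measure M (D j - B)"
  let ?p = "\<Prod>i\<in>J - {j}. poisson_mass (measure M (D i)) (n i)"
  have Jfin: "finite J" and [measurable]: "\<And>j. j \<in> J \<Longrightarrow> D j \<in> sets M" and Dj: "emeasure M (D j) < \<infinity>"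
    using D j by (auto simp: disjoint_finite_def)
  have fin: "emeasure M B < \<infinity>" and fin': "emeasure M (D j - B) < \<infinity>"
    using Dj j emeasure_mono[of B "D j" M] emeasure_mono[of "D j - B" "D j" M]
    by (auto simp: le_less_trans)
  have D': "disjoint_finite ?J ?D"
    using D B fin fin' j by (fastforce simp: disjoint_finite_def disjoint_family_on_def)
  have mj: "measure M (D j) = ?a + ?b"
    using j Dj fin measure_Union[of M B "D j - B"] fin' by (auto simp: Un_absorb1)
  have p0: "0 \<le> ?p"
    by (intro prod_nonneg) (auto intro: poisson_mass_nonneg)
  \<comment> \<open>For \<open>k > n j\<close> the intersection is empty, since \<open>B\<close>
    cannot hold more points than \<open>D j\<close>; the truncated difference \<open>n j - k\<close>
    would hide this. An infinite count in \<open>D j - B\<close> is excluded by the finite count in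
    \<open>D j\<close>.\<close>
  have set: "cyl J D n \<inter> {\<omega>\<in>space P. emeasure \<omega> B = of_nat k}
      = (if k \<le> n j then cyl ?J ?D (?n k) else {})" for k
  proof -
    have "emeasure \<omega> (D j) = of_nat (n j) \<longleftrightarrow> k \<le> n j \<and> emeasure \<omega> (D j - B) = of_nat (n j - k)"
      if \<omega>: "\<omega> \<in> space P" and k: "emeasure \<omega> B = of_nat k" for \<omega>
    proof -
      have "emeasure \<omega> (D j) = of_nat k + emeasure \<omega> (D j - B)"
        using \<omega> j plus_emeasure[of B \<omega> "D j - B"] by (auto simp: k sets_config Un_absorb1)
      moreover obtain m :: nat where "emeasure \<omega> (D j - B) = of_nat m \<or> emeasure \<omega> (D j - B) = \<infinity>"
        using count_eq_of_nat[OF \<omega>, of "D j - B"] j by auto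
      moreover have "(of_nat k + of_nat m = (of_nat (n j) :: ennreal)) \<longleftrightarrow> k + m = n j"
        by (metis of_nat_add of_nat_eq_iff)
      ultimately show ?thesis
        by (auto simp: add_top)
    qed
    then have iff: "\<omega> \<in> cyl J D n \<longleftrightarrow> k \<le> n j \<and> \<omega> \<in> cyl ?J ?D (?n k)"
      if "\<omega> \<in> space P" "emeasure \<omega> B = of_nat k" for \<omega>
      using that j(1) by (auto simp: cyl_def)
    have sub: "\<omega> \<in> space P \<and> emeasure \<omega> B = of_nat k" if "\<omega> \<in> cyl ?J ?D (?n k)" for \<omega>
      using that by (simp add: cyl_def)
    show ?thesis
      by (cases "k \<le> n j") (use iff sub in auto)
  qed
  have "(\<integral>\<^sup>+\<omega>. indicator (cyl J D n) \<omega> * indicator {\<omega>\<in>space P. emeasure \<omega> B = of_nat k} \<omega> \<partial>P)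
      = ennreal (if k \<le> n j then poisson_mass ?a k * poisson_mass ?b (n j - k) * ?p else 0)" for k
  proof -
    have "emeasure P (cyl ?J ?D (?n k)) = ennreal (poisson_mass ?a k * poisson_mass ?b (n j - k) * ?p)"
    proof -
      have "(\<Prod>i\<in>Some ` J. poisson_mass (measure M (?D i)) (?n k i))
         = poisson_mass ?b (n j - k) * ?p"
        using Jfin j by (subst prod.reindex) (auto simp: prod.remove intro!: prod.cong)
      then show ?thesis
        unfolding emeasure_cyl[OF D'] using Jfin by (subst prod.insert) (auto simp: mult_ac)
    qed
    then show ?thesis
      using disjoint_cyl_sets[OF D'] by (simp add: indicator_inter_arith[symmetric] set)
  qed
  moreover have "(\<Sum>k. of_nat k * ennreal (if k \<le> n j then poisson_mass ?a k * poisson_mass ?b (n j - k) * ?p else 0))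
    = ennreal (\<Sum>k\<le>n j. real k * poisson_mass ?a k * poisson_mass ?b (n j - k) * ?p)"
  proof -
    have "(\<Sum>k. of_nat k * ennreal (if k \<le> n j then poisson_mass ?a k * poisson_mass ?b (n j - k) * ?p else 0))
      = (\<Sum>k\<le>n j. ennreal (real k * poisson_mass ?a k * poisson_mass ?b (n j - k) * ?p))"
      by (subst suminf_finite[of "{..n j}"])
        (auto simp: ennreal_of_nat_eq_real_of_nat ennreal_mult'[symmetric] mult_ac)
    then show ?thesis
      using p0 by (subst sum_ennreal[symmetric]) (auto intro!: mult_nonneg_nonneg poisson_mass_nonneg)
  qed
  \<comment> \<open>The term \<open>k = 0\<close> vanishes, which settles \<open>n j = 0\<close>.
    For \<open>n j = Suc m\<close> the index shift turns \<open>real k\<close> times the mass at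
    \<open>k\<close> into \<open>?a\<close> times the mass at \<open>k - 1\<close>, and the
    remaining sum is a convolution with total rate \<open>?a + ?b\<close>.\<close>
  moreover have "(\<Sum>k\<le>n j. real k * poisson_mass ?a k * poisson_mass ?b (n j - k) * ?p)
    = (if n j = 0 then 0 else ?a * P.prob (cyl J D (n(j := n j - 1))))"
  proof (cases "n j")
    case (Suc m)
    have "(\<Sum>k\<le>Suc m. real k * poisson_mass ?a k * poisson_mass ?b (Suc m - k) * ?p)
       = (\<Sum>k\<le>m. real (Suc k) * poisson_mass ?a (Suc k) * poisson_mass ?b (m - k) * ?p)"
      by (subst sum.atMost_Suc_shift) (simp del: of_nat_Suc)
    also have "\<dots> = ?a * (\<Sum>k\<le>m. poisson_mass ?a k * poisson_mass ?b (m - k)) * ?p"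
      by (simp add: poisson_mass_Suc sum_distrib_left sum_distrib_right mult_ac del: of_nat_Suc)
    also have "\<dots> = ?a * (poisson_mass (measure M (D j)) m * ?p)"
      unfolding poisson_mass_binomial mj by simp
    also have "poisson_mass (measure M (D j)) m * ?p = P.prob (cyl J D (n(j := n j - 1)))"
      unfolding prob_cyl[OF D] using Jfin j Suc by (auto simp: prod.remove intro!: prod.cong)
    finally show ?thesis
      by (simp add: Suc)
  qed simp
  ultimately show ?thesis
    using Jfin fin by (subst nn_integral_count_times)
      (auto simp: emeasure_eq_ennreal_measure P.emeasure_eq_measure ennreal_mult)
qed

text \<open>For a point \<open>x\<close> of the base space this is the probability that the Poisson process with one
  point added at \<open>x\<close> lies in the cylinder.\<close>

definition cyl_weight :: "'i set \<Rightarrow> ('i \<Rightarrow> 'a set) \<Rightarrow> ('i \<Rightarrow> nat) \<Rightarrow> 'a \<Rightarrow> ennreal" where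
  "cyl_weight J D n x =
     (\<Sum>j\<in>J. (if n j = 0 then 0 else emeasure P (cyl J D (n(j := n j - 1)))) * indicator (D j) x)
     + emeasure P (cyl J D n) * indicator (space M - (\<Union>j\<in>J. D j)) x"

lemma cyl_weight_measurable [measurable]:
  "disjoint_finite J D \<Longrightarrow> cyl_weight J D n \<in> borel_measurable M"
  unfolding cyl_weight_def disjoint_finite_def
  by (intro borel_measurable_add borel_measurable_sum borel_measurable_times_ennreal
      borel_measurable_indicator borel_measurable_const sets.Diff sets.finite_UN sets.top) auto

text \<open>Cut \<open>B\<close> along the sets \<open>D j\<close>: each piece inside some
  \<open>D j\<close> yields a summand of \<open>cyl_weight\<close>, and the rest of \<open>B\<close>
  yields the last term by independence.\<close>

lemma nn_integral_count_cyl: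
  assumes D: "disjoint_finite J D" and B[measurable]: "B \<in> sets M" and fin: "emeasure M B < \<infinity>"
  shows "(\<integral>\<^sup>+\<omega>. emeasure \<omega> B * indicator (cyl J D n) \<omega> \<partial>P)
    = (\<integral>\<^sup>+x. indicator B x * cyl_weight J D n x \<partial>M)"
proof -
  let ?c = "\<lambda>j. if n j = 0 then 0 else emeasure P (cyl J D (n(j := n j - 1)))"
  let ?U = "\<Union>j\<in>J. D j"
  have Jfin: "finite J" and Dm[measurable]: "\<And>j. j \<in> J \<Longrightarrow> D j \<in> sets M" and dis: "disjoint_family_on D J"
    using D by (auto simp: disjoint_finite_def)
  have U[measurable]: "?U \<in> sets M"
    by (intro sets.finite_UN Jfin Dm)
  have split: "emeasure N B = (\<Sum>j\<in>J. emeasure N (B \<inter> D j)) + emeasure N (B - ?U)" if "sets N = sets M" for N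
  proof -
    have "emeasure N (\<Union>j\<in>J. B \<inter> D j) = (\<Sum>j\<in>J. emeasure N (B \<inter> D j))"
      using Jfin dis by (intro sum_emeasure[symmetric]) (auto simp: that disjoint_family_on_def)
    moreover have "emeasure N (\<Union>j\<in>J. B \<inter> D j) + emeasure N (B - ?U) = emeasure N B"
      using Jfin U Dm by (subst plus_emeasure) (auto simp: that intro!: arg_cong[where f="emeasure N"])
    ultimately show ?thesis
      by simp
  qed
  have fin_sub: "emeasure M C < \<infinity>" if "C \<subseteq> B" for C
    using emeasure_mono[OF that B] fin by auto
  have "(\<integral>\<^sup>+\<omega>. emeasure \<omega> B * indicator (cyl J D n) \<omega> \<partial>P)
    = (\<integral>\<^sup>+\<omega>. (\<Sum>j\<in>J. emeasure \<omega> (B \<inter> D j) * indicator (cyl J D n) \<omega>)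
        + emeasure \<omega> (B - ?U) * indicator (cyl J D n) \<omega> \<partial>P)"
    by (rule nn_integral_cong) (simp add: split sets_config distrib_right sum_distrib_right)
  also have "\<dots> = (\<Sum>j\<in>J. \<integral>\<^sup>+\<omega>. emeasure \<omega> (B \<inter> D j) * indicator (cyl J D n) \<omega> \<partial>P)
        + (\<integral>\<^sup>+\<omega>. emeasure \<omega> (B - ?U) * indicator (cyl J D n) \<omega> \<partial>P)"
    using disjoint_cyl_sets[OF D]
    by (subst nn_integral_add) (auto simp: nn_integral_sum)
  also have "\<dots> = (\<Sum>j\<in>J. emeasure M (B \<inter> D j) * ?c j) + emeasure M (B - ?U) * emeasure P (cyl J D n)"
    by (intro arg_cong2[where f="(+)"] sum.cong refl nn_integral_count_inside
        nn_integral_count_outside D fin_sub sets.Int sets.Diff B Dm U) auto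
  also have "\<dots> = (\<integral>\<^sup>+x. (\<Sum>j\<in>J. ?c j * indicator (B \<inter> D j) x)
      + emeasure P (cyl J D n) * indicator (B - ?U) x \<partial>M)"
    using U Dm by (subst nn_integral_add) (auto simp: nn_integral_sum nn_integral_cmult_indicator mult.commute[of "emeasure M _"])
  also have "\<dots> = (\<integral>\<^sup>+x. indicator B x * cyl_weight J D n x \<partial>M)"
    by (intro nn_integral_cong)
      (auto simp: cyl_weight_def distrib_left sum_distrib_left indicator_def intro!: sum.cong)
  finally show ?thesis .
qed

text \<open>The factor \<open>Z\<close> is left general because the extension from sets to functions
  serves twice: with the indicator of a cylinder it gives the Mecke formula, with another Poisson
  integral the second moments.\<close>

lemma nn_integral_count_extend:
  assumes [measurable]: "Z \<in> borel_measurable P" "w \<in> borel_measurable M" "f \<in> borel_measurable M"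
    and B: "\<And>B. B \<in> sets M \<Longrightarrow> emeasure M B < \<infinity> \<Longrightarrow>
      (\<integral>\<^sup>+\<omega>. emeasure \<omega> B * Z \<omega> \<partial>P) = (\<integral>\<^sup>+x. indicator B x * w x \<partial>M)"
  shows "(\<integral>\<^sup>+\<omega>. (\<integral>\<^sup>+x. f x \<partial>\<omega>) * Z \<omega> \<partial>P) = (\<integral>\<^sup>+x. f x * w x \<partial>M)"
  using assms(3)
proof (induction rule: borel_measurable_induct)
  case (cong f g)
  have "(\<integral>\<^sup>+x. f x * w x \<partial>M) = (\<integral>\<^sup>+x. g x * w x \<partial>M)"
    using cong by (intro nn_integral_cong) auto
  moreover have "(\<integral>\<^sup>+\<omega>. (\<integral>\<^sup>+x. f x \<partial>\<omega>) * Z \<omega> \<partial>P) = (\<integral>\<^sup>+\<omega>. (\<integral>\<^sup>+x. g x \<partial>\<omega>) * Z \<omega> \<partial>P)"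
    using cong by (intro nn_integral_cong arg_cong2[where f="(*)"]) (auto simp: space_config)
  ultimately show ?case
    using cong by simp
next
  \<comment> \<open>The hypothesis covers sets of finite measure only. The general set is exhausted
    by its intersections with the \<open>S i\<close>, and both sides follow by monotone
    convergence.\<close>
  case (set A)
  obtain S where S: "range S \<subseteq> sets M" "(\<Union>i. S i) = space M" "\<And>i. emeasure M (S i) \<noteq> \<infinity>" "incseq S"
    using sigma_finite_incseq by blast
  have [measurable]: "S i \<in> sets M" for i
    using S(1) by auto
  have inc: "incseq (\<lambda>i. A \<inter> S i)"
    using S(4) by (auto simp: incseq_def)
  have AS: "(\<Union>i. A \<inter> S i) = A"
    using S(2) sets.sets_into_space[OF set] by auto
  then have AS': "A \<inter> (\<Union>i. S i) = A"
    by auto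
  have "(\<integral>\<^sup>+\<omega>. emeasure \<omega> A * Z \<omega> \<partial>P) = (\<integral>\<^sup>+\<omega>. (SUP i. emeasure \<omega> (A \<inter> S i) * Z \<omega>) \<partial>P)"
  proof (rule nn_integral_cong)
    fix \<omega> assume "\<omega> \<in> space P"
    then have "(SUP i. emeasure \<omega> (A \<inter> S i)) = emeasure \<omega> A"
      using set by (subst SUP_emeasure_incseq[OF _ inc]) (auto simp: sets_config AS')
    then show "emeasure \<omega> A * Z \<omega> = (SUP i. emeasure \<omega> (A \<inter> S i) * Z \<omega>)"
      by (metis SUP_mult_right_ennreal)
  qed
  also have "\<dots> = (SUP i. \<integral>\<^sup>+\<omega>. emeasure \<omega> (A \<inter> S i) * Z \<omega> \<partial>P)"
  proof (rule nn_integral_monotone_convergence_SUP_AE)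
    show "AE \<omega> in P. emeasure \<omega> (A \<inter> S i) * Z \<omega> \<le> emeasure \<omega> (A \<inter> S (Suc i)) * Z \<omega>" for i
      using inc set by (intro AE_I2 mult_right_mono emeasure_mono) (auto simp: sets_config incseq_Suc_iff)
  qed (use set in measurable)
  also have "\<dots> = (SUP i. \<integral>\<^sup>+x. indicator (A \<inter> S i) x * w x \<partial>M)"
  proof (intro SUP_cong refl B)
    fix i show "emeasure M (A \<inter> S i) < \<infinity>"
      using S(3)[of i] emeasure_mono[of "A \<inter> S i" "S i" M] by (auto simp: less_top[symmetric] top_unique)
  qed (use set in auto)
  also have "\<dots> = (\<integral>\<^sup>+x. (SUP i. indicator (A \<inter> S i) x * w x) \<partial>M)"
    using set inc by (intro nn_integral_monotone_convergence_SUP_AE[symmetric] AE_I2 mult_right_mono)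
      (auto simp: incseq_Suc_iff indicator_def)
  also have "\<dots> = (\<integral>\<^sup>+x. indicator A x * w x \<partial>M)"
  proof (rule nn_integral_cong)
    fix x
    have "(SUP i. indicator (A \<inter> S i) x :: ennreal) = indicator (\<Union>i. A \<inter> S i) x"
      by (rule antisym) (auto simp: indicator_def intro!: SUP_least SUP_upper2)
    then show "(SUP i. indicator (A \<inter> S i) x * w x) = indicator A x * w x"
      by (simp only: SUP_mult_right_ennreal[symmetric] AS)
  qed
  finally show ?case
    using set by (subst nn_integral_cong[where v="\<lambda>\<omega>. emeasure \<omega> A * Z \<omega>"]) (auto simp: sets_config)
next
  case (mult u c)
  have "(\<integral>\<^sup>+\<omega>. (\<integral>\<^sup>+x. c * u x \<partial>\<omega>) * Z \<omega> \<partial>P) = (\<integral>\<^sup>+\<omega>. c * ((\<integral>\<^sup>+x. u x \<partial>\<omega>) * Z \<omega>) \<partial>P)"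
    using mult by (intro nn_integral_cong) (simp add: nn_integral_cmult measurable_config mult_ac)
  then show ?case
    using mult by (simp add: nn_integral_cmult mult.assoc)
next
  case (add u v)
  have "(\<integral>\<^sup>+\<omega>. (\<integral>\<^sup>+x. v x + u x \<partial>\<omega>) * Z \<omega> \<partial>P)
      = (\<integral>\<^sup>+\<omega>. (\<integral>\<^sup>+x. v x \<partial>\<omega>) * Z \<omega> + (\<integral>\<^sup>+x. u x \<partial>\<omega>) * Z \<omega> \<partial>P)"
    using add by (intro nn_integral_cong) (simp add: nn_integral_add measurable_config distrib_right)
  then show ?case
    using add by (simp add: nn_integral_add distrib_right)
next
  case (seq U)
  have sup: "\<Squnion> range U = (\<lambda>x. SUP i. U i x)"
    by (simp add: fun_eq_iff image_comp)
  have Um[measurable]: "U i \<in> borel_measurable M" for i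
    using seq by auto
  have U: "U i x \<le> U (Suc i) x" for i x
    using seq(3) by (simp add: incseq_Suc_iff le_fun_def)
  have "(\<integral>\<^sup>+\<omega>. (\<integral>\<^sup>+x. (\<Squnion> range U) x \<partial>\<omega>) * Z \<omega> \<partial>P) = (\<integral>\<^sup>+\<omega>. (SUP i. (\<integral>\<^sup>+x. U i x \<partial>\<omega>) * Z \<omega>) \<partial>P)"
  proof (rule nn_integral_cong)
    fix \<omega> assume "\<omega> \<in> space P"
    then have "(\<integral>\<^sup>+x. (\<Squnion> range U) x \<partial>\<omega>) = (SUP i. \<integral>\<^sup>+x. U i x \<partial>\<omega>)"
      unfolding sup using seq(3) by (intro nn_integral_monotone_convergence_SUP) (auto intro: measurable_config)
    then show "(\<integral>\<^sup>+x. (\<Squnion> range U) x \<partial>\<omega>) * Z \<omega> = (SUP i. (\<integral>\<^sup>+x. U i x \<partial>\<omega>) * Z \<omega>)"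
      by (simp add: SUP_mult_right_ennreal)
  qed
  also have "\<dots> = (SUP i. \<integral>\<^sup>+\<omega>. (\<integral>\<^sup>+x. U i x \<partial>\<omega>) * Z \<omega> \<partial>P)"
    by (intro nn_integral_monotone_convergence_SUP_AE AE_I2 mult_right_mono nn_integral_mono U) auto
  also have "\<dots> = (SUP i. \<integral>\<^sup>+x. U i x * w x \<partial>M)"
    using seq by simp
  also have "\<dots> = (\<integral>\<^sup>+x. (SUP i. U i x * w x) \<partial>M)"
    by (intro nn_integral_monotone_convergence_SUP_AE[symmetric] AE_I2 mult_right_mono U) auto
  also have "\<dots> = (\<integral>\<^sup>+x. (\<Squnion> range U) x * w x \<partial>M)"
    by (intro nn_integral_cong) (simp add: sup SUP_mult_right_ennreal)
  finally show ?case .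
qed

lemma mecke_cyl:
  assumes D: "disjoint_finite J D" and "f \<in> borel_measurable M"
  shows "(\<integral>\<^sup>+\<omega>. (\<integral>\<^sup>+x. f x \<partial>\<omega>) * indicator (cyl J D n) \<omega> \<partial>P) = (\<integral>\<^sup>+x. f x * cyl_weight J D n x \<partial>M)"
  using assms disjoint_cyl_sets[OF D]
  by (intro nn_integral_count_extend nn_integral_count_cyl cyl_weight_measurable borel_measurable_indicator)

text \<open>The cylinder over the empty family is the whole Poisson space, and its weight is 1 at
  every point of the base space.\<close>

lemma campbell:
  assumes "f \<in> borel_measurable M"
  shows "(\<integral>\<^sup>+\<omega>. (\<integral>\<^sup>+x. f x \<partial>\<omega>) \<partial>P) = (\<integral>\<^sup>+x. f x \<partial>M)"
proof -
  have D: "disjoint_finite {} (\<lambda>_ :: nat. {} :: 'a set)"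
    by (simp add: disjoint_finite_def disjoint_family_on_def)
  have [simp]: "cyl {} D n = space P" for D :: "nat \<Rightarrow> 'a set" and n
    by (simp add: cyl_def)
  have "(\<integral>\<^sup>+\<omega>. (\<integral>\<^sup>+x. f x \<partial>\<omega>) \<partial>P) = (\<integral>\<^sup>+\<omega>. (\<integral>\<^sup>+x. f x \<partial>\<omega>) * indicator (cyl {} (\<lambda>_ :: nat. {}) (\<lambda>_. 0)) \<omega> \<partial>P)"
    by (rule nn_integral_cong) simp
  also have "\<dots> = (\<integral>\<^sup>+x. f x * cyl_weight {} (\<lambda>_ :: nat. {}) (\<lambda>_. 0) x \<partial>M)"
    by (rule mecke_cyl[OF D assms])
  also have "\<dots> = (\<integral>\<^sup>+x. f x \<partial>M)"
    by (rule nn_integral_cong) (simp add: cyl_weight_def P.emeasure_space_1)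
  finally show ?thesis .
qed

end

section \<open>Cylinder events determine finite measures on Poisson space\<close>

text \<open>The members of \<open>\<D>\<close> are the atoms of the ring of sets generated by \<open>\<A>\<close>.\<close>

lemma finite_family_atoms:
  assumes "finite \<A>" "\<A> \<subseteq> sets M"
  obtains \<D> where "finite \<D>" "\<D> \<subseteq> sets M" "disjoint \<D>"
    "\<forall>A\<in>\<A>. A = \<Union>{D\<in>\<D>. D \<subseteq> A}" "\<forall>D\<in>\<D>. \<exists>A\<in>\<A>. D \<subseteq> A"
proof -
  \<comment> \<open>\<open>g S\<close> is the set of points whose membership pattern in the family
    is \<open>S\<close>. Only patterns of points of the union are used: the empty pattern describes
    the complement of the union, whose measure may be infinite.\<close>
  define g where "g S = {y\<in>space M. \<forall>A\<in>\<A>. y \<in> A \<longleftrightarrow> A \<in> S}" for S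
  let ?\<D> = "(\<lambda>x. g {A\<in>\<A>. x \<in> A}) ` \<Union>\<A>"
  have sp: "A \<subseteq> space M" if "A \<in> \<A>" for A
    using assms(2) that sets.sets_into_space by auto
  have mem: "x \<in> g {A\<in>\<A>. x \<in> A}" if "x \<in> \<Union>\<A>" for x
    using that sp by (auto simp: g_def)
  have sub: "g {A\<in>\<A>. x \<in> A} \<subseteq> A" if "A \<in> \<A>" "x \<in> A" for x A
    using that by (auto simp: g_def)
  show thesis
  proof
    show "finite ?\<D>"
      by (rule finite_subset[of _ "g ` Pow \<A>"]) (use assms(1) in auto)
    have "g S \<in> sets M" for S
    proof -
      have "{y\<in>space M. y \<in> A \<longleftrightarrow> A \<in> S} \<in> sets M" if "A \<in> \<A>" for A
      proof -
        have [measurable]: "A \<in> sets M"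
          using assms(2) that by auto
        show ?thesis
          by measurable
      qed
      then show ?thesis
        unfolding g_def by (intro sets.sets_Collect_finite_All' sets.sets_Collect_finite_All assms(1))
    qed
    then show "?\<D> \<subseteq> sets M"
      by auto
    show "disjoint ?\<D>"
    proof (rule pairwiseI)
      fix D E assume "D \<in> ?\<D>" "E \<in> ?\<D>" "D \<noteq> E"
      then obtain x y where xy: "D = g {A\<in>\<A>. x \<in> A}" "E = g {A\<in>\<A>. y \<in> A}"
        by auto
      show "disjnt D E"
      proof (rule ccontr)
        assume "\<not> disjnt D E"
        then obtain z where "z \<in> D" "z \<in> E"
          by (auto simp: disjnt_def)
        then have "{A\<in>\<A>. x \<in> A} = {A\<in>\<A>. y \<in> A}"
          unfolding xy g_def by blast
        with \<open>D \<noteq> E\<close> xy show False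
          by simp
      qed
    qed
    have "A = \<Union>{D\<in>?\<D>. D \<subseteq> A}" if "A \<in> \<A>" for A
    proof
      show "A \<subseteq> \<Union>{D\<in>?\<D>. D \<subseteq> A}"
      proof
        fix x assume x: "x \<in> A"
        with that have "x \<in> \<Union>\<A>" by blast
        then show "x \<in> \<Union>{D\<in>?\<D>. D \<subseteq> A}"
          using mem[of x] sub[OF that x] by blast
      qed
    qed blast
    then show "\<forall>A\<in>\<A>. A = \<Union>{D\<in>?\<D>. D \<subseteq> A}"
      by blast
    have "\<exists>A\<in>\<A>. D \<subseteq> A" if "D \<in> ?\<D>" for D
      using that sub by blast
    then show "\<forall>D\<in>?\<D>. \<exists>A\<in>\<A>. D \<subseteq> A"
      by blast
  qed
qed

context poisson_space begin

text \<open>Two gaps separate these generators from all counting maps. The value infinity is not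
  prescribed by any cylinder, but it is what remains once all natural values are excluded; and a set
  of infinite measure is an increasing union of sets of finite measure.\<close>

lemma sets_P_cyl:
  "sets P = sigma_sets (space P) {cyl \<A> (\<lambda>A. A) n | \<A> n. finite \<A> \<and> \<A> \<subseteq> {A\<in>sets M. emeasure M A < \<infinity>}}"
  (is "_ = sigma_sets _ ?E")
proof
  have E: "?E \<subseteq> sets P"
    by (auto intro!: cyl_sets)
  show "sigma_sets (space P) ?E \<subseteq> sets P"
    using E by (rule sets.sigma_sets_subset)
  define \<Sigma> where "\<Sigma> = sigma (space P) ?E"
  have space_S: "space \<Sigma> = space P" and sets_S: "sets \<Sigma> = sigma_sets (space P) ?E"
    unfolding \<Sigma>_def using E sets.space_closed[of P] by (auto simp: space_measure_of_conv subset_trans)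
  have fin: "(\<lambda>\<omega>. emeasure \<omega> A) \<in> borel_measurable \<Sigma>" if A: "A \<in> sets M" "emeasure M A < \<infinity>" for A
  proof (rule measurableI)
    fix B :: "ennreal set" assume "B \<in> sets borel"
    have at: "{\<omega>\<in>space P. emeasure \<omega> A = of_nat n} \<in> sets \<Sigma>" for n
    proof -
      have "cyl {A} (\<lambda>A. A) (\<lambda>_. n) \<in> ?E"
        using A by blast
      then show ?thesis
        unfolding sets_S by (intro sigma_sets.Basic) (simp add: cyl_def)
    qed
    let ?F = "\<Union>n\<in>{n::nat. of_nat n \<in> B}. {\<omega>\<in>space P. emeasure \<omega> A = of_nat n}"
    let ?I = "space \<Sigma> - (\<Union>n::nat. {\<omega>\<in>space P. emeasure \<omega> A = of_nat n})"
    have "(\<lambda>\<omega>. emeasure \<omega> A) -` B \<inter> space \<Sigma> = ?F \<union> (if \<infinity> \<in> B then ?I else {})"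
    proof -
      have "emeasure \<omega> A = \<infinity> \<longleftrightarrow> (\<forall>n::nat. emeasure \<omega> A \<noteq> of_nat n)" if "\<omega> \<in> space P" for \<omega>
        using count_eq_of_nat[OF that A(1)] by (auto simp: ennreal_of_nat_eq_real_of_nat)
      then show ?thesis
        unfolding space_S by (auto split: if_splits) metis+
    qed
    moreover have "?F \<in> sets \<Sigma>" "?I \<in> sets \<Sigma>"
      using at by (auto intro!: sets.countable_UN'' sets.Diff sets.top)
    ultimately show "(\<lambda>\<omega>. emeasure \<omega> A) -` B \<inter> space \<Sigma> \<in> sets \<Sigma>"
      by auto
  qed simp
  have all: "(\<lambda>\<omega>. emeasure \<omega> A) \<in> borel_measurable \<Sigma>" if A: "A \<in> sets M" for A
  proof -
    obtain S where S: "range S \<subseteq> sets M" "(\<Union>i. S i) = space M" "\<And>i. emeasure M (S i) \<noteq> \<infinity>" "incseq S"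
      using sigma_finite_incseq by blast
    have inc: "incseq (\<lambda>i. A \<inter> S i)"
      using S(4) by (auto simp: incseq_def)
    have AS: "(\<Union>i. A \<inter> S i) = A"
      using S(2) sets.sets_into_space[OF A] by auto
    have "(\<lambda>\<omega>. SUP i. emeasure \<omega> (A \<inter> S i)) \<in> borel_measurable \<Sigma>"
    proof (intro borel_measurable_SUP fin)
      fix i show "emeasure M (A \<inter> S i) < \<infinity>"
        using S(1) S(3)[of i] emeasure_mono[of "A \<inter> S i" "S i" M] by (auto simp: less_top[symmetric] top_unique)
    qed (use A S(1) in auto)
    moreover have "(SUP i. emeasure \<omega> (A \<inter> S i)) = emeasure \<omega> A" if "\<omega> \<in> space P" for \<omega>
      using A S(1) that by (subst SUP_emeasure_incseq[OF _ inc]) (auto simp only: sets_config AS)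
    ultimately show ?thesis
      by (subst measurable_cong[symmetric]) (auto simp: space_S)
  qed
  \<comment> \<open>Measurability of the identity map is the remaining inclusion of
    sigma-algebras.\<close>
  have "(\<lambda>\<omega>. \<omega>) \<in> \<Sigma> \<rightarrow>\<^sub>M configuration_algebra M"
    by (rule measurable_configuration_algebra) (use all in \<open>auto simp: space_S space_P\<close>)
  then have "(\<lambda>\<omega>. \<omega>) \<in> \<Sigma> \<rightarrow>\<^sub>M P"
    by (simp add: measurable_cong_sets[OF refl sets_P])
  then have "G \<in> sets \<Sigma>" if "G \<in> sets P" for G
    using measurable_sets[of "\<lambda>\<omega>. \<omega>" \<Sigma> P G] that sets.sets_into_space[OF that]
    by (simp add: space_S Int_absorb2)
  then show "sets P \<subseteq> sigma_sets (space P) ?E"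
    unfolding sets_S by blast
qed

text \<open>The count of a set is the sum of the counts of its atoms, and these are finite because
  every atom lies inside some member of the family. Extensional functions \<open>m\<close> make
  every assignment of counts occur once, so that the union is a disjoint one.\<close>

lemma cyl_decomposition:
  assumes "finite \<D>" "\<D> \<subseteq> sets M" "disjoint \<D>"
    and A: "\<And>A. A \<in> \<A> \<Longrightarrow> A = \<Union>{D\<in>\<D>. D \<subseteq> A}" "\<And>D. D \<in> \<D> \<Longrightarrow> \<exists>A\<in>\<A>. D \<subseteq> A"
    and "\<A> \<subseteq> sets M"
  shows "cyl \<A> (\<lambda>A. A) n =
    (\<Union>m\<in>{m \<in> \<D> \<rightarrow>\<^sub>E UNIV. \<forall>A\<in>\<A>. (\<Sum>D\<in>{D\<in>\<D>. D \<subseteq> A}. m D) = n A}. cyl \<D> (\<lambda>D. D) m)"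
proof -
  have sum: "emeasure \<omega> A = (\<Sum>D\<in>{D\<in>\<D>. D \<subseteq> A}. emeasure \<omega> D)" if "\<omega> \<in> space P" "A \<in> \<A>" for \<omega> A
  proof -
    have "(\<Sum>D\<in>{D\<in>\<D>. D \<subseteq> A}. emeasure \<omega> D) = emeasure \<omega> (\<Union>D\<in>{D\<in>\<D>. D \<subseteq> A}. D)"
      by (rule sum_emeasure) (use assms(1-3) that in
          \<open>auto simp: sets_config disjoint_family_on_def pairwise_def disjnt_def\<close>)
    then show ?thesis
      using A(1)[OF that(2)] by simp
  qed
  show ?thesis
  proof (intro set_eqI iffI)
    fix \<omega> assume \<omega>: "\<omega> \<in> cyl \<A> (\<lambda>A. A) n"
    then have sp: "\<omega> \<in> space P" and n: "\<And>A. A \<in> \<A> \<Longrightarrow> emeasure \<omega> A = of_nat (n A)"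
      by (auto simp: cyl_def)
    have "\<exists>k :: nat. emeasure \<omega> D = of_nat k" if D: "D \<in> \<D>" for D
    proof (rule count_eq_of_nat[OF sp])
      show "D \<in> sets M"
        using D assms(2) by auto
      obtain B where "B \<in> \<A>" "D \<subseteq> B"
        using A(2)[OF D] by auto
      then have "emeasure \<omega> D \<le> of_nat (n B)"
        using emeasure_mono[of D B \<omega>] n[of B] assms(6) by (auto simp: sets_config[OF sp])
      also have "of_nat (n B) < (\<infinity>::ennreal)"
        by (simp add: ennreal_of_nat_eq_real_of_nat)
      finally show "emeasure \<omega> D \<noteq> \<infinity>"
        by simp
    qed
    then obtain k :: "'a set \<Rightarrow> nat" where k: "\<And>D. D \<in> \<D> \<Longrightarrow> emeasure \<omega> D = of_nat (k D)"
      by metis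
    have "(\<Sum>D\<in>{D\<in>\<D>. D \<subseteq> A}. k D) = n A" if "A \<in> \<A>" for A
    proof -
      have "of_nat (\<Sum>D\<in>{D\<in>\<D>. D \<subseteq> A}. k D) = (of_nat (n A) :: ennreal)"
        using sum[OF sp that] n[OF that] k by simp
      then show ?thesis
        by (simp only: of_nat_eq_iff)
    qed
    then show "\<omega> \<in> (\<Union>m\<in>{m \<in> \<D> \<rightarrow>\<^sub>E UNIV. \<forall>A\<in>\<A>. (\<Sum>D\<in>{D\<in>\<D>. D \<subseteq> A}. m D) = n A}. cyl \<D> (\<lambda>D. D) m)"
      using k sp by (auto simp: cyl_def intro!: exI[of _ "restrict k \<D>"])
  next
    fix \<omega> assume "\<omega> \<in> (\<Union>m\<in>{m \<in> \<D> \<rightarrow>\<^sub>E UNIV. \<forall>A\<in>\<A>. (\<Sum>D\<in>{D\<in>\<D>. D \<subseteq> A}. m D) = n A}. cyl \<D> (\<lambda>D. D) m)"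
    then obtain m where m: "\<And>A. A \<in> \<A> \<Longrightarrow> (\<Sum>D\<in>{D\<in>\<D>. D \<subseteq> A}. m D) = n A"
      and sp: "\<omega> \<in> space P" and eq: "\<And>D. D \<in> \<D> \<Longrightarrow> emeasure \<omega> D = of_nat (m D)"
      by (auto simp: cyl_def)
    have "emeasure \<omega> A = of_nat (n A)" if "A \<in> \<A>" for A
      unfolding sum[OF sp that] m[OF that, symmetric] using eq by simp
    then show "\<omega> \<in> cyl \<A> (\<lambda>A. A) n"
      using sp by (simp add: cyl_def)
  qed
qed

text \<open>Intersecting cylinders over two disjoint families may give one over an overlapping
  family, so the generator consists of cylinders over arbitrary finite families. Each of these is a
  countable disjoint union of cylinders over the atoms, where the measures agree by
  hypothesis.\<close>

lemma measure_eqI_cyl: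
  assumes Q: "sets Q = sets P" and R: "sets R = sets P" and fin: "emeasure Q (space P) \<noteq> \<infinity>"
    and eq: "\<And>\<D> n. disjoint_finite \<D> (\<lambda>D. D) \<Longrightarrow> emeasure Q (cyl \<D> (\<lambda>D. D) n) = emeasure R (cyl \<D> (\<lambda>D. D) n)"
  shows "Q = R"
proof (rule measure_eqI_generator_eq)
  let ?F = "{A\<in>sets M. emeasure M A < \<infinity>}"
  let ?E = "insert {} {cyl \<A> (\<lambda>A. A) n | \<A> n. finite \<A> \<and> \<A> \<subseteq> ?F}"
  show E: "?E \<subseteq> Pow (space P)"
    by (auto simp: cyl_def)
  have "sigma_sets (space P) ?E = sets P"
    unfolding sets_P_cyl
    by (intro sigma_sets_eqI) (auto intro: sigma_sets.Empty sigma_sets.Basic)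
  then show "sets Q = sigma_sets (space P) ?E" "sets R = sigma_sets (space P) ?E"
    using Q R by auto
  show "Int_stable ?E"
  proof (rule Int_stableI)
    fix X Y assume X: "X \<in> ?E" and Y: "Y \<in> ?E"
    show "X \<inter> Y \<in> ?E"
    proof (cases "X \<inter> Y = {}")
      case False
      then obtain \<omega>0 where \<omega>0: "\<omega>0 \<in> X" "\<omega>0 \<in> Y"
        by blast
      then obtain \<A> n \<B> m where AB: "finite \<A>" "\<A> \<subseteq> ?F" "X = cyl \<A> (\<lambda>A. A) n"
          "finite \<B>" "\<B> \<subseteq> ?F" "Y = cyl \<B> (\<lambda>A. A) m"
        using X Y by auto
      \<comment> \<open>Cylinders that prescribe different counts for a common set are disjoint,
        which is why the empty set belongs to \<open>?E\<close>. A common configuration forces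
        \<open>n\<close> and \<open>m\<close> to agree on common sets, so \<open>?k\<close> merges
        them.\<close>
      let ?k = "\<lambda>A. if A \<in> \<A> then n A else m A"
      have "n A = m A" if "A \<in> \<A>" "A \<in> \<B>" for A
      proof -
        have "of_nat (n A) = (of_nat (m A) :: ennreal)"
          using \<omega>0 AB that by (auto simp: cyl_def)
        then show ?thesis
          by (simp only: of_nat_eq_iff)
      qed
      then have "X \<inter> Y = cyl (\<A> \<union> \<B>) (\<lambda>A. A) ?k"
        unfolding AB(3) AB(6) by (auto simp: cyl_def)
      moreover have "cyl (\<A> \<union> \<B>) (\<lambda>A. A) ?k \<in> ?E"
        using AB by blast
      ultimately show ?thesis
        by simp
    qed simp
  qed
  show "emeasure Q X = emeasure R X" if X: "X \<in> ?E" for X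
  proof (cases "X = {}")
    case False
    then obtain \<A> n where A: "finite \<A>" "\<A> \<subseteq> ?F" "X = cyl \<A> (\<lambda>A. A) n"
      using X by auto
    then have AM: "\<A> \<subseteq> sets M"
      by auto
    obtain \<D> where D: "finite \<D>" "\<D> \<subseteq> sets M" "disjoint \<D>"
      "\<forall>A\<in>\<A>. A = \<Union>{D\<in>\<D>. D \<subseteq> A}" "\<forall>D\<in>\<D>. \<exists>A\<in>\<A>. D \<subseteq> A"
      by (rule finite_family_atoms[OF A(1) AM]) blast
    have fin: "emeasure M B < \<infinity>" if "B \<in> \<D>" for B
    proof -
      obtain A where "A \<in> \<A>" "B \<subseteq> A"
        using D(5) \<open>B \<in> \<D>\<close> by auto
      then show ?thesis
        using A(2) emeasure_mono[of B A M] by (auto simp: le_less_trans)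
    qed
    then have dis: "disjoint_finite \<D> (\<lambda>D. D)"
      using D by (auto simp: disjoint_finite_def disjoint_family_on_def pairwise_def disjnt_def)
    let ?m = "{m \<in> \<D> \<rightarrow>\<^sub>E UNIV. \<forall>A\<in>\<A>. (\<Sum>D\<in>{D\<in>\<D>. D \<subseteq> A}. m D) = n A}"
    have cnt: "countable ?m"
      by (rule countable_subset[OF _ countable_PiE[OF D(1), of "\<lambda>_. UNIV"]]) auto
    have disj: "disjoint_family_on (cyl \<D> (\<lambda>D. D)) ?m"
    proof (unfold disjoint_family_on_def, intro ballI impI)
      fix m m' assume "m \<in> ?m" "m' \<in> ?m" "m \<noteq> m'"
      then obtain D where "D \<in> \<D>" "m D \<noteq> m' D"
        using PiE_ext[of m \<D> "\<lambda>_. UNIV" m'] by blast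
      then have "of_nat (m D) \<noteq> (of_nat (m' D) :: ennreal)"
        by simp
      then show "cyl \<D> (\<lambda>D. D) m \<inter> cyl \<D> (\<lambda>D. D) m' = {}"
        using \<open>D \<in> \<D>\<close> by (auto simp: cyl_def)
    qed
    have dec: "cyl \<A> (\<lambda>A. A) n = (\<Union>m\<in>?m. cyl \<D> (\<lambda>D. D) m)"
      by (rule cyl_decomposition[OF D(1-3) _ _ AM]) (use D(4,5) in blast)+
    have "emeasure N X = (\<integral>\<^sup>+m. emeasure N (cyl \<D> (\<lambda>D. D) m) \<partial>count_space ?m)" if "sets N = sets P" for N
      unfolding A(3) dec
      using disjoint_cyl_sets[OF dis] by (intro emeasure_UN_countable cnt disj) (simp add: that)
    then show ?thesis
      using Q R eq[OF dis] by simp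
  qed simp
  have "space P = cyl {} (\<lambda>A. A) (\<lambda>_. 0)"
    by (simp add: cyl_def)
  then have "space P \<in> ?E"
    by blast
  then show "range (\<lambda>_ :: nat. space P) \<subseteq> ?E"
    by blast
  show "(\<Union>i :: nat. space P) = space P" "\<And>i :: nat. emeasure Q (space P) \<noteq> \<infinity>"
    using fin by auto
qed

section \<open>The suspension of an endomorphism\<close>

lemma endomorphism_measurable: "endomorphism M T \<Longrightarrow> T \<in> M \<rightarrow>\<^sub>M M"
  by (simp add: endomorphism_def)

lemma emeasure_preimage:
  "endomorphism M T \<Longrightarrow> A \<in> sets M \<Longrightarrow> emeasure M (T -` A \<inter> space M) = emeasure M A"
  by (simp add: endomorphism_def)

lemma disjoint_finite_preimage:
  assumes T: "endomorphism M T" and D: "disjoint_finite J D"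
  shows "disjoint_finite J (\<lambda>j. T -` D j \<inter> space M)"
  using D measurable_sets[OF endomorphism_measurable[OF T]]
  by (auto simp: disjoint_finite_def disjoint_family_on_def emeasure_preimage[OF T])

lemma vimage_suspension_cyl:
  assumes T: "endomorphism M T" and D: "disjoint_finite J D"
  shows "poisson_suspension M T -` cyl J D n \<inter> space P = cyl J (\<lambda>j. T -` D j \<inter> space M) n"
  using D measurable_space[OF suspension_measurable[OF endomorphism_measurable[OF T]]]
  by (auto simp: cyl_def disjoint_finite_def emeasure_suspension endomorphism_measurable[OF T])

lemma emeasure_cyl_preimage:
  assumes T: "endomorphism M T" and D: "disjoint_finite J D"
  shows "emeasure P (cyl J (\<lambda>j. T -` D j \<inter> space M) n) = emeasure P (cyl J D n)"
  unfolding emeasure_cyl[OF D] emeasure_cyl[OF disjoint_finite_preimage[OF T D]]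
  using D by (auto simp: disjoint_finite_def measure_def emeasure_preimage[OF T] intro!: prod.cong)

lemma cyl_weight_preimage:
  assumes T: "endomorphism M T" and D: "disjoint_finite J D" and x: "x \<in> space M"
  shows "cyl_weight J (\<lambda>j. T -` D j \<inter> space M) n x = cyl_weight J D n (T x)"
  using x measurable_space[OF endomorphism_measurable[OF T] x]
  by (auto simp: cyl_weight_def emeasure_cyl_preimage[OF T D] indicator_def intro!: sum.cong)

text \<open>The probability of a cylinder over a disjoint family depends only on the masses of its
  sets, and \<open>T\<close> preserves these masses.\<close>

lemma distr_suspension:
  assumes T: "endomorphism M T"
  shows "distr P P (poisson_suspension M T) = P"
proof (rule measure_eqI_cyl)
  note [measurable] = suspension_measurable[OF endomorphism_measurable[OF T]]
  show "emeasure (distr P P (poisson_suspension M T)) (space P) \<noteq> \<infinity>"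
    by (simp add: emeasure_distr)
  fix \<D> :: "'a set set" and n assume D: "disjoint_finite \<D> (\<lambda>D. D)"
  then show "emeasure (distr P P (poisson_suspension M T)) (cyl \<D> (\<lambda>D. D) n) = emeasure P (cyl \<D> (\<lambda>D. D) n)"
    using disjoint_cyl_sets[OF D]
    by (simp add: emeasure_distr vimage_suspension_cyl[OF T D] emeasure_cyl_preimage[OF T D])
qed simp_all

text \<open>Mecke's formula reduces the identity to the base space, since the weight of the preimage
  of a cylinder is the weight of the cylinder composed with \<open>T\<close>.\<close>

lemma distr_density_suspension:
  assumes T: "endomorphism M T" and u[measurable]: "u \<in> borel_measurable M" and v[measurable]: "v \<in> borel_measurable M"
    and fin: "(\<integral>\<^sup>+x. u x \<partial>M) < \<infinity>"
    and dual: "\<And>g. g \<in> borel_measurable M \<Longrightarrow> (\<integral>\<^sup>+x. v x * g x \<partial>M) = (\<integral>\<^sup>+x. u x * g (T x) \<partial>M)"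
  shows "distr (density P (\<lambda>\<omega>. \<integral>\<^sup>+x. u x \<partial>\<omega>)) P (poisson_suspension M T) = density P (\<lambda>\<omega>. \<integral>\<^sup>+x. v x \<partial>\<omega>)"
    (is "distr ?U P ?T = ?V")
proof (rule measure_eqI_cyl)
  note meas[measurable] = suspension_measurable[OF endomorphism_measurable[OF T]]
  have "?T -` space P \<inter> space P = space P"
    using measurable_space[OF meas] by auto
  then have "emeasure (distr ?U P ?T) (space P) = (\<integral>\<^sup>+\<omega>. (\<integral>\<^sup>+x. u x \<partial>\<omega>) * indicator (space P) \<omega> \<partial>P)"
    by (simp add: emeasure_distr emeasure_density)
  also have "\<dots> = (\<integral>\<^sup>+\<omega>. (\<integral>\<^sup>+x. u x \<partial>\<omega>) \<partial>P)"
    by (rule nn_integral_cong) simp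
  finally show "emeasure (distr ?U P ?T) (space P) \<noteq> \<infinity>"
    using fin by (simp add: campbell)
  fix \<D> :: "'a set set" and n assume D: "disjoint_finite \<D> (\<lambda>D. D)"
  note [measurable] = disjoint_cyl_sets[OF D] and D' = disjoint_finite_preimage[OF T D]
  have "emeasure (distr ?U P ?T) (cyl \<D> (\<lambda>D. D) n)
      = (\<integral>\<^sup>+\<omega>. (\<integral>\<^sup>+x. u x \<partial>\<omega>) * indicator (cyl \<D> (\<lambda>D. T -` D \<inter> space M) n) \<omega> \<partial>P)"
    using disjoint_cyl_sets[OF D'] by (simp add: emeasure_distr emeasure_density vimage_suspension_cyl[OF T D])
  also have "\<dots> = (\<integral>\<^sup>+x. u x * cyl_weight \<D> (\<lambda>D. D) n (T x) \<partial>M)"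
    unfolding mecke_cyl[OF D' u] by (rule nn_integral_cong) (simp add: cyl_weight_preimage[OF T D])
  also have "\<dots> = (\<integral>\<^sup>+x. v x * cyl_weight \<D> (\<lambda>D. D) n x \<partial>M)"
    by (rule dual[symmetric]) (rule cyl_weight_measurable[OF D])
  also have "\<dots> = emeasure ?V (cyl \<D> (\<lambda>D. D) n)"
    by (simp add: emeasure_density mecke_cyl[OF D v])
  finally show "emeasure (distr ?U P ?T) (cyl \<D> (\<lambda>D. D) n) = emeasure ?V (cyl \<D> (\<lambda>D. D) n)" .
qed simp_all

section \<open>Second moments\<close>

text \<open>Sum the Mecke formula for the events \<open>N(A) = k\<close> against \<open>k\<close>.
  With a point added at \<open>x\<close>, the expected count of \<open>A\<close> is
  \<open>1 + measure M A\<close> for \<open>x\<close> in \<open>A\<close> and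
  \<open>measure M A\<close> elsewhere, so the weights sum to the indicator plus the mass.\<close>

lemma nn_integral_count_count:
  assumes A[measurable]: "A \<in> sets M" and fin: "emeasure M A < \<infinity>" and f[measurable]: "f \<in> borel_measurable M"
  shows "(\<integral>\<^sup>+\<omega>. emeasure \<omega> A * (\<integral>\<^sup>+x. f x \<partial>\<omega>) \<partial>P) = (\<integral>\<^sup>+x. indicator A x * (f x + (\<integral>\<^sup>+y. f y \<partial>M)) \<partial>M)"
proof -
  let ?a = "measure M A"
  have D: "disjoint_finite {()} (\<lambda>_. A)"
    using A fin by (simp add: disjoint_finite_def disjoint_family_on_def)
  have set: "{\<omega>\<in>space P. emeasure \<omega> A = of_nat k} = cyl {()} (\<lambda>_. A) (\<lambda>_. k)" for k
    by (simp add: cyl_def)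
  have weight: "cyl_weight {()} (\<lambda>_. A) (\<lambda>_. k) x
     = ennreal (if x \<in> A then (if k = 0 then 0 else poisson_mass ?a (k - 1)) else poisson_mass ?a k)"
    if "x \<in> space M" for k x
    using that D by (simp add: cyl_weight_def emeasure_cyl)
  have sum: "(\<Sum>k. of_nat k * cyl_weight {()} (\<lambda>_. A) (\<lambda>_. k) x) = indicator A x + emeasure M A" if "x \<in> space M" for x
  proof -
    have "(\<lambda>k. real k * (if x \<in> A then (if k = 0 then 0 else poisson_mass ?a (k - 1)) else poisson_mass ?a k))
        sums (indicator A x + ?a)"
    proof (cases "x \<in> A")
      case True
      have "(\<lambda>k. real (Suc k) * poisson_mass ?a k) sums (1 + ?a)"
        using sums_add[OF poisson_mass_sums[of ?a] poisson_mass_mean[of ?a]] by (simp add: algebra_simps)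
      then have "(\<lambda>k. real k * (if k = 0 then 0 else poisson_mass ?a (k - 1))) sums (1 + ?a)"
        using sums_Suc_iff[of "\<lambda>k. real k * (if k = 0 then 0 else poisson_mass ?a (k - 1))" "1 + ?a"] by simp
      then show ?thesis
        using True by simp
    qed (simp add: poisson_mass_mean)
    then have "(\<Sum>k. ennreal (real k * (if x \<in> A then (if k = 0 then 0 else poisson_mass ?a (k - 1)) else poisson_mass ?a k)))
       = ennreal (indicator A x + ?a)"
      by (intro suminf_ennreal_eq) (auto intro!: mult_nonneg_nonneg poisson_mass_nonneg)
    then show ?thesis
      using fin that
      by (simp add: weight ennreal_of_nat_eq_real_of_nat ennreal_mult'[symmetric] emeasure_eq_ennreal_measure
          ennreal_indicator)
  qed
  have "(\<integral>\<^sup>+\<omega>. emeasure \<omega> A * (\<integral>\<^sup>+x. f x \<partial>\<omega>) \<partial>P)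
     = (\<Sum>k. of_nat k * (\<integral>\<^sup>+x. f x * cyl_weight {()} (\<lambda>_. A) (\<lambda>_. k) x \<partial>M))"
    by (subst nn_integral_count_times[OF A fin]) (simp_all add: set mecke_cyl[OF D f])
  also have "\<dots> = (\<integral>\<^sup>+x. f x * (\<Sum>k. of_nat k * cyl_weight {()} (\<lambda>_. A) (\<lambda>_. k) x) \<partial>M)"
    using cyl_weight_measurable[OF D]
    by (simp add: nn_integral_suminf nn_integral_cmult ennreal_suminf_cmult[symmetric] mult.left_commute)
  also have "\<dots> = (\<integral>\<^sup>+x. f x * (indicator A x + emeasure M A) \<partial>M)"
    by (rule nn_integral_cong) (simp add: sum)
  also have "\<dots> = (\<integral>\<^sup>+x. indicator A x * (f x + (\<integral>\<^sup>+y. f y \<partial>M)) \<partial>M)"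
    by (simp add: distrib_left nn_integral_add nn_integral_multc mult.commute)
  finally show ?thesis .
qed

lemma nn_integral_product:
  assumes f[measurable]: "f \<in> borel_measurable M" and g[measurable]: "g \<in> borel_measurable M"
  shows "(\<integral>\<^sup>+\<omega>. (\<integral>\<^sup>+x. f x \<partial>\<omega>) * (\<integral>\<^sup>+x. g x \<partial>\<omega>) \<partial>P)
    = (\<integral>\<^sup>+x. f x * g x \<partial>M) + (\<integral>\<^sup>+x. f x \<partial>M) * (\<integral>\<^sup>+x. g x \<partial>M)"
proof -
  have "(\<integral>\<^sup>+\<omega>. (\<integral>\<^sup>+x. f x \<partial>\<omega>) * (\<integral>\<^sup>+x. g x \<partial>\<omega>) \<partial>P) = (\<integral>\<^sup>+x. f x * (g x + (\<integral>\<^sup>+y. g y \<partial>M)) \<partial>M)"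
    by (rule nn_integral_count_extend) (auto intro: nn_integral_count_count)
  then show ?thesis
    by (simp add: distrib_left nn_integral_add nn_integral_multc)
qed

end

section \<open>Truncation in the Orlicz space\<close>

lemma Phi_nonneg: "0 \<le> x \<Longrightarrow> 0 \<le> Phi x"
  by (simp add: Phi_def)

lemma Phi_mono: "0 \<le> x \<Longrightarrow> x \<le> y \<Longrightarrow> Phi x \<le> Phi y"
  by (auto simp: Phi_def power_mono) (smt (verit) power_le_one)

lemma le_one_plus_Phi: "x \<le> 1 + Phi x"
  by (auto simp: Phi_def intro: order_trans[of _ 1])

lemma Phi_le: "0 \<le> x \<Longrightarrow> Phi x \<le> 2 * x"
  by (auto simp: Phi_def power2_eq_square mult_left_le_one_le intro: order_trans[of _ x])

text \<open>The function dominates a line away from 0: this is what makes the truncations of a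
  member of \<open>LPhi M\<close> integrable.\<close>

lemma Phi_ge_linear:
  assumes "0 < \<epsilon>" "\<epsilon> \<le> 1" "\<epsilon> \<le> x"
  shows "\<epsilon> * x \<le> Phi x"
proof (cases "x \<le> 1")
  case True
  then show ?thesis
    using assms by (simp add: Phi_def power2_eq_square mult_right_mono)
next
  case False
  then have "\<epsilon> * x \<le> 1 * x"
    using assms by (intro mult_right_mono) auto
  moreover have "Phi x = 2 * x - 1"
    using False by (simp add: Phi_def)
  ultimately show ?thesis
    using False by linarith
qed

lemma Phi_measurable [measurable]: "Phi \<in> borel_measurable borel"
  unfolding Phi_def[abs_def] by measurable

lemma LPhi_measurable: "f \<in> LPhi M \<Longrightarrow> f \<in> borel_measurable M"
  by (simp add: LPhi_def)

lemma LPhi_integrable: "f \<in> LPhi M \<Longrightarrow> integrable M (\<lambda>x. Phi \<bar>f x\<bar>)"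
  by (auto simp: LPhi_def integrable_iff_bounded Phi_nonneg)

lemma L1_subset_LPhi: "L1 M \<subseteq> LPhi M"
proof
  fix f assume "f \<in> L1 M"
  then have f: "integrable M f"
    by (simp add: L1_def)
  then have "(\<integral>\<^sup>+x. ennreal (Phi \<bar>f x\<bar>) \<partial>M) \<le> (\<integral>\<^sup>+x. ennreal (2 * \<bar>f x\<bar>) \<partial>M)"
    by (intro nn_integral_mono ennreal_leI Phi_le) auto
  also have "\<dots> < \<infinity>"
    using f by (subst nn_integral_eq_integral) auto
  finally show "f \<in> LPhi M"
    using f by (simp add: LPhi_def)
qed

lemma truncate_small_measurable [measurable]:
  assumes [measurable]: "f \<in> borel_measurable M"
  shows "truncate_small \<epsilon> f \<in> borel_measurable M"
  unfolding truncate_small_def by measurable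

lemma truncate_small_integrable:
  assumes f: "f \<in> LPhi M" and \<epsilon>: "0 < \<epsilon>" "\<epsilon> \<le> 1"
  shows "integrable M (truncate_small \<epsilon> f)"
proof (rule Bochner_Integration.integrable_bound)
  show "integrable M (\<lambda>x. Phi \<bar>f x\<bar> / \<epsilon>)"
    using LPhi_integrable[OF f] by simp
  have "\<bar>truncate_small \<epsilon> f x\<bar> \<le> Phi \<bar>f x\<bar> / \<epsilon>" for x
    using Phi_ge_linear[OF \<epsilon>, of "\<bar>f x\<bar>"] Phi_nonneg[of "\<bar>f x\<bar>"] \<epsilon>
    by (auto simp: truncate_small_def field_simps)
  then show "AE x in M. norm (truncate_small \<epsilon> f x) \<le> norm (Phi \<bar>f x\<bar> / \<epsilon>)"
    using \<epsilon> by (auto simp: Phi_nonneg)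
qed (use LPhi_measurable[OF f] in measurable)

text \<open>The squared truncation error. Its integral is the squared distance in \<open>L^2\<close>
  between \<open>f\<close> and its truncation, and all later error bounds are expressed in
  it.\<close>

definition small_part_sq :: "real \<Rightarrow> ('a \<Rightarrow> real) \<Rightarrow> 'a \<Rightarrow> real" where
  "small_part_sq \<epsilon> f x = (f x - truncate_small \<epsilon> f x)\<^sup>2"

lemma small_part_sq_eq: "small_part_sq \<epsilon> f x = (if \<bar>f x\<bar> \<le> \<epsilon> then (f x)\<^sup>2 else 0)"
  by (simp add: small_part_sq_def truncate_small_def)

lemma small_part_sq_measurable [measurable]:
  assumes [measurable]: "f \<in> borel_measurable M"
  shows "small_part_sq \<epsilon> f \<in> borel_measurable M"
  unfolding small_part_sq_def[abs_def] by measurable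

lemma small_part_sq_nonneg [simp]: "0 \<le> small_part_sq \<epsilon> f x"
  by (simp add: small_part_sq_def)

lemma small_part_sq_le_Phi: "\<epsilon> \<le> 1 \<Longrightarrow> small_part_sq \<epsilon> f x \<le> Phi \<bar>f x\<bar>"
  by (auto simp: small_part_sq_eq Phi_nonneg) (simp add: Phi_def)

lemma small_part_sq_integrable:
  assumes f: "f \<in> LPhi M" and "\<epsilon> \<le> 1"
  shows "integrable M (small_part_sq \<epsilon> f)"
proof (rule Bochner_Integration.integrable_bound[OF LPhi_integrable[OF f]])
  show "AE x in M. norm (small_part_sq \<epsilon> f x) \<le> norm (Phi \<bar>f x\<bar>)"
    using small_part_sq_le_Phi[OF assms(2), of f] by (auto simp: Phi_nonneg)
qed (use LPhi_measurable[OF f] in measurable)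

text \<open>Dominated convergence with majorant \<open>Phi \<bar>f x\<bar>\<close>, valid for
  \<epsilon> up to 1, which explains the restriction \<open>S n < 1\<close>. At each point the
  square is eventually 0: for small \<epsilon> the truncation keeps every nonzero value.\<close>

lemma small_part_sq_tendsto_0:
  assumes f: "f \<in> LPhi M"
  shows "((\<lambda>\<epsilon>. \<integral>x. small_part_sq \<epsilon> f x \<partial>M) \<longlongrightarrow> 0) (at_right 0)"
proof -
  note [measurable] = LPhi_measurable[OF f]
  have "((\<lambda>\<epsilon>. \<integral>x. small_part_sq \<epsilon> f x \<partial>M) \<longlongrightarrow> (\<integral>x. 0 \<partial>M)) (at_right 0)"
  proof (rule tendsto_at_right_sequentially[of 0 1])
    fix S :: "nat \<Rightarrow> real" assume S: "\<And>n. 0 < S n" "\<And>n. S n < 1" "S \<longlonglongrightarrow> 0"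
    show "(\<lambda>n. \<integral>x. small_part_sq (S n) f x \<partial>M) \<longlonglongrightarrow> (\<integral>x. 0 \<partial>M)"
    proof (rule integral_dominated_convergence)
      show "AE x in M. (\<lambda>n. small_part_sq (S n) f x) \<longlonglongrightarrow> 0"
      proof (rule AE_I2)
        fix x
        show "(\<lambda>n. small_part_sq (S n) f x) \<longlonglongrightarrow> 0"
        proof (cases "f x = 0")
          case False
          then have "\<forall>\<^sub>F n in sequentially. S n < \<bar>f x\<bar>"
            using S(3) by (intro order_tendstoD) auto
          then have "\<forall>\<^sub>F n in sequentially. small_part_sq (S n) f x = 0"
            by eventually_elim (auto simp: small_part_sq_eq)
          then show ?thesis
            by (rule tendsto_eventually)
        next
          case True
          then show ?thesis
            by (simp add: small_part_sq_eq cong: if_cong)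
        qed
      qed
      show "AE x in M. norm (small_part_sq (S n) f x) \<le> Phi \<bar>f x\<bar>" for n
        using small_part_sq_le_Phi[of "S n" f] S(2)[of n] by auto
    qed (auto intro: LPhi_integrable[OF f])
  qed simp
  then show ?thesis
    by simp
qed

text \<open>Since \<open>I1\<close> is an arbitrarily chosen limit, estimates obtained for a
  constructed limit reach \<open>I1\<close> only through this uniqueness.\<close>

lemma tendsto_in_measure_unique:
  assumes "finite_measure P" and F: "F \<noteq> bot"
    and [measurable]: "\<And>i. X i \<in> borel_measurable P" "Y \<in> borel_measurable P" "Z \<in> borel_measurable P"
    and Y: "tendsto_in_measure P X Y F" and Z: "tendsto_in_measure P X Z F"
  shows "AE \<omega> in P. Y \<omega> = Z \<omega>"
proof -
  interpret finite_measure P by fact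
  have null: "measure P {\<omega>\<in>space P. \<bar>Y \<omega> - Z \<omega>\<bar> > 2 * \<delta>} = 0" if "\<delta> > 0" for \<delta>
  proof -
    have "measure P {\<omega>\<in>space P. \<bar>Y \<omega> - Z \<omega>\<bar> > 2 * \<delta>} \<le> measure P {\<omega>\<in>space P. \<bar>X i \<omega> - Y \<omega>\<bar> > \<delta>}
        + measure P {\<omega>\<in>space P. \<bar>X i \<omega> - Z \<omega>\<bar> > \<delta>}" for i
    proof -
      have "measure P {\<omega>\<in>space P. \<bar>Y \<omega> - Z \<omega>\<bar> > 2 * \<delta>}
          \<le> measure P ({\<omega>\<in>space P. \<bar>X i \<omega> - Y \<omega>\<bar> > \<delta>} \<union> {\<omega>\<in>space P. \<bar>X i \<omega> - Z \<omega>\<bar> > \<delta>})"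
        by (rule finite_measure_mono) auto
      also have "\<dots> \<le> measure P {\<omega>\<in>space P. \<bar>X i \<omega> - Y \<omega>\<bar> > \<delta>} + measure P {\<omega>\<in>space P. \<bar>X i \<omega> - Z \<omega>\<bar> > \<delta>}"
        by (rule measure_Un_le) auto
      finally show ?thesis .
    qed
    moreover have "((\<lambda>i. measure P {\<omega>\<in>space P. \<bar>X i \<omega> - Y \<omega>\<bar> > \<delta>}
        + measure P {\<omega>\<in>space P. \<bar>X i \<omega> - Z \<omega>\<bar> > \<delta>}) \<longlongrightarrow> 0 + 0) F"
      using Y Z that unfolding tendsto_in_measure_def by (intro tendsto_add) auto
    ultimately have "measure P {\<omega>\<in>space P. \<bar>Y \<omega> - Z \<omega>\<bar> > 2 * \<delta>} \<le> 0"
      by (intro tendsto_lowerbound[OF _ _ F]) auto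
    then show ?thesis
      using measure_nonneg[of P] by (intro antisym)
  qed
  have "AE \<omega> in P. \<not> \<bar>Y \<omega> - Z \<omega>\<bar> > 2 * inverse (real (Suc n))" for n
  proof (rule AE_I)
    show "emeasure P {\<omega>\<in>space P. \<bar>Y \<omega> - Z \<omega>\<bar> > 2 * inverse (real (Suc n))} = 0"
      using null[of "inverse (real (Suc n))"] by (simp add: emeasure_eq_measure)
  qed auto
  then have "AE \<omega> in P. \<forall>n. \<not> \<bar>Y \<omega> - Z \<omega>\<bar> > 2 * inverse (real (Suc n))"
    by (simp add: AE_all_countable)
  then show ?thesis
  proof eventually_elim
    case (elim \<omega>)
    show ?case
    proof (rule ccontr)
      assume "Y \<omega> \<noteq> Z \<omega>"
      then obtain n where "inverse (real (Suc n)) < \<bar>Y \<omega> - Z \<omega>\<bar> / 2"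
        using reals_Archimedean[of "\<bar>Y \<omega> - Z \<omega>\<bar> / 2"] by auto
      then show False
        using elim by (auto simp: field_simps)
    qed
  qed
qed

section \<open>The compensated Poisson integral\<close>

context poisson_space begin

text \<open>For integrable \<open>f\<close> this is the centred Poisson integral. The integral over
  \<omega> is 0 by default where \<open>f\<close> is not integrable, so additivity in
  \<open>f\<close> holds only almost everywhere.\<close>

definition cint :: "('a \<Rightarrow> real) \<Rightarrow> 'a measure \<Rightarrow> real" where
  "cint f \<omega> = (\<integral>x. f x \<partial>\<omega>) - (\<integral>x. f x \<partial>M)"

lemma cint_measurable [measurable]:
  assumes "f \<in> borel_measurable M"
  shows "cint f \<in> borel_measurable P"
  unfolding cint_def[abs_def] by (intro borel_measurable_diff integral_measurable assms) simp

text \<open>By Campbell's formula the integral of \<bar>f\<bar> over \<omega> has finite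
  expectation, hence is almost surely finite.\<close>

lemma AE_integrable_config:
  assumes f: "integrable M f"
  shows "AE \<omega> in P. integrable \<omega> (f :: 'a \<Rightarrow> real)"
proof -
  have [measurable]: "f \<in> borel_measurable M"
    using f by auto
  have "(\<integral>\<^sup>+\<omega>. (\<integral>\<^sup>+x. ennreal \<bar>f x\<bar> \<partial>\<omega>) \<partial>P) \<noteq> \<infinity>"
    using f by (simp add: campbell integrable_iff_bounded)
  then have "AE \<omega> in P. (\<integral>\<^sup>+x. ennreal \<bar>f x\<bar> \<partial>\<omega>) \<noteq> \<infinity>"
    by (intro nn_integral_PInf_AE) auto
  with AE_space show ?thesis
  proof eventually_elim
    case (elim \<omega>)
    then show ?case
      using measurable_config[OF elim(1), of f borel] by (simp add: integrable_iff_bounded less_top)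
  qed
qed

lemma cint_diff:
  assumes "integrable M f" "integrable M g"
  shows "AE \<omega> in P. cint (\<lambda>x. f x - g x) \<omega> = cint f \<omega> - cint g \<omega>"
  using AE_integrable_config[OF assms(1)] AE_integrable_config[OF assms(2)]
  by eventually_elim (use assms in \<open>simp add: cint_def\<close>)

lemma integral_config_integrable:
  assumes f: "integrable M f"
  shows "integrable P (\<lambda>\<omega>. \<integral>x. f x \<partial>\<omega> :: real)"
proof (rule integrableI_bounded)
  have [measurable]: "f \<in> borel_measurable M"
    using f by auto
  show "(\<lambda>\<omega>. \<integral>x. f x \<partial>\<omega> :: real) \<in> borel_measurable P"
    by measurable
  have "ennreal (norm (\<integral>x. f x \<partial>\<omega>)) \<le> (\<integral>\<^sup>+x. ennreal \<bar>f x\<bar> \<partial>\<omega>)" if "\<omega> \<in> space P" for \<omega>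
    by (cases "integrable \<omega> f") (use integral_norm_bound_ennreal[of \<omega> f] in \<open>auto simp: not_integrable_integral_eq\<close>)
  then have "(\<integral>\<^sup>+\<omega>. ennreal (norm (\<integral>x. f x \<partial>\<omega>)) \<partial>P) \<le> (\<integral>\<^sup>+\<omega>. (\<integral>\<^sup>+x. ennreal \<bar>f x\<bar> \<partial>\<omega>) \<partial>P)"
    by (intro nn_integral_mono) auto
  also have "\<dots> < \<infinity>"
    using f by (simp add: campbell integrable_iff_bounded)
  finally show "(\<integral>\<^sup>+\<omega>. ennreal (norm (\<integral>x. f x \<partial>\<omega>)) \<partial>P) < \<infinity>" .
qed

lemma cint_integrable: "integrable M f \<Longrightarrow> integrable P (cint f)"
  unfolding cint_def using integral_config_integrable by auto

lemma integral_config_nonneg: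
  assumes p: "integrable M p" "\<And>x. 0 \<le> (p x :: real)"
  shows "AE \<omega> in P. (\<integral>\<^sup>+x. ennreal (p x) \<partial>\<omega>) = ennreal (\<integral>x. p x \<partial>\<omega>)"
  using AE_integrable_config[OF p(1)]
  by eventually_elim (simp add: nn_integral_eq_integral p(2))

lemma expectation_integral_config:
  assumes f: "integrable M (f :: 'a \<Rightarrow> real)"
  shows "(\<integral>\<omega>. (\<integral>x. f x \<partial>\<omega>) \<partial>P) = (\<integral>x. f x \<partial>M)"
proof -
  have nonneg: "(\<integral>\<omega>. (\<integral>x. p x \<partial>\<omega>) \<partial>P) = (\<integral>x. p x \<partial>M)"
    if p: "integrable M p" "\<And>x. 0 \<le> (p x :: real)" for p
  proof -
    have [measurable]: "p \<in> borel_measurable M"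
      using p by auto
    have "(\<integral>\<^sup>+\<omega>. ennreal (\<integral>x. p x \<partial>\<omega>) \<partial>P) = (\<integral>\<^sup>+\<omega>. (\<integral>\<^sup>+x. ennreal (p x) \<partial>\<omega>) \<partial>P)"
      using integral_config_nonneg[OF p] by (intro nn_integral_cong_AE) auto
    also have "\<dots> = ennreal (\<integral>x. p x \<partial>M)"
      by (simp add: campbell nn_integral_eq_integral p)
    finally show ?thesis
      by (subst (asm) nn_integral_eq_integrable) (auto intro!: integral_nonneg_AE simp: p)
  qed
  let ?p = "\<lambda>x. max 0 (f x)" and ?q = "\<lambda>x. max 0 (- f x)"
  have p: "integrable M ?p" and q: "integrable M ?q"
    using f by auto
  have "AE \<omega> in P. (\<integral>x. f x \<partial>\<omega>) = (\<integral>x. ?p x \<partial>\<omega>) - (\<integral>x. ?q x \<partial>\<omega>)"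
    using AE_integrable_config[OF p] AE_integrable_config[OF q]
    by eventually_elim (simp add: Bochner_Integration.integral_diff[symmetric] max_def if_distrib cong: if_cong)
  then have "(\<integral>\<omega>. (\<integral>x. f x \<partial>\<omega>) \<partial>P) = (\<integral>\<omega>. (\<integral>x. ?p x \<partial>\<omega>) - (\<integral>x. ?q x \<partial>\<omega>) \<partial>P)"
    using f by (intro integral_cong_AE) auto
  also have "\<dots> = (\<integral>x. ?p x \<partial>M) - (\<integral>x. ?q x \<partial>M)"
    using p q by (simp add: integral_config_integrable nonneg)
  also have "\<dots> = (\<integral>x. ?p x - ?q x \<partial>M)"
    using p q by simp
  also have "\<dots> = (\<integral>x. f x \<partial>M)"
    by (rule Bochner_Integration.integral_cong) auto
  finally show ?thesis .
qed

lemma expectation_product_nonneg: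
  assumes p: "integrable M p" "\<And>x. 0 \<le> (p x :: real)" and q: "integrable M q" "\<And>x. 0 \<le> (q x :: real)"
    and pq: "integrable M (\<lambda>x. p x * q x)"
  shows "integrable P (\<lambda>\<omega>. (\<integral>x. p x \<partial>\<omega>) * (\<integral>x. q x \<partial>\<omega>))"
    "(\<integral>\<omega>. (\<integral>x. p x \<partial>\<omega>) * (\<integral>x. q x \<partial>\<omega>) \<partial>P) = (\<integral>x. p x * q x \<partial>M) + (\<integral>x. p x \<partial>M) * (\<integral>x. q x \<partial>M)"
proof -
  have [measurable]: "p \<in> borel_measurable M" "q \<in> borel_measurable M"
    using p q by auto
  have "(\<integral>\<^sup>+\<omega>. ennreal ((\<integral>x. p x \<partial>\<omega>) * (\<integral>x. q x \<partial>\<omega>)) \<partial>P)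
      = (\<integral>\<^sup>+\<omega>. (\<integral>\<^sup>+x. ennreal (p x) \<partial>\<omega>) * (\<integral>\<^sup>+x. ennreal (q x) \<partial>\<omega>) \<partial>P)"
    by (intro nn_integral_cong_AE, use integral_config_nonneg[OF p] integral_config_nonneg[OF q] in eventually_elim)
      (simp add: ennreal_mult p q integral_nonneg_AE)
  also have "\<dots> = ennreal ((\<integral>x. p x * q x \<partial>M) + (\<integral>x. p x \<partial>M) * (\<integral>x. q x \<partial>M))"
    using p q pq
    by (simp add: nn_integral_product nn_integral_eq_integral ennreal_mult[symmetric] ennreal_plus[symmetric]
        integral_nonneg_AE del: ennreal_plus)
  finally have "integrable P (\<lambda>\<omega>. (\<integral>x. p x \<partial>\<omega>) * (\<integral>x. q x \<partial>\<omega>)) \<and>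
    (\<integral>\<omega>. (\<integral>x. p x \<partial>\<omega>) * (\<integral>x. q x \<partial>\<omega>) \<partial>P) = (\<integral>x. p x * q x \<partial>M) + (\<integral>x. p x \<partial>M) * (\<integral>x. q x \<partial>M)"
    by (subst (asm) nn_integral_eq_integrable)
      (auto intro!: integral_nonneg_AE mult_nonneg_nonneg add_nonneg_nonneg simp: p q)
  then show "integrable P (\<lambda>\<omega>. (\<integral>x. p x \<partial>\<omega>) * (\<integral>x. q x \<partial>\<omega>))"
    "(\<integral>\<omega>. (\<integral>x. p x \<partial>\<omega>) * (\<integral>x. q x \<partial>\<omega>) \<partial>P) = (\<integral>x. p x * q x \<partial>M) + (\<integral>x. p x \<partial>M) * (\<integral>x. q x \<partial>M)"
    by auto
qed

text \<open>Expand the square in the integrals \<open>?U\<close>, \<open>?V\<close> of the positive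
  and negative parts. The parts have product 0, so the mixed moment is just \<open>?a * ?b\<close>;
  all terms in the means then cancel and the integrals of the two squares remain.\<close>

lemma cint_isometry:
  assumes f: "integrable M (f :: 'a \<Rightarrow> real)" and f2: "integrable M (\<lambda>x. (f x)\<^sup>2)"
  shows "integrable P (\<lambda>\<omega>. (cint f \<omega>)\<^sup>2)" "(\<integral>\<omega>. (cint f \<omega>)\<^sup>2 \<partial>P) = (\<integral>x. (f x)\<^sup>2 \<partial>M)"
proof -
  let ?p = "\<lambda>x. max 0 (f x)" and ?q = "\<lambda>x. max 0 (- f x)"
  have fm[measurable]: "f \<in> borel_measurable M"
    using f by auto
  have p: "integrable M ?p" and q: "integrable M ?q"
    using f by auto
  have p2: "integrable M (\<lambda>x. ?p x * ?p x)" and q2: "integrable M (\<lambda>x. ?q x * ?q x)"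
    by (rule Bochner_Integration.integrable_bound[OF f2]; auto simp: max_def power2_eq_square)+
  have pq0: "?p x * ?q x = 0" for x
    by (auto simp: max_def)
  have pq: "integrable M (\<lambda>x. ?p x * ?q x)"
    unfolding pq0 by simp
  let ?U = "\<lambda>\<omega>. \<integral>x. ?p x \<partial>\<omega>" and ?V = "\<lambda>\<omega>. \<integral>x. ?q x \<partial>\<omega>"
  let ?a = "\<integral>x. ?p x \<partial>M" and ?b = "\<integral>x. ?q x \<partial>M"
  note U2 = expectation_product_nonneg[OF p _ p _ p2, simplified max.cobounded1]
  note V2 = expectation_product_nonneg[OF q _ q _ q2, simplified max.cobounded1]
  note UV = expectation_product_nonneg[OF p _ q _ pq, simplified max.cobounded1]
  have pqf: "(\<lambda>x. ?p x - ?q x) = f"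
    by (auto simp: max_def)
  have ab: "(\<integral>x. f x \<partial>M) = ?a - ?b"
    using Bochner_Integration.integral_diff[OF p q] unfolding pqf .
  let ?W = "\<lambda>\<omega>. ?U \<omega> * ?U \<omega> - 2 * (?U \<omega> * ?V \<omega>) + ?V \<omega> * ?V \<omega> - 2 * (?a - ?b) * (?U \<omega> - ?V \<omega>) + (?a - ?b)\<^sup>2"
  have W: "integrable P ?W"
    using U2(1) V2(1) UV(1) integral_config_integrable[OF p] integral_config_integrable[OF q] by auto
  have eq: "AE \<omega> in P. (cint f \<omega>)\<^sup>2 = ?W \<omega>"
    using AE_integrable_config[OF p] AE_integrable_config[OF q]
  proof eventually_elim
    case (elim \<omega>)
    have UV: "(\<integral>x. f x \<partial>\<omega>) = ?U \<omega> - ?V \<omega>"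
      using Bochner_Integration.integral_diff[OF elim] unfolding pqf .
    show ?case
      unfolding cint_def ab UV by (simp add: power2_eq_square algebra_simps)
  qed
  show "integrable P (\<lambda>\<omega>. (cint f \<omega>)\<^sup>2)"
    by (rule integrable_cong_AE_imp[OF W]) (use eq in auto)
  have "(\<integral>\<omega>. (cint f \<omega>)\<^sup>2 \<partial>P) = (\<integral>\<omega>. ?W \<omega> \<partial>P)"
    using eq by (intro integral_cong_AE) auto
  also have "\<dots> = (\<integral>x. ?p x * ?p x \<partial>M) + (\<integral>x. ?q x * ?q x \<partial>M)"
    using U2(1) V2(1) UV(1) integral_config_integrable[OF p] integral_config_integrable[OF q]
    by (simp add: U2(2) V2(2) UV(2) pq0 expectation_integral_config p q P.prob_space)
      (simp add: power2_eq_square algebra_simps)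
  also have "\<dots> = (\<integral>x. ?p x * ?p x + ?q x * ?q x \<partial>M)"
    using p2 q2 by simp
  also have "\<dots> = (\<integral>x. (f x)\<^sup>2 \<partial>M)"
    by (rule Bochner_Integration.integral_cong) (auto simp: max_def power2_eq_square)
  finally show "(\<integral>\<omega>. (cint f \<omega>)\<^sup>2 \<partial>P) = (\<integral>x. (f x)\<^sup>2 \<partial>M)" .
qed

lemma nn_integral_cint_le:
  assumes f: "integrable M (f :: 'a \<Rightarrow> real)" and f2: "integrable M (\<lambda>x. (f x)\<^sup>2)"
  shows "(\<integral>\<^sup>+\<omega>. ennreal \<bar>cint f \<omega>\<bar> \<partial>P) \<le> ennreal (sqrt (\<integral>x. (f x)\<^sup>2 \<partial>M))"
proof -
  have i: "integrable P (\<lambda>\<omega>. \<bar>cint f \<omega>\<bar>)"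
    using cint_integrable[OF f] by auto
  \<comment> \<open>Nonnegativity of this variance is the inequality between first and second
    absolute moments; the isometry evaluates the second.\<close>
  have "0 \<le> P.variance (\<lambda>\<omega>. \<bar>cint f \<omega>\<bar>)"
    by (rule P.variance_positive)
  also have "\<dots> = (\<integral>\<omega>. (cint f \<omega>)\<^sup>2 \<partial>P) - (\<integral>\<omega>. \<bar>cint f \<omega>\<bar> \<partial>P)\<^sup>2"
    using P.variance_eq[OF i] cint_isometry(1)[OF f f2] by simp
  finally have "(\<integral>\<omega>. \<bar>cint f \<omega>\<bar> \<partial>P) \<le> sqrt (\<integral>x. (f x)\<^sup>2 \<partial>M)"
    unfolding cint_isometry(2)[OF f f2] by (intro real_le_rsqrt) simp
  then show ?thesis
    using i by (subst nn_integral_eq_integral) (auto intro: ennreal_leI)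
qed

text \<open>Where the two truncations differ, exactly one of them has dropped \<open>f x\<close>,
  and the squared difference is the corresponding small part.\<close>

lemma cint_truncate_cauchy:
  assumes f: "f \<in> LPhi M" and \<delta>: "0 < \<delta>" "\<delta> \<le> 1" and \<epsilon>: "0 < \<epsilon>" "\<epsilon> \<le> 1"
  shows "(\<integral>\<^sup>+\<omega>. ennreal \<bar>cint (truncate_small \<delta> f) \<omega> - cint (truncate_small \<epsilon> f) \<omega>\<bar> \<partial>P)
    \<le> ennreal (sqrt ((\<integral>x. small_part_sq \<delta> f x \<partial>M) + (\<integral>x. small_part_sq \<epsilon> f x \<partial>M)))"
proof -
  let ?d = "\<lambda>x. truncate_small \<delta> f x - truncate_small \<epsilon> f x"
  note i\<delta> = truncate_small_integrable[OF f \<delta>] and i\<epsilon> = truncate_small_integrable[OF f \<epsilon>]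
  note s\<delta> = small_part_sq_integrable[OF f \<delta>(2)] and s\<epsilon> = small_part_sq_integrable[OF f \<epsilon>(2)]
  have bound: "(?d x)\<^sup>2 \<le> small_part_sq \<delta> f x + small_part_sq \<epsilon> f x" for x
    by (auto simp: small_part_sq_def truncate_small_def)
  have i: "integrable M ?d"
    using i\<delta> i\<epsilon> by simp
  have i2: "integrable M (\<lambda>x. (?d x)\<^sup>2)"
    by (rule Bochner_Integration.integrable_bound[OF Bochner_Integration.integrable_add[OF s\<delta> s\<epsilon>]])
      (use i bound in auto)
  have "(\<integral>\<^sup>+\<omega>. ennreal \<bar>cint (truncate_small \<delta> f) \<omega> - cint (truncate_small \<epsilon> f) \<omega>\<bar> \<partial>P)
      = (\<integral>\<^sup>+\<omega>. ennreal \<bar>cint ?d \<omega>\<bar> \<partial>P)"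
    using cint_diff[OF i\<delta> i\<epsilon>] by (intro nn_integral_cong_AE) auto
  also have "\<dots> \<le> ennreal (sqrt (\<integral>x. (?d x)\<^sup>2 \<partial>M))"
    by (rule nn_integral_cint_le[OF i i2])
  also have "\<dots> \<le> ennreal (sqrt (\<integral>x. small_part_sq \<delta> f x + small_part_sq \<epsilon> f x \<partial>M))"
    using i2 s\<delta> s\<epsilon> bound by (intro ennreal_leI real_sqrt_le_mono integral_mono) auto
  finally show ?thesis
    using s\<delta> s\<epsilon> by simp
qed

text \<open>The limit is taken along a rapidly decreasing sequence of levels, where it exists almost
  surely. Fatou's lemma then bounds its distance to the truncated integral at every level, not only
  along the sequence.\<close>

lemma cint_truncate_limit:
  assumes f: "f \<in> LPhi M"
  shows "\<exists>Y\<in>borel_measurable P. \<forall>\<epsilon>. 0 < \<epsilon> \<longrightarrow> \<epsilon> \<le> 1 \<longrightarrow>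
    (\<integral>\<^sup>+\<omega>. ennreal \<bar>cint (truncate_small \<epsilon> f) \<omega> - Y \<omega>\<bar> \<partial>P) \<le> ennreal (sqrt (\<integral>x. small_part_sq \<epsilon> f x \<partial>M))"
proof -
  note [measurable] = LPhi_measurable[OF f]
  let ?r = "\<lambda>\<epsilon>. \<integral>x. small_part_sq \<epsilon> f x \<partial>M"
  have r0: "0 \<le> ?r \<epsilon>" for \<epsilon>
    by (intro integral_nonneg_AE) simp
  \<comment> \<open>The Cauchy bound takes a square root, so squared errors of order
    \<open>(1/4) ^ k\<close> yield increments of order \<open>(1/2) ^ k\<close>, which are
    summable.\<close>
  have "\<exists>\<epsilon>>0. \<epsilon> \<le> 1 \<and> ?r \<epsilon> \<le> (1/4) ^ k" for k :: nat
  proof -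
    have "\<forall>\<^sub>F \<epsilon> in at_right 0. ?r \<epsilon> < (1/4) ^ k"
      by (rule order_tendstoD(2)[OF small_part_sq_tendsto_0[OF f]]) simp
    moreover have "\<forall>\<^sub>F \<epsilon> in at_right (0::real). \<epsilon> < 1"
      by (simp add: eventually_at_right_field) (rule exI[of _ 1], simp)
    moreover have "\<forall>\<^sub>F \<epsilon> in at_right (0::real). 0 < \<epsilon>"
      by (rule eventually_at_right_less)
    ultimately have "\<forall>\<^sub>F \<epsilon> in at_right 0. 0 < \<epsilon> \<and> \<epsilon> \<le> 1 \<and> ?r \<epsilon> \<le> (1/4) ^ k"
      by eventually_elim auto
    then show ?thesis
      using eventually_happens trivial_limit_at_right_real by blast
  qed
  then obtain e where e: "\<And>k :: nat. 0 < e k" "\<And>k. e k \<le> 1" "\<And>k. ?r (e k) \<le> (1/4) ^ k"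
    by metis
  define X where "X k = cint (truncate_small (e k) f)" for k
  have [measurable]: "X k \<in> borel_measurable P" for k
    unfolding X_def by measurable
  have step: "(\<integral>\<^sup>+\<omega>. ennreal \<bar>X (Suc k) \<omega> - X k \<omega>\<bar> \<partial>P) \<le> ennreal (2 * (1/2) ^ k)" for k
  proof -
    have "?r (e (Suc k)) + ?r (e k) \<le> (1/4) ^ Suc k + (1/4) ^ k"
      by (intro add_mono e)
    also have "\<dots> \<le> (2 * (1/2) ^ k)\<^sup>2"
      by (simp add: power_mult_distrib power2_eq_square power_mult_distrib[symmetric])
    finally have "sqrt (?r (e (Suc k)) + ?r (e k)) \<le> 2 * (1/2) ^ k"
      by (intro real_le_lsqrt) auto
    then show ?thesis
      unfolding X_def by (intro order_trans[OF cint_truncate_cauchy[OF f e(1,2) e(1,2)]] ennreal_leI)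
  qed
  have "(\<integral>\<^sup>+\<omega>. (\<Sum>k. ennreal \<bar>X (Suc k) \<omega> - X k \<omega>\<bar>) \<partial>P) = (\<Sum>k. \<integral>\<^sup>+\<omega>. ennreal \<bar>X (Suc k) \<omega> - X k \<omega>\<bar> \<partial>P)"
    by (rule nn_integral_suminf) measurable
  also have "\<dots> \<le> (\<Sum>k. ennreal (2 * (1/2) ^ k))"
    by (intro suminf_le step) auto
  also have "\<dots> = ennreal (2 * 2)"
    by (intro suminf_ennreal_eq sums_mult) (use geometric_sums[of "1/2 :: real"] in auto)
  finally have "(\<integral>\<^sup>+\<omega>. (\<Sum>k. ennreal \<bar>X (Suc k) \<omega> - X k \<omega>\<bar>) \<partial>P) \<noteq> \<infinity>"
    by (auto simp: top_unique)
  then have "AE \<omega> in P. (\<Sum>k. ennreal \<bar>X (Suc k) \<omega> - X k \<omega>\<bar>) \<noteq> \<infinity>"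
    by (intro nn_integral_PInf_AE) auto
  then have conv: "AE \<omega> in P. (\<lambda>k. X k \<omega>) \<longlonglongrightarrow> lim (\<lambda>k. X k \<omega>)"
  proof eventually_elim
    case (elim \<omega>)
    then have "summable (\<lambda>k. \<bar>X (Suc k) \<omega> - X k \<omega>\<bar>)"
      by (intro summable_suminf_not_top) auto
    then have "summable (\<lambda>k. X (Suc k) \<omega> - X k \<omega>)"
      by (rule summable_rabs_cancel)
    then have "convergent (\<lambda>n. \<Sum>k<n. X (Suc k) \<omega> - X k \<omega>)"
      by (simp add: summable_iff_convergent)
    then have "convergent (\<lambda>n. X n \<omega> - X 0 \<omega>)"
      by (simp only: sum_lessThan_telescope[of "\<lambda>k. X k \<omega>"])
    from convergent_add[OF this convergent_const[of "X 0 \<omega>"]] show ?case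
      by (simp add: convergent_LIMSEQ_iff)
  qed
  define Y where "Y \<omega> = lim (\<lambda>k. X k \<omega>)" for \<omega>
  have [measurable]: "Y \<in> borel_measurable P"
    unfolding Y_def[abs_def] by measurable
  have "(\<integral>\<^sup>+\<omega>. ennreal \<bar>cint (truncate_small \<epsilon> f) \<omega> - Y \<omega>\<bar> \<partial>P) \<le> ennreal (sqrt (?r \<epsilon>))"
    if \<epsilon>: "0 < \<epsilon>" "\<epsilon> \<le> 1" for \<epsilon>
  proof -
    let ?c = "cint (truncate_small \<epsilon> f)"
    \<comment> \<open>Almost everywhere \<open>X k\<close> converges to \<open>Y\<close>, so the
      integrand is a lower limit, and Fatou transports the Cauchy bound from \<open>X k\<close> to
      \<open>Y\<close>.\<close>
    have "(\<integral>\<^sup>+\<omega>. ennreal \<bar>?c \<omega> - Y \<omega>\<bar> \<partial>P) = (\<integral>\<^sup>+\<omega>. liminf (\<lambda>k. ennreal \<bar>?c \<omega> - X k \<omega>\<bar>) \<partial>P)"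
      using conv
    proof (intro nn_integral_cong_AE, eventually_elim)
      case (elim \<omega>)
      then have "(\<lambda>k. ennreal \<bar>?c \<omega> - X k \<omega>\<bar>) \<longlonglongrightarrow> ennreal \<bar>?c \<omega> - Y \<omega>\<bar>"
        unfolding Y_def by (intro tendsto_intros)
      then show ?case
        by (rule lim_imp_Liminf[OF sequentially_bot, symmetric])
    qed
    also have "\<dots> \<le> liminf (\<lambda>k. \<integral>\<^sup>+\<omega>. ennreal \<bar>?c \<omega> - X k \<omega>\<bar> \<partial>P)"
      by (rule nn_integral_liminf) measurable
    also have "\<dots> \<le> liminf (\<lambda>k. ennreal (sqrt (?r \<epsilon> + (1/4) ^ k)))"
    proof (intro Liminf_mono always_eventually allI)
      fix k
      show "(\<integral>\<^sup>+\<omega>. ennreal \<bar>?c \<omega> - X k \<omega>\<bar> \<partial>P) \<le> ennreal (sqrt (?r \<epsilon> + (1/4) ^ k))"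
        unfolding X_def
        by (intro order_trans[OF cint_truncate_cauchy[OF f \<epsilon> e(1,2)]] ennreal_leI real_sqrt_le_mono add_left_mono e(3))
    qed
    also have "\<dots> = ennreal (sqrt (?r \<epsilon> + 0))"
      by (intro lim_imp_Liminf tendsto_intros LIMSEQ_realpow_zero) auto
    finally show ?thesis
      by simp
  qed
  then show ?thesis
    by (intro bexI[of _ Y]) auto
qed

lemma tendsto_in_measure_cint:
  assumes f: "f \<in> LPhi M" and [measurable]: "Y \<in> borel_measurable P"
    and Y: "\<And>\<epsilon>. 0 < \<epsilon> \<Longrightarrow> \<epsilon> \<le> 1 \<Longrightarrow> (\<integral>\<^sup>+\<omega>. ennreal \<bar>cint (truncate_small \<epsilon> f) \<omega> - Y \<omega>\<bar> \<partial>P)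
      \<le> ennreal (sqrt (\<integral>x. small_part_sq \<epsilon> f x \<partial>M))"
  shows "tendsto_in_measure P (\<lambda>\<epsilon>. cint (truncate_small \<epsilon> f)) Y (at_right 0)"
  unfolding tendsto_in_measure_def
proof (intro allI impI)
  fix \<delta> :: real assume \<delta>: "0 < \<delta>"
  note [measurable] = LPhi_measurable[OF f]
  let ?r = "\<lambda>\<epsilon>. \<integral>x. small_part_sq \<epsilon> f x \<partial>M"
  let ?X = "\<lambda>\<epsilon>. cint (truncate_small \<epsilon> f)"
  have bound: "P.prob {\<omega>\<in>space P. \<bar>?X \<epsilon> \<omega> - Y \<omega>\<bar> > \<delta>} \<le> sqrt (?r \<epsilon>) / \<delta>" if \<epsilon>: "0 < \<epsilon>" "\<epsilon> \<le> 1" for \<epsilon>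
  proof -
    have i: "integrable P (\<lambda>\<omega>. ?X \<epsilon> \<omega> - Y \<omega>)"
      using order_le_less_trans[OF Y[OF \<epsilon>], of \<infinity>] by (intro integrableI_bounded) auto
    have "P.prob {\<omega>\<in>space P. \<bar>?X \<epsilon> \<omega> - Y \<omega>\<bar> > \<delta>} \<le> P.prob {\<omega>\<in>space P. \<delta> \<le> \<bar>?X \<epsilon> \<omega> - Y \<omega>\<bar>}"
      by (rule P.finite_measure_mono) auto
    also have "\<dots> \<le> (\<integral>\<omega>. \<bar>?X \<epsilon> \<omega> - Y \<omega>\<bar> \<partial>P) / \<delta>"
      by (rule integral_Markov_inequality_measure[where A="{}"]) (use i \<delta> in auto)
    also have "(\<integral>\<omega>. \<bar>?X \<epsilon> \<omega> - Y \<omega>\<bar> \<partial>P) \<le> sqrt (?r \<epsilon>)"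
      using Y[OF \<epsilon>] i by (subst (asm) nn_integral_eq_integral) (auto simp: ennreal_le_iff integral_nonneg_AE)
    finally show ?thesis
      using \<delta> by (simp add: divide_right_mono)
  qed
  have "\<forall>\<^sub>F \<epsilon> in at_right (0::real). 0 < \<epsilon> \<and> \<epsilon> < 1"
    by (simp add: eventually_at_right_field) (rule exI[of _ 1], simp)
  then have "\<forall>\<^sub>F \<epsilon> in at_right 0. P.prob {\<omega>\<in>space P. \<bar>?X \<epsilon> \<omega> - Y \<omega>\<bar> > \<delta>} \<le> sqrt (?r \<epsilon>) / \<delta>"
    by eventually_elim (auto intro: bound)
  moreover have "((\<lambda>\<epsilon>. sqrt (?r \<epsilon>) / \<delta>) \<longlongrightarrow> sqrt 0 / \<delta>) (at_right 0)"
    using \<delta> by (intro tendsto_intros small_part_sq_tendsto_0[OF f]) auto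
  ultimately show "((\<lambda>\<epsilon>. P.prob {\<omega>\<in>space P. \<bar>?X \<epsilon> \<omega> - Y \<omega>\<bar> > \<delta>}) \<longlongrightarrow> 0) (at_right 0)"
    by - (rule tendsto_sandwich[of "\<lambda>_. 0" _ _ "\<lambda>\<epsilon>. sqrt (?r \<epsilon>) / \<delta>"], auto)
qed

text \<open>\<open>I1\<close> is defined by convergence in measure; the bound shows that the
  convergence is even in mean, with an explicit rate. This is what allows limits under expectations
  against bounded variables.\<close>

lemma I1_approx:
  assumes f: "f \<in> LPhi M"
  shows "I1 M P f \<in> borel_measurable P"
    and "0 < \<epsilon> \<Longrightarrow> \<epsilon> \<le> 1 \<Longrightarrow> (\<integral>\<^sup>+\<omega>. ennreal \<bar>cint (truncate_small \<epsilon> f) \<omega> - I1 M P f \<omega>\<bar> \<partial>P)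
      \<le> ennreal (sqrt (\<integral>x. small_part_sq \<epsilon> f x \<partial>M))"
proof -
  note [measurable] = LPhi_measurable[OF f]
  let ?lim = "\<lambda>Y. Y \<in> borel_measurable P \<and> tendsto_in_measure P (\<lambda>\<epsilon>. cint (truncate_small \<epsilon> f)) Y (at_right 0)"
  obtain Y where Y: "Y \<in> borel_measurable P"
    "\<And>\<epsilon>. 0 < \<epsilon> \<Longrightarrow> \<epsilon> \<le> 1 \<Longrightarrow> (\<integral>\<^sup>+\<omega>. ennreal \<bar>cint (truncate_small \<epsilon> f) \<omega> - Y \<omega>\<bar> \<partial>P)
      \<le> ennreal (sqrt (\<integral>x. small_part_sq \<epsilon> f x \<partial>M))"
    using cint_truncate_limit[OF f] by blast
  have Y': "?lim Y"
    using tendsto_in_measure_cint[OF f Y] Y(1) by simp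
  have "I1 M P f = (SOME Y. ?lim Y)"
    unfolding I1_def cint_def[abs_def] ..
  then have I1: "?lim (I1 M P f)"
    using someI[of ?lim, OF Y'] by simp
  then show "I1 M P f \<in> borel_measurable P"
    by simp
  have "AE \<omega> in P. I1 M P f \<omega> = Y \<omega>"
    by (rule tendsto_in_measure_unique[where X="\<lambda>\<epsilon>. cint (truncate_small \<epsilon> f)" and F="at_right 0"])
      (use I1 Y' P.finite_measure_axioms in \<open>auto simp: trivial_limit_at_right_real\<close>)
  then have "(\<integral>\<^sup>+\<omega>. ennreal \<bar>cint (truncate_small \<epsilon> f) \<omega> - I1 M P f \<omega>\<bar> \<partial>P)
     = (\<integral>\<^sup>+\<omega>. ennreal \<bar>cint (truncate_small \<epsilon> f) \<omega> - Y \<omega>\<bar> \<partial>P)"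
    by (intro nn_integral_cong_AE) auto
  then show "0 < \<epsilon> \<Longrightarrow> \<epsilon> \<le> 1 \<Longrightarrow> (\<integral>\<^sup>+\<omega>. ennreal \<bar>cint (truncate_small \<epsilon> f) \<omega> - I1 M P f \<omega>\<bar> \<partial>P)
      \<le> ennreal (sqrt (\<integral>x. small_part_sq \<epsilon> f x \<partial>M))"
    using Y(2) by simp
qed

lemma I1_integrable:
  assumes f: "f \<in> LPhi M"
  shows "integrable P (I1 M P f)"
proof -
  note [measurable] = LPhi_measurable[OF f] I1_approx(1)[OF f]
  let ?c = "cint (truncate_small 1 f)"
  have "integrable P (\<lambda>\<omega>. ?c \<omega> - I1 M P f \<omega>)"
    using order_le_less_trans[OF I1_approx(2)[OF f, of 1], of \<infinity>] by (intro integrableI_bounded) auto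
  moreover have "integrable P ?c"
    by (intro cint_integrable truncate_small_integrable[OF f]) auto
  ultimately have "integrable P (\<lambda>\<omega>. ?c \<omega> - (?c \<omega> - I1 M P f \<omega>))"
    by (rule Bochner_Integration.integrable_diff[rotated])
  then show ?thesis
    by simp
qed

end

section \<open>Transfer operators on the base space\<close>

lemma LinftyE:
  assumes "g \<in> Linfty M"
  obtains C where "0 \<le> C" "AE x in M. \<bar>g x\<bar> \<le> C"
proof -
  obtain C where "AE x in M. \<bar>g x\<bar> \<le> C"
    using assms by (auto simp: Linfty_def)
  then have "AE x in M. \<bar>g x\<bar> \<le> max C 0"
    by eventually_elim auto
  then show ?thesis
    by (intro that[of "max C 0"]) auto
qed

lemma Linfty_measurable: "g \<in> Linfty M \<Longrightarrow> g \<in> borel_measurable M"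
  by (simp add: Linfty_def)

lemma LinftyI: "g \<in> borel_measurable M \<Longrightarrow> (\<And>x. x \<in> space M \<Longrightarrow> \<bar>g x\<bar> \<le> C) \<Longrightarrow> g \<in> Linfty M"
  by (auto simp: Linfty_def)

lemma AE_measure_preserving:
  assumes "T \<in> M \<rightarrow>\<^sub>M M" "distr M M T = M" "AE x in M. Q x"
  shows "AE x in M. Q (T x)"
  by (rule AE_distrD[OF assms(1)], subst assms(2), rule assms(3))

lemma Linfty_comp:
  assumes T: "T \<in> M \<rightarrow>\<^sub>M M" "distr M M T = M" and g: "g \<in> Linfty M"
  shows "(\<lambda>x. g (T x)) \<in> Linfty M"
proof -
  obtain C where "AE x in M. \<bar>g x\<bar> \<le> C"
    using LinftyE[OF g] .
  from AE_measure_preserving[OF T this] show ?thesis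
    using measurable_compose[OF T(1) Linfty_measurable[OF g]] by (auto simp: Linfty_def)
qed

lemma integrable_mult_Linfty:
  assumes f: "integrable M f" and g: "g \<in> Linfty M"
  shows "integrable M (\<lambda>x. f x * g x :: real)"
proof -
  obtain C where C0: "0 \<le> C" and C: "AE x in M. \<bar>g x\<bar> \<le> C"
    using LinftyE[OF g] .
  show ?thesis
  proof (rule Bochner_Integration.integrable_bound)
    show "integrable M (\<lambda>x. C * f x)"
      using f by simp
    show "AE x in M. norm (f x * g x) \<le> norm (C * f x)"
      using C
    proof eventually_elim
      case (elim x)
      then show ?case
        using mult_right_mono[OF elim, of "\<bar>f x\<bar>"] C0 by (simp add: abs_mult mult.commute)
    qed
  qed (use f Linfty_measurable[OF g] in measurable)
qed

lemma abs_integral_mult_Linfty_le: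
  fixes X G :: "'a \<Rightarrow> real"
  assumes X: "integrable M X" "(\<integral>\<^sup>+x. ennreal \<bar>X x\<bar> \<partial>M) \<le> ennreal B" "0 \<le> B"
    and G: "G \<in> borel_measurable M" "AE x in M. \<bar>G x\<bar> \<le> C" "0 \<le> C"
  shows "\<bar>\<integral>x. X x * G x \<partial>M\<bar> \<le> C * B"
proof -
  have GL: "G \<in> Linfty M"
    using G by (auto simp: Linfty_def)
  have "(\<integral>x. \<bar>X x\<bar> \<partial>M) \<le> B"
    using X by (subst (asm) nn_integral_eq_integral) auto
  have "\<bar>\<integral>x. X x * G x \<partial>M\<bar> \<le> (\<integral>x. \<bar>X x * G x\<bar> \<partial>M)"
    by (rule integral_abs_bound)
  also have "\<dots> \<le> (\<integral>x. C * \<bar>X x\<bar> \<partial>M)"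
  proof (rule integral_mono_AE)
    show "integrable M (\<lambda>x. \<bar>X x * G x\<bar>)"
      using integrable_mult_Linfty[OF X(1) GL] by auto
    show "AE x in M. \<bar>X x * G x\<bar> \<le> C * \<bar>X x\<bar>"
      using G(2) by eventually_elim (auto simp: abs_mult mult.commute intro!: mult_right_mono)
  qed (use X in auto)
  also have "\<dots> \<le> C * B"
    using \<open>(\<integral>x. \<bar>X x\<bar> \<partial>M) \<le> B\<close> G(3) by (simp add: mult_left_mono)
  finally show ?thesis .
qed

text \<open>Testing with the sign of the difference, a bounded function, turns the duality into
  vanishing of the integral of the absolute difference.\<close>

lemma L1_eq_AE_if_dual_eq:
  assumes k: "k \<in> L1 M" and k': "k' \<in> L1 M"
    and eq: "\<And>g. g \<in> Linfty M \<Longrightarrow> (\<integral>x. k x * g x \<partial>M) = (\<integral>x. k' x * g x \<partial>M)"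
  shows "AE x in M. k x = k' x"
proof -
  have i: "integrable M k" "integrable M k'"
    using k k' by (auto simp: L1_def)
  then have [measurable]: "k \<in> borel_measurable M" "k' \<in> borel_measurable M"
    by auto
  let ?g = "\<lambda>x. sgn (k x - k' x)"
  have g: "?g \<in> Linfty M"
    by (rule LinftyI[of _ _ 1]) (auto simp: sgn_real_def)
  have "(\<integral>x. \<bar>k x - k' x\<bar> \<partial>M) = (\<integral>x. k x * ?g x - k' x * ?g x \<partial>M)"
    by (intro Bochner_Integration.integral_cong refl) (simp add: abs_sgn left_diff_distrib)
  also have "\<dots> = 0"
    using eq[OF g] integrable_mult_Linfty[OF i(1) g] integrable_mult_Linfty[OF i(2) g] by simp
  finally show ?thesis
    using i by (subst (asm) integral_nonneg_eq_0_iff_AE) auto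
qed

lemma nn_integral_le_exhaustion:
  assumes [measurable]: "F \<in> borel_measurable M"
    and A: "\<And>i :: nat. A i \<in> sets M" "incseq A" "(\<Union>i. A i) = space M"
    and le: "\<And>i. (\<integral>\<^sup>+x. F x * indicator (A i) x \<partial>M) \<le> C"
  shows "(\<integral>\<^sup>+x. F x \<partial>M) \<le> C"
proof -
  have "(\<integral>\<^sup>+x. F x \<partial>M) = emeasure (density M F) (space M)"
    by (subst emeasure_density) (auto intro!: nn_integral_cong)
  also have "\<dots> = (SUP i. emeasure (density M F) (A i))"
    using A by (subst SUP_emeasure_incseq) auto
  also have "\<dots> \<le> C"
    using A(1) le by (intro SUP_least) (simp add: emeasure_density)
  finally show ?thesis .
qed

text \<open>\<open>Phi\<close> lies above its tangent at \<kappa>, with slope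
  \<open>2 * min \<kappa> 1\<close>. The terms are arranged without subtraction so that the
  inequality can be used in \<open>ennreal\<close>.\<close>

lemma Phi_tangent:
  fixes u \<kappa> :: real
  assumes "0 \<le> u" "0 \<le> \<kappa>"
  shows "Phi \<kappa> + 2 * min \<kappa> 1 * u \<le> Phi u + 2 * min \<kappa> 1 * \<kappa>"
proof (cases "\<kappa> \<le> 1")
  case True
  show ?thesis
  proof (cases "u \<le> 1")
    case u: True
    have "0 \<le> (u - \<kappa>)\<^sup>2"
      by simp
    then show ?thesis
      using True u by (simp add: Phi_def power2_eq_square algebra_simps)
  next
    case False
    have "0 \<le> (1 - \<kappa>) * (2 * u - 1 - \<kappa>)"
      using True False by (intro mult_nonneg_nonneg) auto
    then show ?thesis
      using True False by (simp add: Phi_def power2_eq_square algebra_simps)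
  qed
next
  case False
  have "0 \<le> (u - 1)\<^sup>2"
    by simp
  then have "2 * u - 1 \<le> Phi u"
    by (auto simp: Phi_def power2_eq_square algebra_simps)
  then show ?thesis
    using False by (simp add: Phi_def)
qed

section \<open>Transfer of nonnegative functions\<close>

locale endomorphism_space = sigma_finite_measure M for M :: "'a measure" +
  fixes T :: "'a \<Rightarrow> 'a"
  assumes endo: "endomorphism M T"
begin

lemma T_measurable [measurable]: "T \<in> M \<rightarrow>\<^sub>M M"
  using endo by (simp add: endomorphism_def)

lemma distr_T: "distr M M T = M"
  using endo by (intro measure_eqI) (auto simp: emeasure_distr endomorphism_def)

lemma nn_integral_T: "g \<in> borel_measurable M \<Longrightarrow> (\<integral>\<^sup>+x. g (T x) \<partial>M) = (\<integral>\<^sup>+x. g x \<partial>M)"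
  using nn_integral_distr[OF T_measurable, of g] by (simp add: distr_T)

text \<open>The transfer is the Radon-Nikodym density of the image under \<open>T\<close> of the
  measure with density \<open>u\<close>; absolute continuity holds because preimages of null sets
  are null. The density may still take the value infinity.\<close>

lemma ex_nn_transfer:
  assumes [measurable]: "u \<in> borel_measurable M"
  shows "\<exists>k\<in>borel_measurable M. \<forall>g\<in>borel_measurable M. (\<integral>\<^sup>+x. k x * g x \<partial>M) = (\<integral>\<^sup>+x. u x * g (T x) \<partial>M)"
proof -
  let ?N = "distr (density M u) M T"
  have int: "integral\<^sup>N ?N g = (\<integral>\<^sup>+x. u x * g (T x) \<partial>M)" if [measurable]: "g \<in> borel_measurable M" for g
    by (subst nn_integral_distr) (auto simp: nn_integral_density)
  have "absolutely_continuous M ?N"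
    unfolding absolutely_continuous_def
  proof
    fix A assume A: "A \<in> null_sets M"
    then have [measurable]: "A \<in> sets M"
      by auto
    have "T -` A \<inter> space M \<in> null_sets M"
      using A endo by (auto simp: null_sets_def endomorphism_def)
    then have "AE x in M. x \<notin> T -` A \<inter> space M"
      by (rule AE_not_in)
    then have "(\<integral>\<^sup>+x. u x * indicator A (T x) \<partial>M) = (\<integral>\<^sup>+x. 0 \<partial>M)"
      using AE_space by (intro nn_integral_cong_AE, eventually_elim) (auto simp: indicator_def)
    then have "emeasure ?N A = 0"
      using int[of "indicator A"] by simp
    then show "A \<in> null_sets ?N"
      by (simp add: null_sets_def)
  qed
  from Radon_Nikodym[OF this] obtain k where k[measurable]: "k \<in> borel_measurable M" and eq: "density M k = ?N"
    by auto
  have "(\<integral>\<^sup>+x. k x * g x \<partial>M) = (\<integral>\<^sup>+x. u x * g (T x) \<partial>M)" if [measurable]: "g \<in> borel_measurable M" for g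
    using int[OF that] by (simp add: eq[symmetric] nn_integral_density)
  then show ?thesis
    using k by blast
qed

text \<open>The duality is required for nonnegative test functions with extended integrals, so that
  it can be applied before any integrability is known.\<close>

definition transfers :: "('a \<Rightarrow> real) \<Rightarrow> ('a \<Rightarrow> real) \<Rightarrow> bool" where
  "transfers u k \<longleftrightarrow> u \<in> borel_measurable M \<and> k \<in> borel_measurable M \<and> (\<forall>x. 0 \<le> u x) \<and> (\<forall>x. 0 \<le> k x) \<and>
     (\<forall>g\<in>borel_measurable M. (\<integral>\<^sup>+x. ennreal (k x) * g x \<partial>M) = (\<integral>\<^sup>+x. ennreal (u x) * g (T x) \<partial>M))"

text \<open>The density is finite almost everywhere: by duality its integral over \<open>S i\<close>
  is at most the measure of \<open>S i\<close> plus the integral of \<open>Phi\<close> of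
  \<open>u\<close>, because \<open>u x\<close> is at most \<open>1 + Phi (u x)\<close>.\<close>

lemma ex_transfers:
  assumes u: "u \<in> LPhi M" and u0: "\<And>x. 0 \<le> u x"
  shows "\<exists>k. transfers u k"
proof -
  note [measurable] = LPhi_measurable[OF u]
  obtain k where k[measurable]: "k \<in> borel_measurable M"
    and dual: "\<And>g. g \<in> borel_measurable M \<Longrightarrow> (\<integral>\<^sup>+x. k x * g x \<partial>M) = (\<integral>\<^sup>+x. ennreal (u x) * g (T x) \<partial>M)"
    using ex_nn_transfer[of "\<lambda>x. ennreal (u x)"] by auto
  obtain S where S: "range S \<subseteq> sets M" "(\<Union>i. S i) = space M" "\<And>i :: nat. emeasure M (S i) \<noteq> \<infinity>"
    using sigma_finite by metis
  have [measurable]: "S i \<in> sets M" for i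
    using S(1) by auto
  have "AE x in M. k x * indicator (S i) x \<noteq> \<infinity>" for i
  proof (rule nn_integral_PInf_AE)
    have "(\<integral>\<^sup>+x. k x * indicator (S i) x \<partial>M) \<le> (\<integral>\<^sup>+x. indicator (S i) (T x) + ennreal (Phi \<bar>u x\<bar>) \<partial>M)"
    proof (subst dual, simp, rule nn_integral_mono)
      fix x
      have "ennreal (u x) \<le> ennreal 1 + ennreal (Phi (u x))"
        using le_one_plus_Phi[of "u x"] by (subst ennreal_plus[symmetric]) (auto simp: Phi_nonneg u0 simp del: ennreal_plus intro: ennreal_leI)
      then show "ennreal (u x) * indicator (S i) (T x) \<le> indicator (S i) (T x) + ennreal (Phi \<bar>u x\<bar>)"
        by (auto simp: indicator_def u0)
    qed
    also have "\<dots> = emeasure M (S i) + (\<integral>\<^sup>+x. ennreal (Phi \<bar>u x\<bar>) \<partial>M)"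
      by (subst nn_integral_add) (auto simp: nn_integral_T[of "indicator (S i)"])
    finally show "(\<integral>\<^sup>+x. k x * indicator (S i) x \<partial>M) \<noteq> \<infinity>"
      using S(3)[of i] u by (auto simp: LPhi_def top_unique)
  qed simp
  then have "AE x in M. \<forall>i. k x * indicator (S i) x \<noteq> \<infinity>"
    by (simp add: AE_all_countable)
  then have fin: "AE x in M. ennreal (enn2real (k x)) = k x"
    using AE_space
  proof eventually_elim
    case (elim x)
    then obtain i where "x \<in> S i"
      using S(2) by blast
    then show ?case
      using elim(1)[rule_format, of i] by (simp add: less_top)
  qed
  have "transfers u (\<lambda>x. enn2real (k x))"
    unfolding transfers_def
  proof (intro conjI ballI allI u0)
    fix g :: "'a \<Rightarrow> ennreal" assume g: "g \<in> borel_measurable M"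
    have "(\<integral>\<^sup>+x. ennreal (enn2real (k x)) * g x \<partial>M) = (\<integral>\<^sup>+x. k x * g x \<partial>M)"
      using fin by (intro nn_integral_cong_AE) auto
    then show "(\<integral>\<^sup>+x. ennreal (enn2real (k x)) * g x \<partial>M) = (\<integral>\<^sup>+x. ennreal (u x) * g (T x) \<partial>M)"
      using dual[OF g] by simp
  qed auto
  then show ?thesis
    by blast
qed

text \<open>Jensen's inequality: integrate the tangent-line bound of the convex function \<open>\<Phi>\<close> at
  \<open>k (T x)\<close>; the linear terms cancel by duality.\<close>

lemma transfers_LPhi:
  assumes uk: "transfers u k" and u: "u \<in> LPhi M"
  shows "k \<in> LPhi M"
proof -
  have [measurable]: "u \<in> borel_measurable M" and [measurable]: "k \<in> borel_measurable M"
    and u0: "\<And>x. 0 \<le> u x" and k0: "\<And>x. 0 \<le> k x"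
    and dual: "\<And>g. g \<in> borel_measurable M \<Longrightarrow> (\<integral>\<^sup>+x. ennreal (k x) * g x \<partial>M) = (\<integral>\<^sup>+x. ennreal (u x) * g (T x) \<partial>M)"
    using uk by (auto simp: transfers_def)
  obtain S where S: "range S \<subseteq> sets M" "(\<Union>i. S i) = space M" "\<And>i :: nat. emeasure M (S i) \<noteq> \<infinity>" "incseq S"
    using sigma_finite_incseq by blast
  have [measurable]: "S i \<in> sets M" for i
    using S(1) by auto
  have "(\<integral>\<^sup>+x. ennreal (Phi (k x)) \<partial>M) \<le> (\<integral>\<^sup>+x. ennreal (Phi (u x)) \<partial>M)"
  proof (rule nn_integral_le_exhaustion[OF _ _ S(4,2)])
    fix i
    \<comment> \<open>The slope of the tangent at \<open>k\<close>, cut off to a set of finite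
      measure. The slope is at most 2, so \<open>?c\<close> is finite and can be cancelled from both
      sides in \<open>ennreal\<close>.\<close>
    let ?s = "\<lambda>x. ennreal (2 * min (k x) 1) * indicator (S i) x"
    let ?c = "\<integral>\<^sup>+x. ennreal (u x) * ?s (T x) \<partial>M"
    have pt: "ennreal (u x) * ?s (T x) + ennreal (Phi (k (T x))) * indicator (S i) (T x)
        \<le> ennreal (k (T x)) * ?s (T x) + ennreal (Phi (u x))" for x
    proof -
      have "ennreal (u x) * ennreal (2 * min (k (T x)) 1) + ennreal (Phi (k (T x)))
          = ennreal (Phi (k (T x)) + 2 * min (k (T x)) 1 * u x)"
        using k0[of "T x"] u0[of x] by (simp add: ennreal_mult[symmetric] ennreal_plus[symmetric] Phi_nonneg add.commute mult.commute del: ennreal_plus)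
      also have "\<dots> \<le> ennreal (Phi (u x) + 2 * min (k (T x)) 1 * k (T x))"
        by (intro ennreal_leI Phi_tangent u0 k0)
      also have "\<dots> = ennreal (k (T x)) * ennreal (2 * min (k (T x)) 1) + ennreal (Phi (u x))"
        using k0[of "T x"] u0[of x] by (simp add: ennreal_mult[symmetric] ennreal_plus[symmetric] Phi_nonneg add.commute mult.commute del: ennreal_plus)
      finally show ?thesis
        by (auto simp: indicator_def)
    qed
    have "?c + (\<integral>\<^sup>+x. ennreal (Phi (k x)) * indicator (S i) x \<partial>M)
        = (\<integral>\<^sup>+x. ennreal (u x) * ?s (T x) + ennreal (Phi (k (T x))) * indicator (S i) (T x) \<partial>M)"
      using nn_integral_T[of "\<lambda>x. ennreal (Phi (k x)) * indicator (S i) x"] by (subst nn_integral_add) auto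
    also have "\<dots> \<le> (\<integral>\<^sup>+x. ennreal (k (T x)) * ?s (T x) + ennreal (Phi (u x)) \<partial>M)"
      by (intro nn_integral_mono pt)
    also have "\<dots> = ?c + (\<integral>\<^sup>+x. ennreal (Phi (u x)) \<partial>M)"
      using nn_integral_T[of "\<lambda>x. ennreal (k x) * ?s x"] dual[of ?s] by (subst nn_integral_add) auto
    finally have "?c + (\<integral>\<^sup>+x. ennreal (Phi (k x)) * indicator (S i) x \<partial>M) \<le> ?c + (\<integral>\<^sup>+x. ennreal (Phi (u x)) \<partial>M)" .
    moreover have "?c \<noteq> \<infinity>"
    proof -
      have "?c \<le> (\<integral>\<^sup>+x. 2 * indicator (S i) (T x) + 2 * ennreal (Phi (u x)) \<partial>M)"
      proof (rule nn_integral_mono)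
        fix x
        have "u x * (2 * min (k (T x)) 1) \<le> (1 + Phi (u x)) * 2"
          using k0[of "T x"] u0[of x] le_one_plus_Phi[of "u x"] Phi_nonneg[of "u x"] by (intro mult_mono) auto
        then have "ennreal (u x) * ennreal (2 * min (k (T x)) 1) \<le> ennreal (2 + 2 * Phi (u x))"
          using k0[of "T x"] u0[of x] by (subst ennreal_mult[symmetric]) (auto intro!: ennreal_leI)
        also have "\<dots> = 2 + 2 * ennreal (Phi (u x))"
          using u0[of x] by (simp add: ennreal_mult' Phi_nonneg)
        finally show "ennreal (u x) * ?s (T x) \<le> 2 * indicator (S i) (T x) + 2 * ennreal (Phi (u x))"
          by (auto simp: indicator_def)
      qed
      also have "\<dots> = 2 * emeasure M (S i) + 2 * (\<integral>\<^sup>+x. ennreal (Phi (u x)) \<partial>M)"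
        by (subst nn_integral_add) (auto simp: nn_integral_cmult nn_integral_T[of "indicator (S i)"])
      finally show ?thesis
        using S(3)[of i] u u0 by (auto simp: LPhi_def top_unique ennreal_mult_eq_top_iff)
    qed
    ultimately show "(\<integral>\<^sup>+x. ennreal (Phi (k x)) * indicator (S i) x \<partial>M) \<le> (\<integral>\<^sup>+x. ennreal (Phi (u x)) \<partial>M)"
      by (simp add: ennreal_add_left_cancel_le)
  qed simp_all
  also have "\<dots> < \<infinity>"
    using u u0 by (simp add: LPhi_def)
  finally show ?thesis
    using k0 by (simp add: LPhi_def)
qed

lemma transfers_integral:
  assumes uk: "transfers u k" and [measurable]: "g \<in> borel_measurable M"
    and fin: "integrable M (\<lambda>x. u x * g (T x))"
  shows "integrable M (\<lambda>x. k x * g x)" "(\<integral>x. k x * g x \<partial>M) = (\<integral>x. u x * g (T x) \<partial>M)"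
proof -
  have [measurable]: "u \<in> borel_measurable M" and [measurable]: "k \<in> borel_measurable M"
    and u0: "\<And>x. 0 \<le> u x" and k0: "\<And>x. 0 \<le> k x"
    and dual: "\<And>g. g \<in> borel_measurable M \<Longrightarrow> (\<integral>\<^sup>+x. ennreal (k x) * g x \<partial>M) = (\<integral>\<^sup>+x. ennreal (u x) * g (T x) \<partial>M)"
    using uk by (auto simp: transfers_def)
  have eq: "(\<integral>\<^sup>+x. ennreal (k x * g' x) \<partial>M) = (\<integral>\<^sup>+x. ennreal (u x * g' (T x)) \<partial>M)"
    if [measurable]: "g' \<in> borel_measurable M" for g'
    using dual[of "\<lambda>x. ennreal (g' x)"] by (simp add: ennreal_mult' u0 k0)
  show i: "integrable M (\<lambda>x. k x * g x)"
    using fin eq[of "\<lambda>x. \<bar>g x\<bar>"] by (simp add: integrable_iff_bounded abs_mult u0 k0)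
  show "(\<integral>x. k x * g x \<partial>M) = (\<integral>x. u x * g (T x) \<partial>M)"
    using eq[of g] eq[of "\<lambda>x. - g x"] by (simp add: real_lebesgue_integral_def i fin)
qed

lemma L2_comp: "g \<in> L2 M \<Longrightarrow> (\<lambda>x. g (T x)) \<in> L2 M"
  using integrable_distr_eq[OF T_measurable, of "\<lambda>x. (g x)\<^sup>2"] by (auto simp: L2_def distr_T)

lemma integral_sq_comp:
  assumes "g \<in> L2 M"
  shows "(\<integral>x. (g (T x))\<^sup>2 \<partial>M) = (\<integral>x. (g x)\<^sup>2 \<partial>M)"
proof -
  have "(\<lambda>x. (g x)\<^sup>2) \<in> borel_measurable M"
    using assms by (auto simp: L2_def)
  from integral_distr[OF T_measurable this] show ?thesis
    by (simp add: distr_T)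
qed

lemma L2_Linfty_comp: "g \<in> L2 M \<inter> Linfty M \<Longrightarrow> (\<lambda>x. g (T x)) \<in> L2 M \<inter> Linfty M"
  using L2_comp Linfty_comp[OF T_measurable distr_T] by auto

end

text \<open>Where \<bar>f\<bar> is at most 1, the product is controlled by the sum of squares;
  elsewhere \<bar>f\<bar> is at most \<open>Phi \<bar>f x\<bar>\<close> and the bound
  \<open>C\<close> on \<open>g\<close> suffices.\<close>

lemma integrable_LPhi_mult:
  assumes f: "f \<in> LPhi M" and g: "g \<in> L2 M \<inter> Linfty M"
  shows "integrable M (\<lambda>x. f x * g x)"
proof -
  obtain C where C: "0 \<le> C" "AE x in M. \<bar>g x\<bar> \<le> C"
    using LinftyE[of g M] g by auto
  have g2: "integrable M (\<lambda>x. (g x)\<^sup>2)" and [measurable]: "g \<in> borel_measurable M"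
    using g by (auto simp: L2_def)
  show ?thesis
  proof (rule Bochner_Integration.integrable_bound)
    show "integrable M (\<lambda>x. (1 + C) * Phi \<bar>f x\<bar> + (g x)\<^sup>2)"
      using LPhi_integrable[OF f] g2 by simp
    show "AE x in M. norm (f x * g x) \<le> norm ((1 + C) * Phi \<bar>f x\<bar> + (g x)\<^sup>2)"
      using C(2)
    proof eventually_elim
      case (elim x)
      let ?a = "\<bar>f x\<bar>" and ?b = "\<bar>g x\<bar>"
      have "?a * ?b \<le> (1 + C) * Phi ?a + ?b\<^sup>2"
      proof (cases "?a \<le> 1")
        case True
        have "2 * ?a * ?b \<le> ?a\<^sup>2 + ?b\<^sup>2" "0 \<le> ?a * ?b" "0 \<le> C * ?a\<^sup>2"
          using C(1) sum_squares_bound[of ?a ?b] by auto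
        moreover have "(1 + C) * Phi ?a = ?a\<^sup>2 + C * ?a\<^sup>2"
          using True by (simp add: Phi_def distrib_right)
        ultimately show ?thesis
          by linarith
      next
        case False
        have "?a * ?b \<le> ?a * C"
          using elim by (intro mult_left_mono) auto
        also have "\<dots> \<le> Phi ?a * C"
          using False C(1) by (intro mult_right_mono) (auto simp: Phi_def)
        finally have "?a * ?b \<le> Phi ?a * C" .
        moreover have "(1 + C) * Phi ?a = Phi ?a + Phi ?a * C"
          by (simp add: algebra_simps)
        moreover have "0 \<le> Phi ?a" "0 \<le> ?b\<^sup>2"
          by (auto simp: Phi_nonneg)
        ultimately show ?thesis
          by linarith
      qed
      then show ?case
        by (simp add: abs_mult)
    qed
  qed (use LPhi_measurable[OF f] in measurable)
qed

section \<open>Signed functions, contraction in \<open>L^2\<close> and uniqueness\<close>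

context endomorphism_space begin

text \<open>Membership of \<open>a - b\<close> in \<open>LPhi M\<close> is read off from its bound
  \<open>a + b\<close>, which is a transfer of \<bar>f\<bar>. Jensen's inequality is thus applied
  once, to a nonnegative function, and no sum of two members of \<open>LPhi M\<close> has to be
  estimated.\<close>

lemma ex_signed_transfer:
  assumes f: "f \<in> LPhi M"
  obtains a b where "transfers (\<lambda>x. max 0 (f x)) a" "transfers (\<lambda>x. max 0 (- f x)) b"
    "(\<lambda>x. a x - b x) \<in> LPhi M"
    "\<And>g. g \<in> borel_measurable M \<Longrightarrow> integrable M (\<lambda>x. f x * g (T x)) \<Longrightarrow>
      integrable M (\<lambda>x. (a x - b x) * g x) \<and> (\<integral>x. (a x - b x) * g x \<partial>M) = (\<integral>x. f x * g (T x) \<partial>M)"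
proof -
  note fm[measurable] = LPhi_measurable[OF f]
  have LPhi_le: "h \<in> LPhi M" if "h' \<in> LPhi M" "h \<in> borel_measurable M" "\<And>x. \<bar>h x\<bar> \<le> \<bar>h' x\<bar>" for h h' :: "'a \<Rightarrow> real"
  proof -
    have "(\<integral>\<^sup>+x. ennreal (Phi \<bar>h x\<bar>) \<partial>M) \<le> (\<integral>\<^sup>+x. ennreal (Phi \<bar>h' x\<bar>) \<partial>M)"
      by (intro nn_integral_mono ennreal_leI Phi_mono that) auto
    also have "\<dots> < \<infinity>"
      using that by (simp add: LPhi_def)
    finally show ?thesis
      using that by (simp add: LPhi_def)
  qed
  have fp: "(\<lambda>x. max 0 (f x)) \<in> LPhi M" and fn: "(\<lambda>x. max 0 (- f x)) \<in> LPhi M"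
    by (rule LPhi_le[OF f]; auto simp: max_def)+
  obtain a where a: "transfers (\<lambda>x. max 0 (f x)) a"
    using ex_transfers[OF fp] by auto
  obtain b where b: "transfers (\<lambda>x. max 0 (- f x)) b"
    using ex_transfers[OF fn] by auto
  have am[measurable]: "a \<in> borel_measurable M" and bm[measurable]: "b \<in> borel_measurable M"
    and a0: "\<And>x. 0 \<le> a x" and b0: "\<And>x. 0 \<le> b x"
    using a b by (auto simp: transfers_def)
  have ab: "transfers (\<lambda>x. \<bar>f x\<bar>) (\<lambda>x. a x + b x)"
    unfolding transfers_def
  proof (intro conjI ballI)
    fix g :: "'a \<Rightarrow> ennreal" assume [measurable]: "g \<in> borel_measurable M"
    have "(\<integral>\<^sup>+x. ennreal (a x + b x) * g x \<partial>M)
        = (\<integral>\<^sup>+x. ennreal (max 0 (f x)) * g (T x) \<partial>M) + (\<integral>\<^sup>+x. ennreal (max 0 (- f x)) * g (T x) \<partial>M)"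
      using a b by (simp add: a0 b0 distrib_right nn_integral_add transfers_def)
    also have "\<dots> = (\<integral>\<^sup>+x. ennreal (max 0 (f x)) * g (T x) + ennreal (max 0 (- f x)) * g (T x) \<partial>M)"
      by (subst nn_integral_add) auto
    also have "\<dots> = (\<integral>\<^sup>+x. ennreal \<bar>f x\<bar> * g (T x) \<partial>M)"
      by (intro nn_integral_cong) (auto simp: max_def)
    finally show "(\<integral>\<^sup>+x. ennreal (a x + b x) * g x \<partial>M) = (\<integral>\<^sup>+x. ennreal \<bar>f x\<bar> * g (T x) \<partial>M)" .
  qed (auto simp: a0 b0)
  have "(\<lambda>x. \<bar>f x\<bar>) \<in> LPhi M"
    by (rule LPhi_le[OF f]) auto
  then have s: "(\<lambda>x. a x + b x) \<in> LPhi M"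
    by (rule transfers_LPhi[OF ab])
  show thesis
  proof (rule that[OF a b])
    show "(\<lambda>x. a x - b x) \<in> LPhi M"
    proof (rule LPhi_le[OF s])
      show "\<bar>a x - b x\<bar> \<le> \<bar>a x + b x\<bar>" for x
        using a0[of x] b0[of x] by linarith
    qed measurable
    fix g :: "'a \<Rightarrow> real" assume g[measurable]: "g \<in> borel_measurable M" and i: "integrable M (\<lambda>x. f x * g (T x))"
    have ip: "integrable M (\<lambda>x. max 0 (f x) * g (T x))"
      by (rule Bochner_Integration.integrable_bound[OF i]) (auto simp: max_def)
    have "integrable M (\<lambda>x. max 0 (- f x) * g (T x))"
      by (rule Bochner_Integration.integrable_bound[OF i]) (auto simp: max_def)
    note A = transfers_integral[OF a g ip] and B = transfers_integral[OF b g this]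
    have "(\<integral>x. (a x - b x) * g x \<partial>M) = (\<integral>x. max 0 (f x) * g (T x) \<partial>M) - (\<integral>x. max 0 (- f x) * g (T x) \<partial>M)"
      using A B by (simp add: left_diff_distrib)
    also have "\<dots> = (\<integral>x. max 0 (f x) * g (T x) - max 0 (- f x) * g (T x) \<partial>M)"
      by (rule Bochner_Integration.integral_diff[symmetric]) fact+
    also have "\<dots> = (\<integral>x. f x * g (T x) \<partial>M)"
      by (intro Bochner_Integration.integral_cong) (auto simp: max_def)
    finally show "integrable M (\<lambda>x. (a x - b x) * g x) \<and> (\<integral>x. (a x - b x) * g x \<partial>M) = (\<integral>x. f x * g (T x) \<partial>M)"
      using A B by (simp add: left_diff_distrib)
  qed
qed

text \<open>Test \<open>k\<close> against itself, cut off to a set of finite measure where it is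
  bounded. Composition with \<open>T\<close> preserves the norm of the test function, so after
  \<open>2 * a * b \<le> a^2 + b^2\<close> half of the finite left side is absorbed; the cut-offs
  then exhaust the space.\<close>

lemma L2_contraction:
  assumes [measurable]: "k \<in> borel_measurable M" and q: "q \<in> L2 M"
    and dual: "\<And>g. g \<in> L2 M \<inter> Linfty M \<Longrightarrow> (\<integral>x. k x * g x \<partial>M) = (\<integral>x. q x * g (T x) \<partial>M)"
  shows "(\<integral>\<^sup>+x. ennreal ((k x)\<^sup>2) \<partial>M) \<le> ennreal (\<integral>x. (q x)\<^sup>2 \<partial>M)"
proof -
  have [measurable]: "q \<in> borel_measurable M" and q2: "integrable M (\<lambda>x. (q x)\<^sup>2)"
    using q by (auto simp: L2_def)
  obtain S where S: "range S \<subseteq> sets M" "(\<Union>i. S i) = space M" "\<And>i :: nat. emeasure M (S i) \<noteq> \<infinity>" "incseq S"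
    using sigma_finite_incseq by blast
  have [measurable]: "S i \<in> sets M" for i
    using S(1) by auto
  have Ssp: "S i \<subseteq> space M" for i
    by (rule sets.sets_into_space) simp
  let ?A = "\<lambda>i. {x\<in>space M. x \<in> S i \<and> \<bar>k x\<bar> \<le> real i}"
  show ?thesis
  proof (rule nn_integral_le_exhaustion[where A="?A"])
    show "incseq ?A"
      using S(4) by (fastforce simp: incseq_def)
    show "(\<Union>i. ?A i) = space M"
    proof (intro equalityI subsetI)
      fix x assume x: "x \<in> space M"
      then obtain i where i: "x \<in> S i"
        using S(2) by auto
      obtain j where j: "\<bar>k x\<bar> \<le> real j"
        using real_arch_simple by blast
      have "x \<in> S (max i j)"
        using i S(4) by (meson incseqD max.cobounded1 subsetD)
      then show "x \<in> (\<Union>i. ?A i)"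
        using x j by (intro UN_I[of "max i j"]) auto
    qed auto
    fix i
    let ?g = "\<lambda>x. k x * indicator (?A i) x"
    have bdd: "\<bar>?g x\<bar> \<le> real i" for x
      by (auto simp: indicator_def)
    have iS: "integrable M (\<lambda>x. (real i)\<^sup>2 * indicator (S i) x)"
      using S(3)[of i] by (simp add: less_top)
    have g2: "integrable M (\<lambda>x. (?g x)\<^sup>2)"
    proof (rule Bochner_Integration.integrable_bound[OF iS])
      have "(?g x)\<^sup>2 \<le> (real i)\<^sup>2 * indicator (S i) x" for x
        using power_mono[of "\<bar>k x\<bar>" "real i" 2] by (auto simp: indicator_def)
      then show "AE x in M. norm ((?g x)\<^sup>2) \<le> norm ((real i)\<^sup>2 * indicator (S i) x)"
        by (auto simp: abs_mult)
    qed simp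
    have gL2: "?g \<in> L2 M"
      using g2 by (auto simp: L2_def)
    moreover have "?g \<in> Linfty M"
      using bdd by (intro LinftyI[of _ _ "real i"]) auto
    ultimately have g: "?g \<in> L2 M \<inter> Linfty M"
      by simp
    have gT2: "integrable M (\<lambda>x. (?g (T x))\<^sup>2)"
      using L2_comp[OF gL2] by (simp add: L2_def)
    have "(\<integral>x. (?g x)\<^sup>2 \<partial>M) = (\<integral>x. k x * ?g x \<partial>M)"
      by (intro Bochner_Integration.integral_cong) (auto simp: indicator_def power2_eq_square)
    also have "\<dots> = (\<integral>x. q x * ?g (T x) \<partial>M)"
      by (rule dual[OF g])
    also have "\<dots> \<le> (\<integral>x. ((q x)\<^sup>2 + (?g (T x))\<^sup>2) / 2 \<partial>M)"
    proof (rule integral_mono')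
      show "integrable M (\<lambda>x. ((q x)\<^sup>2 + (?g (T x))\<^sup>2) / 2)"
        using q2 gT2 by simp
      show "q x * ?g (T x) \<le> ((q x)\<^sup>2 + (?g (T x))\<^sup>2) / 2" for x
        using sum_squares_bound[of "q x" "?g (T x)"] by simp
    qed simp
    also have "\<dots> = ((\<integral>x. (q x)\<^sup>2 \<partial>M) + (\<integral>x. (?g x)\<^sup>2 \<partial>M)) / 2"
      using q2 gT2 integral_sq_comp[OF gL2] by simp
    finally have "(\<integral>x. (?g x)\<^sup>2 \<partial>M) \<le> (\<integral>x. (q x)\<^sup>2 \<partial>M)"
      by simp
    moreover have "(\<integral>\<^sup>+x. ennreal ((k x)\<^sup>2) * indicator (?A i) x \<partial>M) = ennreal (\<integral>x. (?g x)\<^sup>2 \<partial>M)"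
      using g2 by (subst nn_integral_eq_integral[symmetric]) (auto intro!: nn_integral_cong simp: indicator_def)
    ultimately show "(\<integral>\<^sup>+x. ennreal ((k x)\<^sup>2) * indicator (?A i) x \<partial>M) \<le> ennreal (\<integral>x. (q x)\<^sup>2 \<partial>M)"
      by (simp add: ennreal_leI)
  qed simp_all
qed

text \<open>The difference is dual to \<open>q = 0\<close>, so the contraction bound forces it to
  vanish. The sign of the difference would not do as a test function here, as it need not be square
  integrable.\<close>

lemma LPhi_eq_AE_if_dual_eq:
  assumes k: "k \<in> LPhi M" and k': "k' \<in> LPhi M"
    and eq: "\<And>g. g \<in> L2 M \<inter> Linfty M \<Longrightarrow> (\<integral>x. k x * g x \<partial>M) = (\<integral>x. k' x * g x \<partial>M)"
  shows "AE x in M. k x = k' x"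
proof -
  note [measurable] = LPhi_measurable[OF k] LPhi_measurable[OF k']
  note int = integrable_LPhi_mult
  have "(\<integral>\<^sup>+x. ennreal ((k x - k' x)\<^sup>2) \<partial>M) \<le> ennreal (\<integral>x. (0 :: real)\<^sup>2 \<partial>M)"
  proof (rule L2_contraction)
    show "(\<lambda>_. 0) \<in> L2 M"
      by (simp add: L2_def)
    fix g assume g: "g \<in> L2 M \<inter> Linfty M"
    show "(\<integral>x. (k x - k' x) * g x \<partial>M) = (\<integral>x. 0 * g (T x) \<partial>M)"
      using int[OF k g] int[OF k' g] eq[OF g] by (simp add: left_diff_distrib)
  qed simp
  then have "AE x in M. ennreal ((k x - k' x)\<^sup>2) = 0"
    by (subst nn_integral_0_iff_AE[symmetric]) auto
  then show ?thesis
    by eventually_elim simp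
qed

end

section \<open>The transfer operator of the Poisson suspension\<close>

lemma lebesgue_line_space_sigma_finite:
  assumes "lebesgue_line_space M"
  shows "sigma_finite_measure M"
proof
  obtain \<phi> where \<phi>: "\<phi> \<in> M \<rightarrow>\<^sub>M (lborel :: real measure)" "distr M lborel \<phi> = lborel"
    using assms by (auto simp: lebesgue_line_space_def)
  let ?A = "\<lambda>n :: nat. \<phi> -` {- real n..real n} \<inter> space M"
  have fin: "emeasure M (?A n) \<noteq> \<infinity>" for n
    using emeasure_distr[OF \<phi>(1), of "{- real n..real n}"] unfolding \<phi>(2) by auto
  have "\<exists>n. x \<in> ?A n" if "x \<in> space M" for x
  proof -
    obtain n where "\<bar>\<phi> x\<bar> \<le> real n"
      using real_arch_simple by blast
    then show ?thesis
      using that by (intro exI[of _ n]) auto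
  qed
  then have "(\<Union>n. ?A n) = space M"
    by blast
  then show "\<exists>A. countable A \<and> A \<subseteq> sets M \<and> \<Union>A = space M \<and> (\<forall>a\<in>A. emeasure M a \<noteq> \<infinity>)"
    using fin \<phi>(1) by (intro exI[of _ "range ?A"]) auto
qed

section \<open>Duality on Poisson space\<close>

locale poisson_suspension_space = poisson_space M P + endomorphism_space M T
  for M :: "'a measure" and P :: "'a measure measure" and T :: "'a \<Rightarrow> 'a"
begin

abbreviation S :: "'a measure \<Rightarrow> 'a measure" where
  "S \<equiv> poisson_suspension M T"

lemma S_measurable [measurable]: "S \<in> P \<rightarrow>\<^sub>M P"
  by (rule suspension_measurable) simp

lemma distr_S: "distr P P S = P"
  by (rule distr_suspension[OF endo])

text \<open>\<open>distr_density_suspension\<close> is an equality of measures on Poisson space;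
  integrating \<open>G\<close> against both sides gives the claim for every measurable
  \<open>G\<close>, with no appeal to approximation.\<close>

lemma transfers_suspension:
  assumes uk: "transfers u k" and u: "integrable M u" and k: "integrable M k"
    and [measurable]: "G \<in> borel_measurable P"
  shows "(\<integral>\<omega>. (\<integral>x. k x \<partial>\<omega>) * G \<omega> \<partial>P) = (\<integral>\<omega>. (\<integral>x. u x \<partial>\<omega>) * G (S \<omega>) \<partial>P)"
proof -
  have um[measurable]: "u \<in> borel_measurable M" and km[measurable]: "k \<in> borel_measurable M"
    and u0: "\<And>x. 0 \<le> u x" and k0: "\<And>x. 0 \<le> k x"
    and dual: "\<And>g. g \<in> borel_measurable M \<Longrightarrow> (\<integral>\<^sup>+x. ennreal (k x) * g x \<partial>M) = (\<integral>\<^sup>+x. ennreal (u x) * g (T x) \<partial>M)"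
    using uk by (auto simp: transfers_def)
  have dens: "density P (\<lambda>\<omega>. \<integral>\<^sup>+x. ennreal (p x) \<partial>\<omega>) = density P (\<lambda>\<omega>. ennreal (\<integral>x. p x \<partial>\<omega>))"
    if p: "integrable M p" "\<And>x. 0 \<le> (p x :: real)" for p
    using integral_config_nonneg[OF p] p(1) by (intro density_cong) auto
  have "distr (density P (\<lambda>\<omega>. \<integral>\<^sup>+x. ennreal (u x) \<partial>\<omega>)) P S = density P (\<lambda>\<omega>. \<integral>\<^sup>+x. ennreal (k x) \<partial>\<omega>)"
  proof (rule distr_density_suspension[OF endo])
    show "(\<integral>\<^sup>+x. ennreal (u x) \<partial>M) < \<infinity>"
      using u by (simp add: nn_integral_eq_integral u0)
  qed (auto simp: dual)
  then have eq: "distr (density P (\<lambda>\<omega>. ennreal (\<integral>x. u x \<partial>\<omega>))) P S = density P (\<lambda>\<omega>. ennreal (\<integral>x. k x \<partial>\<omega>))"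
    by (simp add: dens u k u0 k0)
  have "(\<integral>\<omega>. (\<integral>x. k x \<partial>\<omega>) * G \<omega> \<partial>P) = (\<integral>\<omega>. G \<omega> \<partial>density P (\<lambda>\<omega>. ennreal (\<integral>x. k x \<partial>\<omega>)))"
    by (subst integral_density) (auto simp: k0 integral_nonneg_AE)
  also have "\<dots> = (\<integral>\<omega>. G (S \<omega>) \<partial>density P (\<lambda>\<omega>. ennreal (\<integral>x. u x \<partial>\<omega>)))"
    unfolding eq[symmetric] by (rule integral_distr) auto
  also have "\<dots> = (\<integral>\<omega>. (\<integral>x. u x \<partial>\<omega>) * G (S \<omega>) \<partial>P)"
    by (subst integral_density) (auto simp: u0 integral_nonneg_AE)
  finally show ?thesis .
qed

text \<open>The compensators match as well: testing with the constant 1 gives equal means of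
  \<open>k\<close> and \<open>u\<close>, and the suspension preserves the expectation of
  \<open>G\<close>.\<close>

lemma transfers_cint:
  assumes uk: "transfers u k" and u: "integrable M u"
    and G: "G \<in> Linfty P"
  shows "integrable M k" "(\<integral>\<omega>. cint k \<omega> * G \<omega> \<partial>P) = (\<integral>\<omega>. cint u \<omega> * G (S \<omega>) \<partial>P)"
proof -
  have Gm[measurable]: "G \<in> borel_measurable P"
    by (rule Linfty_measurable[OF G])
  have GS: "(\<lambda>\<omega>. G (S \<omega>)) \<in> Linfty P"
    by (rule Linfty_comp[OF S_measurable distr_S G])
  have "integrable M (\<lambda>x. u x * 1)"
    using u by simp
  from transfers_integral[OF uk _ this]
  have k: "integrable M k" and ku: "(\<integral>x. k x \<partial>M) = (\<integral>x. u x \<partial>M)"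
    by auto
  show "integrable M k"
    by (rule k)
  have GG: "integrable P G" "integrable P (\<lambda>\<omega>. G (S \<omega>))"
    using integrable_mult_Linfty[of P "\<lambda>_. 1", OF _ G] integrable_mult_Linfty[of P "\<lambda>_. 1", OF _ GS] by auto
  have "(\<integral>\<omega>. cint k \<omega> * G \<omega> \<partial>P) = (\<integral>\<omega>. (\<integral>x. k x \<partial>\<omega>) * G \<omega> \<partial>P) - (\<integral>x. k x \<partial>M) * (\<integral>\<omega>. G \<omega> \<partial>P)"
    unfolding cint_def left_diff_distrib
    using integrable_mult_Linfty[OF integral_config_integrable[OF k] G] GG by simp
  also have "(\<integral>\<omega>. G \<omega> \<partial>P) = (\<integral>\<omega>. G (S \<omega>) \<partial>P)"
    using integral_distr[OF S_measurable Gm] by (simp add: distr_S)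
  also have "(\<integral>\<omega>. (\<integral>x. k x \<partial>\<omega>) * G \<omega> \<partial>P) - (\<integral>x. k x \<partial>M) * (\<integral>\<omega>. G (S \<omega>) \<partial>P)
      = (\<integral>\<omega>. cint u \<omega> * G (S \<omega>) \<partial>P)"
    unfolding cint_def left_diff_distrib
    using integrable_mult_Linfty[OF integral_config_integrable[OF u] GS] GG
    by (simp add: transfers_suspension[OF uk u k Gm] ku)
  finally show "(\<integral>\<omega>. cint k \<omega> * G \<omega> \<partial>P) = (\<integral>\<omega>. cint u \<omega> * G (S \<omega>) \<partial>P)" .
qed

text \<open>One function \<open>v\<close> satisfies the duality on both levels. The base identity
  feeds the contraction estimate, the Poisson identity moves the truncated integral across the
  suspension.\<close>

lemma ex_L1_transfer:
  assumes u: "u \<in> L1 M"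
  obtains v where "v \<in> L1 M" "\<And>g. g \<in> Linfty M \<Longrightarrow> (\<integral>x. v x * g x \<partial>M) = (\<integral>x. u x * g (T x) \<partial>M)"
    "\<And>G. G \<in> Linfty P \<Longrightarrow> (\<integral>\<omega>. cint v \<omega> * G \<omega> \<partial>P) = (\<integral>\<omega>. cint u \<omega> * G (S \<omega>) \<partial>P)"
proof -
  have ui: "integrable M u"
    using u by (simp add: L1_def)
  have "u \<in> LPhi M"
    using u L1_subset_LPhi by blast
  then obtain a b where a: "transfers (\<lambda>x. max 0 (u x)) a" and b: "transfers (\<lambda>x. max 0 (- u x)) b"
    and dual: "\<And>g. g \<in> borel_measurable M \<Longrightarrow> integrable M (\<lambda>x. u x * g (T x)) \<Longrightarrow>
      (\<integral>x. (a x - b x) * g x \<partial>M) = (\<integral>x. u x * g (T x) \<partial>M)"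
    by (rule ex_signed_transfer) auto
  have p: "integrable M (\<lambda>x. max 0 (u x))" and n: "integrable M (\<lambda>x. max 0 (- u x))"
    using ui by auto
  \<comment> \<open>The zero function serves as the bounded variable in
    \<open>transfers_cint\<close>, from which only the integrability of \<open>a\<close> and
    \<open>b\<close> is taken at this point.\<close>
  have "(\<lambda>_. 0) \<in> Linfty P"
    by (rule LinftyI[of _ _ 0]) auto
  then have ai: "integrable M a" and bi: "integrable M b"
    using transfers_cint(1)[OF a p] transfers_cint(1)[OF b n] by auto
  have diff: "(\<lambda>x. max 0 (u x) - max 0 (- u x)) = u"
    by (auto simp: max_def)
  show thesis
  proof
    show "(\<lambda>x. a x - b x) \<in> L1 M"
      using ai bi by (simp add: L1_def)
    show "(\<integral>x. (a x - b x) * g x \<partial>M) = (\<integral>x. u x * g (T x) \<partial>M)" if g: "g \<in> Linfty M" for g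
      by (rule dual[OF Linfty_measurable[OF g]
            integrable_mult_Linfty[OF ui Linfty_comp[OF T_measurable distr_T g]]])
    fix G assume G: "G \<in> Linfty P"
    have GS: "(\<lambda>\<omega>. G (S \<omega>)) \<in> Linfty P"
      by (rule Linfty_comp[OF S_measurable distr_S G])
    note [measurable] = Linfty_measurable[OF G]
    have "(\<integral>\<omega>. cint (\<lambda>x. a x - b x) \<omega> * G \<omega> \<partial>P) = (\<integral>\<omega>. cint a \<omega> * G \<omega> - cint b \<omega> * G \<omega> \<partial>P)"
      using cint_diff[OF ai bi] ai bi by (intro integral_cong_AE) (auto simp: left_diff_distrib)
    also have "\<dots> = (\<integral>\<omega>. cint a \<omega> * G \<omega> \<partial>P) - (\<integral>\<omega>. cint b \<omega> * G \<omega> \<partial>P)"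
      by (intro Bochner_Integration.integral_diff integrable_mult_Linfty cint_integrable ai bi G)
    also have "\<dots> = (\<integral>\<omega>. cint (\<lambda>x. max 0 (u x)) \<omega> * G (S \<omega>) \<partial>P) - (\<integral>\<omega>. cint (\<lambda>x. max 0 (- u x)) \<omega> * G (S \<omega>) \<partial>P)"
      by (simp only: transfers_cint(2)[OF a p G] transfers_cint(2)[OF b n G])
    also have "\<dots> = (\<integral>\<omega>. cint (\<lambda>x. max 0 (u x)) \<omega> * G (S \<omega>) - cint (\<lambda>x. max 0 (- u x)) \<omega> * G (S \<omega>) \<partial>P)"
      by (intro Bochner_Integration.integral_diff[symmetric] integrable_mult_Linfty cint_integrable p n GS)
    also have "\<dots> = (\<integral>\<omega>. cint u \<omega> * G (S \<omega>) \<partial>P)"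
      using cint_diff[OF p n] ui unfolding diff by (intro integral_cong_AE) (auto simp: left_diff_distrib)
    finally show "(\<integral>\<omega>. cint (\<lambda>x. a x - b x) \<omega> * G \<omega> \<partial>P) = (\<integral>\<omega>. cint u \<omega> * G (S \<omega>) \<partial>P)" .
  qed
qed

text \<open>Both sides are approximated by truncation. The truncation \<open>h\<^sub>\<epsilon>\<close> of \<open>h\<close> differs from the
  transfer \<open>v\<close> of the truncation of \<open>f\<close>, but both are close to \<open>h\<close> modulo \<open>L\<^sup>2\<close>: the first by
  definition, the second because the transfer operator contracts \<open>L\<^sup>2\<close>.\<close>

lemma I1_dual:
  assumes f: "f \<in> LPhi M" and h: "h \<in> LPhi M"
    and dual: "\<And>g. g \<in> L2 M \<inter> Linfty M \<Longrightarrow> (\<integral>x. h x * g x \<partial>M) = (\<integral>x. f x * g (T x) \<partial>M)"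
    and G: "G \<in> Linfty P"
  shows "(\<integral>\<omega>. I1 M P h \<omega> * G \<omega> \<partial>P) = (\<integral>\<omega>. I1 M P f \<omega> * G (S \<omega>) \<partial>P)"
proof -
  note [measurable] = LPhi_measurable[OF f] LPhi_measurable[OF h] Linfty_measurable[OF G] I1_approx(1)[OF f] I1_approx(1)[OF h]
  obtain C where C: "0 \<le> C" "AE \<omega> in P. \<bar>G \<omega>\<bar> \<le> C"
    using LinftyE[OF G] .
  have CS: "AE \<omega> in P. \<bar>G (S \<omega>)\<bar> \<le> C"
    by (rule AE_measure_preserving[OF S_measurable distr_S C(2)])
  have GS: "(\<lambda>\<omega>. G (S \<omega>)) \<in> Linfty P"
    by (rule Linfty_comp[OF S_measurable distr_S G])
  note GSm[measurable] = Linfty_measurable[OF GS]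
  let ?r = "\<lambda>f \<epsilon>. \<integral>x. small_part_sq \<epsilon> f x \<partial>M"
  let ?d = "\<bar>(\<integral>\<omega>. I1 M P f \<omega> * G (S \<omega>) \<partial>P) - (\<integral>\<omega>. I1 M P h \<omega> * G \<omega> \<partial>P)\<bar>"
  \<comment> \<open>The three terms bound, in order, the error of truncating \<open>f\<close>, the
    gap between the transferred truncation of \<open>f\<close> and the truncation of
    \<open>h\<close>, and the error of truncating \<open>h\<close>.\<close>
  let ?b = "\<lambda>\<epsilon>. C * sqrt (?r f \<epsilon>) + C * sqrt (2 * ?r f \<epsilon> + 2 * ?r h \<epsilon>) + C * sqrt (?r h \<epsilon>)"
  have r0: "0 \<le> ?r f \<epsilon>" for f and \<epsilon>
    by (intro integral_nonneg_AE) simp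
  have bound: "?d \<le> ?b \<epsilon>" if \<epsilon>: "0 < \<epsilon>" "\<epsilon> \<le> 1" for \<epsilon>
  proof -
    let ?u = "truncate_small \<epsilon> f" and ?w = "truncate_small \<epsilon> h"
    have u: "integrable M ?u" and w: "integrable M ?w"
      using truncate_small_integrable[OF f \<epsilon>] truncate_small_integrable[OF h \<epsilon>] .
    have "?u \<in> L1 M"
      using u by (simp add: L1_def)
    then obtain v where v: "v \<in> L1 M" "\<And>g. g \<in> Linfty M \<Longrightarrow> (\<integral>x. v x * g x \<partial>M) = (\<integral>x. ?u x * g (T x) \<partial>M)"
      "(\<integral>\<omega>. cint v \<omega> * G \<omega> \<partial>P) = (\<integral>\<omega>. cint ?u \<omega> * G (S \<omega>) \<partial>P)"
      by (rule ex_L1_transfer) (use G in auto)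
    have vi: "integrable M v" and [measurable]: "v \<in> borel_measurable M"
      using v(1) by (auto simp: L1_def)
    note sf = small_part_sq_integrable[OF f \<epsilon>(2)] and sh = small_part_sq_integrable[OF h \<epsilon>(2)]
    \<comment> \<open>Neither \<open>h\<close> nor \<open>v\<close> need be square integrable, but
      \<open>h - v\<close> is dual to the discarded part of \<open>f\<close>, which is; the
      contraction therefore applies to the difference.\<close>
    have "(\<integral>\<^sup>+x. ennreal ((h x - v x)\<^sup>2) \<partial>M) \<le> ennreal (\<integral>x. (f x - ?u x)\<^sup>2 \<partial>M)"
    proof (rule L2_contraction)
      show "(\<lambda>x. f x - ?u x) \<in> L2 M"
        using sf unfolding small_part_sq_def[abs_def] by (auto simp: L2_def)
      fix g assume g: "g \<in> L2 M \<inter> Linfty M"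
      then have gI: "g \<in> Linfty M" by simp
      have gT: "(\<lambda>x. g (T x)) \<in> L2 M \<inter> Linfty M"
        by (rule L2_Linfty_comp[OF g])
      then have gTI: "(\<lambda>x. g (T x)) \<in> Linfty M" by simp
      have "(\<integral>x. (h x - v x) * g x \<partial>M) = (\<integral>x. h x * g x \<partial>M) - (\<integral>x. v x * g x \<partial>M)"
        unfolding left_diff_distrib
        by (intro Bochner_Integration.integral_diff integrable_LPhi_mult[OF h g] integrable_mult_Linfty[OF vi gI])
      also have "\<dots> = (\<integral>x. f x * g (T x) \<partial>M) - (\<integral>x. ?u x * g (T x) \<partial>M)"
        by (simp only: dual[OF g] v(2)[OF gI])
      also have "\<dots> = (\<integral>x. (f x - ?u x) * g (T x) \<partial>M)"
        unfolding left_diff_distrib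
        by (intro Bochner_Integration.integral_diff[symmetric] integrable_LPhi_mult[OF f gT] integrable_mult_Linfty[OF u gTI])
      finally show "(\<integral>x. (h x - v x) * g x \<partial>M) = (\<integral>x. (f x - ?u x) * g (T x) \<partial>M)" .
    qed measurable
    then have hv: "(\<integral>\<^sup>+x. ennreal ((h x - v x)\<^sup>2) \<partial>M) \<le> ennreal (?r f \<epsilon>)"
      by (simp add: small_part_sq_def)
    have hvi: "integrable M (\<lambda>x. (h x - v x)\<^sup>2)"
      using order_le_less_trans[OF hv, of \<infinity>] by (intro integrableI_bounded) auto
    have hvr: "(\<integral>x. (h x - v x)\<^sup>2 \<partial>M) \<le> ?r f \<epsilon>"
      using hv hvi r0 by (subst (asm) nn_integral_eq_integral) auto
    let ?e = "\<lambda>x. v x - ?w x"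
    \<comment> \<open>Write \<open>v - ?w\<close> as \<open>(h - ?w) - (h - v)\<close>; the square
      of a difference is at most twice the sum of the squares. This is the origin of the factors 2
      in \<open>?b\<close>.\<close>
    have pt: "(?e x)\<^sup>2 \<le> 2 * (h x - v x)\<^sup>2 + 2 * small_part_sq \<epsilon> h x" for x
      using sum_squares_bound[of "h x - ?w x" "- (h x - v x)"]
      by (simp add: small_part_sq_def power2_eq_square algebra_simps)
    have ei: "integrable M ?e"
      using vi w by simp
    have e2: "integrable M (\<lambda>x. (?e x)\<^sup>2)"
      by (rule Bochner_Integration.integrable_bound[of _ "\<lambda>x. 2 * (h x - v x)\<^sup>2 + 2 * small_part_sq \<epsilon> h x"])
        (use hvi sh pt in auto)
    have e2r: "(\<integral>x. (?e x)\<^sup>2 \<partial>M) \<le> 2 * ?r f \<epsilon> + 2 * ?r h \<epsilon>"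
    proof -
      have "(\<integral>x. (?e x)\<^sup>2 \<partial>M) \<le> (\<integral>x. 2 * (h x - v x)\<^sup>2 + 2 * small_part_sq \<epsilon> h x \<partial>M)"
        using e2 hvi sh pt by (intro integral_mono) auto
      also have "\<dots> = 2 * (\<integral>x. (h x - v x)\<^sup>2 \<partial>M) + 2 * ?r h \<epsilon>"
        using hvi sh by simp
      finally show ?thesis
        using hvr by simp
    qed
    note iu = cint_integrable[OF u] and iw = cint_integrable[OF w] and iv = cint_integrable[OF vi]
      and If = I1_integrable[OF f] and Ih = I1_integrable[OF h]
    let ?D1 = "\<integral>\<omega>. (cint ?u \<omega> - I1 M P f \<omega>) * G (S \<omega>) \<partial>P"
    let ?D2 = "\<integral>\<omega>. (cint v \<omega> - cint ?w \<omega>) * G \<omega> \<partial>P"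
    let ?D3 = "\<integral>\<omega>. (cint ?w \<omega> - I1 M P h \<omega>) * G \<omega> \<partial>P"
    have D1: "\<bar>?D1\<bar> \<le> C * sqrt (?r f \<epsilon>)"
      by (rule abs_integral_mult_Linfty_le) (use iu If I1_approx(2)[OF f \<epsilon>] CS C r0 in auto)
    have D3: "\<bar>?D3\<bar> \<le> C * sqrt (?r h \<epsilon>)"
      by (rule abs_integral_mult_Linfty_le) (use iw Ih I1_approx(2)[OF h \<epsilon>] C r0 in auto)
    have D2: "\<bar>?D2\<bar> \<le> C * sqrt (2 * ?r f \<epsilon> + 2 * ?r h \<epsilon>)"
    proof (rule abs_integral_mult_Linfty_le)
      have "(\<integral>\<^sup>+\<omega>. ennreal \<bar>cint v \<omega> - cint ?w \<omega>\<bar> \<partial>P) = (\<integral>\<^sup>+\<omega>. ennreal \<bar>cint ?e \<omega>\<bar> \<partial>P)"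
        using cint_diff[OF vi w] by (intro nn_integral_cong_AE) auto
      also have "\<dots> \<le> ennreal (sqrt (\<integral>x. (?e x)\<^sup>2 \<partial>M))"
        by (rule nn_integral_cint_le[OF ei e2])
      also have "\<dots> \<le> ennreal (sqrt (2 * ?r f \<epsilon> + 2 * ?r h \<epsilon>))"
        by (intro ennreal_leI real_sqrt_le_mono e2r)
      finally show "(\<integral>\<^sup>+\<omega>. ennreal \<bar>cint v \<omega> - cint ?w \<omega>\<bar> \<partial>P) \<le> ennreal (sqrt (2 * ?r f \<epsilon> + 2 * ?r h \<epsilon>))" .
    qed (use iv iw C r0 in auto)
    have "?D1 = (\<integral>\<omega>. cint ?u \<omega> * G (S \<omega>) \<partial>P) - (\<integral>\<omega>. I1 M P f \<omega> * G (S \<omega>) \<partial>P)"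
      unfolding left_diff_distrib
      by (intro Bochner_Integration.integral_diff integrable_mult_Linfty iu If GS)
    moreover have "?D2 = (\<integral>\<omega>. cint v \<omega> * G \<omega> \<partial>P) - (\<integral>\<omega>. cint ?w \<omega> * G \<omega> \<partial>P)"
      unfolding left_diff_distrib
      by (intro Bochner_Integration.integral_diff integrable_mult_Linfty iv iw G)
    moreover have "?D3 = (\<integral>\<omega>. cint ?w \<omega> * G \<omega> \<partial>P) - (\<integral>\<omega>. I1 M P h \<omega> * G \<omega> \<partial>P)"
      unfolding left_diff_distrib
      by (intro Bochner_Integration.integral_diff integrable_mult_Linfty iw Ih G)
    ultimately show ?thesis
      using D1 D2 D3 v(3) by linarith
  qed
  have "\<forall>\<^sub>F \<epsilon> in at_right (0::real). 0 < \<epsilon> \<and> \<epsilon> < 1"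
    by (simp add: eventually_at_right_field) (rule exI[of _ 1], simp)
  then have "\<forall>\<^sub>F \<epsilon> in at_right 0. ?d \<le> ?b \<epsilon>"
    by eventually_elim (auto intro!: bound simp del: abs_le_iff)
  moreover have "(?b \<longlongrightarrow> C * sqrt 0 + C * sqrt (2 * 0 + 2 * 0) + C * sqrt 0) (at_right 0)"
    by (intro tendsto_intros small_part_sq_tendsto_0 f h)
  ultimately have "?d \<le> C * sqrt 0 + C * sqrt (2 * 0 + 2 * 0) + C * sqrt 0"
    by (intro tendsto_lowerbound[OF _ _ trivial_limit_at_right_real])
  then show ?thesis
    by simp
qed

lemma poisson_transfer_op:
  assumes f: "f \<in> LPhi M"
  shows "poisson_transfer_op M T f \<in> LPhi M"
    and "g \<in> L2 M \<inter> Linfty M \<Longrightarrow> (\<integral>x. poisson_transfer_op M T f x * g x \<partial>M) = (\<integral>x. f x * g (T x) \<partial>M)"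
proof -
  let ?Q = "\<lambda>h. h \<in> LPhi M \<and> (\<forall>g\<in>L2 M \<inter> Linfty M. (\<integral>x. h x * g x \<partial>M) = (\<integral>x. f x * g (T x) \<partial>M))"
  obtain a b where ab: "(\<lambda>x. a x - b x) \<in> LPhi M"
    "\<And>g. g \<in> borel_measurable M \<Longrightarrow> integrable M (\<lambda>x. f x * g (T x)) \<Longrightarrow>
      (\<integral>x. (a x - b x) * g x \<partial>M) = (\<integral>x. f x * g (T x) \<partial>M)"
    using f by (rule ex_signed_transfer) auto
  have "?Q (\<lambda>x. a x - b x)"
    using ab(1) ab(2) Linfty_measurable integrable_LPhi_mult[OF f L2_Linfty_comp] by blast
  then have "?Q (poisson_transfer_op M T f)"
    unfolding poisson_transfer_op_def by (rule someI[of ?Q])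
  then show "poisson_transfer_op M T f \<in> LPhi M"
    and "g \<in> L2 M \<inter> Linfty M \<Longrightarrow> (\<integral>x. poisson_transfer_op M T f x * g x \<partial>M) = (\<integral>x. f x * g (T x) \<partial>M)"
    by auto
qed

end

text \<open>A single candidate settles both questions about the choice: that it returns a function
  with the required property, and that this function agrees with the candidate almost
  everywhere.\<close>

lemma transfer_op_unique:
  assumes h: "h \<in> L1 M" and dual: "\<And>g. g \<in> Linfty M \<Longrightarrow> (\<integral>x. h x * g x \<partial>M) = (\<integral>x. f x * g (T x) \<partial>M)"
  shows "transfer_op M T f \<in> L1 M" "AE x in M. transfer_op M T f x = h x"
proof -
  let ?Q = "\<lambda>h. h \<in> L1 M \<and> (\<forall>g\<in>Linfty M. (\<integral>x. h x * g x \<partial>M) = (\<integral>x. f x * g (T x) \<partial>M))"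
  have "?Q (transfer_op M T f)"
    unfolding transfer_op_def by (rule someI[of ?Q h]) (use assms in auto)
  then show "transfer_op M T f \<in> L1 M" "AE x in M. transfer_op M T f x = h x"
    using L1_eq_AE_if_dual_eq[OF _ h, of "transfer_op M T f"] dual by auto
qed

section \<open>Identification of the operators\<close>

context poisson_suspension_space begin

text \<open>The candidate for the transfer on Poisson space is the compensated integral itself, with
  \<open>I1_dual\<close> as its duality. The variable \<open>F\<close> is allowed to differ from
  \<open>I1 M P f\<close> on a null set because \<open>I1_space\<close> contains all measurable
  versions.\<close>

lemma transfer_op_I1:
  assumes f: "f \<in> LPhi M" and [measurable]: "F \<in> borel_measurable P" and F: "AE \<omega> in P. F \<omega> = I1 M P f \<omega>"
  shows "transfer_op P S F \<in> borel_measurable P"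
    and "AE \<omega> in P. transfer_op P S F \<omega> = I1 M P (poisson_transfer_op M T f) \<omega>"
proof -
  note h = poisson_transfer_op[OF f]
  have [measurable]: "I1 M P f \<in> borel_measurable P"
    by (rule I1_approx(1)[OF f])
  have L1: "I1 M P (poisson_transfer_op M T f) \<in> L1 P"
    using I1_integrable[OF h(1)] by (simp add: L1_def)
  have dual: "(\<integral>\<omega>. I1 M P (poisson_transfer_op M T f) \<omega> * G \<omega> \<partial>P) = (\<integral>\<omega>. F \<omega> * G (S \<omega>) \<partial>P)"
    if G: "G \<in> Linfty P" for G
  proof -
    note [measurable] = Linfty_measurable[OF G]
    have "(\<integral>\<omega>. F \<omega> * G (S \<omega>) \<partial>P) = (\<integral>\<omega>. I1 M P f \<omega> * G (S \<omega>) \<partial>P)"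
      using F by (intro integral_cong_AE) auto
    then show ?thesis
      using I1_dual[OF f h G] by simp
  qed
  show "transfer_op P S F \<in> borel_measurable P"
    using transfer_op_unique(1)[OF L1 dual] by (auto simp: L1_def)
  show "AE \<omega> in P. transfer_op P S F \<omega> = I1 M P (poisson_transfer_op M T f) \<omega>"
    by (rule transfer_op_unique(2)[OF L1 dual])
qed

text \<open>The Poisson-transfer operator is tested only against
  \<open>L2 M \<inter> Linfty M\<close>, so its integrability is not immediate. The transfer
  \<open>v\<close> in \<open>L1 M\<close> also lies in \<open>LPhi M\<close> and passes the same
  tests, and uniqueness there identifies the two.\<close>

lemma poisson_transfer_op_L1:
  assumes f: "f \<in> L1 M"
  shows "poisson_transfer_op M T f \<in> L1 M" "AE x in M. poisson_transfer_op M T f x = transfer_op M T f x"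
proof -
  have fP: "f \<in> LPhi M"
    using f L1_subset_LPhi by blast
  obtain v where v: "v \<in> L1 M" "\<And>g. g \<in> Linfty M \<Longrightarrow> (\<integral>x. v x * g x \<partial>M) = (\<integral>x. f x * g (T x) \<partial>M)"
    using f by (rule ex_L1_transfer) auto
  have vP: "v \<in> LPhi M"
    using v(1) L1_subset_LPhi by blast
  have eq: "AE x in M. poisson_transfer_op M T f x = v x"
    by (rule LPhi_eq_AE_if_dual_eq[OF poisson_transfer_op(1)[OF fP] vP])
      (use poisson_transfer_op(2)[OF fP] v(2) in auto)
  have "integrable M (poisson_transfer_op M T f)"
    by (rule integrable_cong_AE_imp[of _ v])
      (use v(1) eq LPhi_measurable[OF poisson_transfer_op(1)[OF fP]] in \<open>auto simp: L1_def\<close>)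
  then show "poisson_transfer_op M T f \<in> L1 M"
    by (simp add: L1_def)
  show "AE x in M. poisson_transfer_op M T f x = transfer_op M T f x"
  proof -
    have "AE x in M. transfer_op M T f x = v x"
      by (rule transfer_op_unique(2)) (use v in auto)
    with eq show ?thesis
      by eventually_elim simp
  qed
qed

end

theorem proposition34:
  fixes M :: "'a measure" and P :: "'a measure measure" and T :: "'a \<Rightarrow> 'a"
  assumes "lebesgue_line_space M"
    and "poisson_measure M P"
    and "endomorphism M T"
  shows "(\<forall>F\<in>I1_space M P. transfer_op P (poisson_suspension M T) F \<in> I1_space M P) \<and>
    (\<forall>f\<in>LPhi M. AE \<omega> in P.
       transfer_op P (poisson_suspension M T) (I1 M P f) \<omega> =
         I1 M P (poisson_transfer_op M T f) \<omega>) \<and>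
    (\<forall>f\<in>L1 M. poisson_transfer_op M T f \<in> L1 M \<and>
       (AE x in M. poisson_transfer_op M T f x = transfer_op M T f x))"
proof -
  interpret sigma_finite_measure M
    by (rule lebesgue_line_space_sigma_finite[OF assms(1)])
  interpret poisson_suspension_space M P T
    by unfold_locales (use assms in auto)
  show ?thesis
  proof (intro conjI ballI)
    fix F assume "F \<in> I1_space M P"
    then obtain f where f: "f \<in> LPhi M" and F: "F \<in> borel_measurable P" "AE \<omega> in P. F \<omega> = I1 M P f \<omega>"
      by (auto simp: I1_space_def)
    show "transfer_op P S F \<in> I1_space M P"
      unfolding I1_space_def
      using transfer_op_I1[OF f F] poisson_transfer_op(1)[OF f] by blast
  next
    fix f assume "f \<in> LPhi M"
    then show "AE \<omega> in P. transfer_op P S (I1 M P f) \<omega> = I1 M P (poisson_transfer_op M T f) \<omega>"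
      by (intro transfer_op_I1(2) I1_approx(1)) auto
  qed (auto intro: poisson_transfer_op_L1)
qed

end
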